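(* Let $G(\lambda)$ be real symmetric with $\mathcal S(\lambda)=\left[\begin{array}{c|c}P(\lambda)&B^T\\ \hline B&A-\lambda E\end{array}\right]$ the system matrix of a minimal symmetric realization $G(\lambda)=P(\lambda)+B^T(\lambda E-A)^{-1}B$. Let $0\le h\le m-1$ be even, with $A_m$ nonsingular in case $m$ is even, and let $\mathbb L(\lambda)=\mathbb L_{\mathcal S}(h,\mathbf t_{w_h},\mathbf t_{v_h},\mathcal X,\mathcal Y)$, where $\mathcal X,\mathcal Y$ are nonsingular matrix assignments all of whose matrices are symmetric, be the associated symmetric Rosenbrock strong linearization of $G(\lambda)$. Let $\mathbb G(\lambda)=L(\lambda)+(e_{m-\alpha}\otimes B^T)(\lambda E-A)^{-1}(e_{m-\alpha}^T\otimes B)$ be the transfer function of $\mathbb L(\lambda)$, where $\alpha=i_0(\mathbf t_{w_h},\mathbf w_h)$ and $L(\lambda)=L_P(h,\mathbf t_{w_h},\mathbf t_{v_h},\mathcal X,\mathcal Y)$. Then $\mathbb G(\lambda)$ is real and symmetric and has the same Cauchy–Maslov index as $G(\lambda)$, that is, $\mathbf{Ind}_{\mathrm{CM}}(G)=\mathbf{Ind}_{\mathrm{CM}}(\mathbb G)$.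
   Context: Cauchy–Maslov index: for a real symmetric rational matrix $F(\lambda)$ (entries are rational functions with real coefficients, $F(\lambda)^T=F(\lambda)$), $\mathbf{Ind}_{\mathrm{CM}}(F)$ is the number of eigenvalues of $F(\lambda)$ that jump from $-\infty$ to $+\infty$ minus the number of eigenvalues of $F(\lambda)$ that jump from $+\infty$ to $-\infty$, as the real parameter $\lambda$ traverses from $-\infty$ to $+\infty$. Setting: $G(\lambda)$ is $n\times n$, $P(\lambda)=\sum_{i=0}^m\lambda^iA_i$ with $A_m\ne0$; the realization $G(\lambda)=P(\lambda)+B^T(\lambda E-A)^{-1}B$ is minimal (the size $r$ of the pencil $\lambda E-A$ is smallest among all realizations of $G$) with $A,E$ symmetric $r\times r$, $E$ nonsingular, $B$ of size $r\times n$. Below $C:=B^T$. $e_j$ is the $j$-th column of $I_m$, and $\otimes$ is the Kronecker product. Elementary matrices: for a matrix $X\in\mathbb C^{n\times n}$, $M_0(X)=\mathrm{diag}(I_{(m-1)n},X)$, $M_{-m}(X)=\mathrm{diag}(X,I_{(m-1)n})$, and for $1\le i\le m-1$, $M_i(X)=\mathrm{diag}\big(I_{(m-i-1)n},\begin{bmatrix}X&I_n\\ I_n&0\end{bmatrix},I_{(i-1)n}\big)$, $M_{-i}(X)=\mathrm{diag}\big(I_{(m-i-1)n},\begin{bmatrix}0&I_n\\ I_n&X\end{bmatrix},I_{(i-1)n}\big)$. For $i\in\{-m,\dots,m-1\}$: $\mathbb M_i(X)=\mathrm{diag}(M_i(X),I_r)$; $M_i^P=M_i(-A_i)$ if $i\ge0$,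 $M_i^P=M_i(A_{-i})$ if $i<0$; $\mathbb M_i^P=\mathrm{diag}(M_i^P,I_r)$. Fiedler matrices: $\mathbb M_0^{\mathcal S}=\left[\begin{array}{c|c}M_0^P&-e_m\otimes C\\ \hline -e_m^T\otimes B&-A\end{array}\right]$, $\mathbb M_{-m}^{\mathcal S}=\mathrm{diag}(M_{-m}^P,-E)$, $\mathbb M_i^{\mathcal S}=\mathrm{diag}(M_i^P,I_r)$ and $\mathbb M_{-i}^{\mathcal S}=(\mathbb M_i^{\mathcal S})^{-1}$ for $1\le i\le m-1$. Index tuples: $(a:b)=(a,a+1,\dots,b)$ if $a\le b$, empty otherwise; tuples separated by commas are concatenated; $\mathbf t+k$ adds $k$ to each entry; $\mathrm{rev}$ reverses a tuple. A matrix assignment for $\mathbf t=(t_1,\dots,t_k)$ is a tuple $X=(X_1,\dots,X_k)$ of $n\times n$ matrices; it is nonsingular if the matrices at positions occupied by indices $0$ and $-m$ are nonsingular. $M_{\mathbf t}(X)=\prod_jM_{t_j}(X_j)$, $\mathbb M_{\mathbf t}(X)=\prod_j\mathbb M_{t_j}(X_j)$, and $M^P_{\mathbf t},\mathbb M^P_{\mathbf t},\mathbb M^{\mathcal S}_{\mathbf t}$ are the corresponding ordered products. For a tuple $\beta$ of nonnegative indices with $0\in\beta$, $i_0(\beta)$ is the largest $p\ge0$ such that $(p,\dots,1,0)$ is a subtuple of $\beta$ (obtained by deleting entries). Admissible tuples: an admissible tuple of $\{0:k\}$ with index $p$, $0\le p\le k$, $k-p$ even, is $\mathbf w=(k-1:k,\,k-3:k-2,\dots,p+1:p+2,\,0:p)$;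 it is simple if $p\in\{0,1\}$ ($p=0$ for $k$ even, $p=1$ for $k$ odd). Its symmetric complement is $\mathbf c_w=(k-1,k-3,\dots,p+3,p+1,(0:p)_{rev_c})$ if $p\ge1$, where $(0:p)_{rev_c}=(0:p-1,0:p-2,\dots,0:1,0)$; $\mathbf c_w=(k-1,k-3,\dots,1)$ if $p=0,k>0$; $\mathbf c_w=\emptyset$ if $k=0$. A tuple is in canonical form for $k\ge0$ if it is $(a_1:k-2,a_2:k-4,\dots,a_{\lfloor k/2\rfloor}:k-2\lfloor k/2\rfloor)$ with all $a_i\ge0$ (empty for $k=0,1$). The pencils: $\mathbf w_h$ and $\mathbf v_h+m$ are the simple admissible tuples of $\{0:h\}$ and $\{0:m-h-1\}$, $\mathbf c_{w_h}$ and $\mathbf c_{v_h}+m$ their symmetric complements, $\mathbf t_{w_h}$ and $\mathbf t_{v_h}+m$ are any tuples in canonical form for $h$ and $m-h-1$, and $\mathcal X,\mathcal Y$ are matrix assignments for $\mathbf t_{w_h},\mathbf t_{v_h}$. Then $L_P(h,\mathbf t_{w_h},\mathbf t_{v_h},\mathcal X,\mathcal Y)=M_{(\mathbf t_{v_h},\mathbf t_{w_h})}(\mathcal Y,\mathcal X)(\lambda M^P_{\mathbf v_h}-M^P_{\mathbf w_h})M^P_{(\mathbf c_{w_h},\mathbf c_{v_h})}M_{(\mathrm{rev}(\mathbf t_{w_h}),\mathrm{rev}(\mathbf t_{v_h}))}(\mathrm{rev}(\mathcal X),\mathrm{rev}(\mathcal Y))$ and $\mathbb L_{\mathcal S}(h,\mathbf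 t_{w_h},\mathbf t_{v_h},\mathcal X,\mathcal Y)=\mathbb M_{(\mathbf t_{v_h},\mathbf t_{w_h})}(\mathcal Y,\mathcal X)(\lambda\mathbb M^{\mathcal S}_{\mathbf v_h}-\mathbb M^{\mathcal S}_{\mathbf w_h})\mathbb M^P_{(\mathbf c_{w_h},\mathbf c_{v_h})}\mathbb M_{(\mathrm{rev}(\mathbf t_{w_h}),\mathrm{rev}(\mathbf t_{v_h}))}(\mathrm{rev}(\mathcal X),\mathrm{rev}(\mathcal Y))$; moreover $\mathbb L_{\mathcal S}=\left[\begin{array}{c|c}L_P&e_{m-\alpha}\otimes B^T\\ \hline e^T_{m-\alpha}\otimes B&A-\lambda E\end{array}\right]$ for even $h$. Rosenbrock strong linearization: an irreducible $(mn+r)\times(mn+r)$ system matrix $\mathbb L(\lambda)=\left[\begin{array}{c|c}\mathcal A_1-\lambda\mathcal A_2&\mathcal C\\ \hline \mathcal B&H-\lambda K\end{array}\right]$ with $K$ an $r\times r$ nonsingular matrix (irreducible: $[\mathcal B\;\; H-\lambda K]$ and $[\mathcal C^T\;\;(H-\lambda K)^T]^T$ have rank $r$ for all $\lambda\in\mathbb C$) such that (a) $\mathrm{diag}(U(\lambda),U_0)\,\mathbb L(\lambda)\,\mathrm{diag}(V(\lambda),V_0)=\mathrm{diag}(I_{(m-1)n},\mathcal S(\lambda))$ for some $mn\times mn$ unimodular matrix polynomials $U,V$ (determinant a nonzero constant) and nonsingular constant $r\times r$ matrices $U_0,V_0$; and (b) $\mathcal O_\ell(\lambda)\,\lambda^{-1}\mathbb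 G(\lambda)\,\mathcal O_r(\lambda)=\mathrm{diag}(I_{(m-1)n},\lambda^{-m}G(\lambda))$ for some $mn\times mn$ biproper rational matrices $\mathcal O_\ell,\mathcal O_r$ (having a finite nonsingular limit as $\lambda\to\infty$), where $\mathbb G(\lambda)=\mathcal A_1-\lambda\mathcal A_2+\mathcal C(\lambda K-H)^{-1}\mathcal B$ is the transfer function of $\mathbb L(\lambda)$. For the data in the claim, $\mathbb L(\lambda)$ is a symmetric Rosenbrock strong linearization of $G(\lambda)$.
   Formalization: The symmetric matrices in the assignments X and Y are required to be real; with non-real symmetric assignments the transfer function need not be real (e.g. n=1, m=3, h=2, G=λ³, t_w=(0), X=(i)), so the claim would fail. *)

theory Defs
  imports
    Complex_Main
    "HOL-Library.Sublist"
    "HOL-Computational_Algebra.Field_as_Ring"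
    "HOL-Computational_Algebra.Polynomial_Factorial"
    "HOL-Computational_Algebra.Normalized_Fraction"
    "Jordan_Normal_Form.Char_Poly"
    "Jordan_Normal_Form.Gauss_Jordan_Elimination"
begin

section \<open>Matrices\<close>

definition mat_prod :: "nat \<Rightarrow> 'a :: semiring_1 mat list \<Rightarrow> 'a mat" where
  "mat_prod N Ms = foldr (*) Ms (1\<^sub>m N)"

text \<open>Only meaningful for nonsingular square matrices.\<close>

definition mat_inv :: "'a :: field mat \<Rightarrow> 'a mat" where
  "mat_inv A = the (mat_inverse A)"

definition kronecker :: "'a :: times mat \<Rightarrow> 'a mat \<Rightarrow> 'a mat" (infixl "\<otimes>\<^sub>K" 70) where
  "A \<otimes>\<^sub>K B = mat (dim_row A * dim_row B) (dim_col A * dim_col B)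
     (\<lambda>(i, j). A $$ (i div dim_row B, j div dim_col B) * B $$ (i mod dim_row B, j mod dim_col B))"

text \<open>The columns of the identity matrix are numbered from 1.\<close>

definition e_col :: "nat \<Rightarrow> nat \<Rightarrow> 'a :: zero_neq_one mat" where
  "e_col m j = mat m 1 (\<lambda>(i, _). if Suc i = j then 1 else 0)"

definition real_mat :: "complex mat \<Rightarrow> bool" where
  "real_mat X \<longleftrightarrow> (\<forall>i < dim_row X. \<forall>j < dim_col X. X $$ (i, j) \<in> \<real>)"

definition symmetric_matrix :: "'a mat \<Rightarrow> bool" where
  "symmetric_matrix X \<longleftrightarrow> transpose_mat X = X"

section \<open>Polynomial and rational matrices\<close>

text \<open>
  Matrix polynomials have type \<^typ>\<open>complex poly mat\<close> and rational matrices have type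
  \<^typ>\<open>complex poly fract mat\<close>; the variable \<open>\<lambda>\<close> is \<open>[:0, 1:]\<close>.
\<close>

definition const_mat :: "complex mat \<Rightarrow> complex poly mat" where
  "const_mat X = map_mat (\<lambda>c. [:c:]) X"

definition rat_mat :: "complex poly mat \<Rightarrow> complex poly fract mat" where
  "rat_mat X = map_mat to_fract X"

text \<open>The pencil \<open>\<lambda>X - Y\<close>.\<close>

definition pencil :: "complex mat \<Rightarrow> complex mat \<Rightarrow> complex poly mat" where
  "pencil X Y = [:0, 1:] \<cdot>\<^sub>m const_mat X - const_mat Y"

definition matrix_poly :: "nat \<Rightarrow> nat \<Rightarrow> (nat \<Rightarrow> complex mat) \<Rightarrow> complex poly mat" where
  "matrix_poly n m As = mat n n (\<lambda>(i, j). \<Sum>k\<le>m. monom (As k $$ (i, j)) k)"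

definition real_fract :: "complex poly fract \<Rightarrow> bool" where
  "real_fract f \<longleftrightarrow> (\<exists>p q :: real poly. q \<noteq> 0 \<and>
     f = Fract (map_poly complex_of_real p) (map_poly complex_of_real q))"

definition real_rational_mat :: "complex poly fract mat \<Rightarrow> bool" where
  "real_rational_mat F \<longleftrightarrow> (\<forall>i < dim_row F. \<forall>j < dim_col F. real_fract (F $$ (i, j)))"

section \<open>Realizations and system matrices\<close>

definition is_realization ::
  "nat \<Rightarrow> nat \<Rightarrow> complex poly fract mat \<Rightarrow> complex poly mat \<Rightarrow>
   complex mat \<Rightarrow> complex mat \<Rightarrow> complex mat \<Rightarrow> complex mat \<Rightarrow> bool" where
  "is_realization n r G P A E B C \<longleftrightarrow>
     P \<in> carrier_mat n n \<and> A \<in> carrier_mat r r \<and> E \<in> carrier_mat r r \<and> invertible_mat E \<and>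
     B \<in> carrier_mat r n \<and> C \<in> carrier_mat n r \<and>
     G = rat_mat P
       + rat_mat (const_mat C) * mat_inv (rat_mat (pencil E A)) * rat_mat (const_mat B)"

definition is_minimal_realization ::
  "nat \<Rightarrow> nat \<Rightarrow> complex poly fract mat \<Rightarrow> complex poly mat \<Rightarrow>
   complex mat \<Rightarrow> complex mat \<Rightarrow> complex mat \<Rightarrow> complex mat \<Rightarrow> bool" where
  "is_minimal_realization n r G P A E B C \<longleftrightarrow>
     is_realization n r G P A E B C \<and>
     (\<forall>r' P' A' E' B' C'. is_realization n r' G P' A' E' B' C' \<longrightarrow> r \<le> r')"

text \<open>
  The transfer function of a system matrix with blocks \<open>S11\<close> (of size \<open>N \<times> N\<close>),
  \<open>S12\<close>, \<open>S21\<close> and \<open>S22 = H - \<lambda>K\<close> is \<open>S11 + S12 (\<lambda>K - H)\<^sup>-\<^sup>1 S21\<close>.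
\<close>

definition transfer_function :: "nat \<Rightarrow> complex poly mat \<Rightarrow> complex poly fract mat" where
  "transfer_function N S = (case split_block S N N of (S11, S12, S21, S22) \<Rightarrow>
     rat_mat S11 + rat_mat S12 * mat_inv (rat_mat (- S22)) * rat_mat S21)"

section \<open>The Cauchy--Maslov index\<close>

text \<open>
  \<^term>\<open>quot_of_fract\<close> returns a coprime numerator and denominator, so the poles of an
  entry are the zeros of the denominator.
\<close>

definition has_pole :: "complex poly fract mat \<Rightarrow> real \<Rightarrow> bool" where
  "has_pole F t \<longleftrightarrow> (\<exists>i < dim_row F. \<exists>j < dim_col F.
     poly (snd (quot_of_fract (F $$ (i, j)))) (complex_of_real t) = 0)"

definition eval_mat :: "complex poly fract mat \<Rightarrow> real \<Rightarrow> complex mat" where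
  "eval_mat F t = map_mat (\<lambda>f. poly (fst (quot_of_fract f)) (complex_of_real t) /
                                  poly (snd (quot_of_fract f)) (complex_of_real t)) F"

text \<open>
  The eigenvalues of \<open>F(t)\<close>, counted with multiplicity, followed as \<open>t\<close> traverses the real
  line: every curve is continuous as a map into the projective line \<open>\<real> \<union> {\<infinity>}\<close>, the value
  \<open>\<infinity>\<close> being possible at poles of \<open>F\<close> only. (The value of \<open>\<mu> j\<close> at a point where the
  curve passes through \<open>\<infinity>\<close> is irrelevant.) Without continuity at the poles it would be
  undetermined which eigenvalue to the left of a pole continues which one to the right.
\<close>

definition eigenvalue_curves ::
  "complex poly fract mat \<Rightarrow> (nat \<Rightarrow> real \<Rightarrow> real) \<Rightarrow> bool" where
  "eigenvalue_curves F \<mu> \<longleftrightarrow>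
     (\<forall>t. \<not> has_pole F t \<longrightarrow>
        char_poly (eval_mat F t) = (\<Prod>j < dim_row F. [:- complex_of_real (\<mu> j t), 1:])) \<and>
     (\<forall>j < dim_row F. \<forall>t. isCont (\<mu> j) t \<or> filterlim (\<mu> j) at_infinity (at t))"

definition jumps_up :: "(real \<Rightarrow> real) \<Rightarrow> real \<Rightarrow> bool" where
  "jumps_up f t \<longleftrightarrow> filterlim f at_bot (at_left t) \<and> filterlim f at_top (at_right t)"

definition jumps_down :: "(real \<Rightarrow> real) \<Rightarrow> real \<Rightarrow> bool" where
  "jumps_down f t \<longleftrightarrow> filterlim f at_top (at_left t) \<and> filterlim f at_bot (at_right t)"

text \<open>
  If eigenvalue curves meet, there are several systems of curves, and the number of upward jumps
  depends on the system. The difference does not: at each \<open>t\<close> it is the number of eigenvalues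
  tending to \<open>+\<infinity>\<close> from the right minus the number of those tending to \<open>+\<infinity>\<close> from
  the left.
\<close>

definition Ind_CM :: "complex poly fract mat \<Rightarrow> int" where
  "Ind_CM F = (THE c. \<exists>\<mu>. eigenvalue_curves F \<mu> \<and>
     c = int (card {(j, t). j < dim_row F \<and> jumps_up (\<mu> j) t})
       - int (card {(j, t). j < dim_row F \<and> jumps_down (\<mu> j) t}))"

section \<open>Index tuples\<close>

text \<open>Tuples are lists of integers; the tuple \<open>(a:b)\<close> is \<open>[a..b]\<close>.\<close>

definition shift_tuple :: "int \<Rightarrow> int list \<Rightarrow> int list" where
  "shift_tuple k ts = map (\<lambda>i. i + k) ts"

definition i_zero :: "int list \<Rightarrow> nat" where
  "i_zero \<beta> = (GREATEST p. subseq (rev [0..int p]) \<beta>)"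

definition admissible_tuple :: "nat \<Rightarrow> nat \<Rightarrow> int list" where
  "admissible_tuple k p =
     concat (map (\<lambda>j. [int k - 2 * int j - 1..int k - 2 * int j]) [0..<(k - p) div 2])
     @ [0..int p]"

definition symmetric_complement :: "nat \<Rightarrow> nat \<Rightarrow> int list" where
  "symmetric_complement k p =
     map (\<lambda>j. int k - 1 - 2 * int j) [0..<(k - p) div 2]
     @ concat (map (\<lambda>j. [0..int p - 1 - int j]) [0..<p])"

text \<open>The simple admissible tuple has index 0 for even \<open>k\<close> and index 1 for odd \<open>k\<close>.\<close>

definition simple_admissible :: "nat \<Rightarrow> int list" where
  "simple_admissible k = admissible_tuple k (k mod 2)"

definition simple_complement :: "nat \<Rightarrow> int list" where
  "simple_complement k = symmetric_complement k (k mod 2)"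

definition canonical_form :: "nat \<Rightarrow> int list \<Rightarrow> bool" where
  "canonical_form k ts \<longleftrightarrow> (\<exists>a :: nat \<Rightarrow> int. (\<forall>l \<in> {1..k div 2}. 0 \<le> a l) \<and>
     ts = concat (map (\<lambda>l. [a l..int k - 2 * int l]) [1..<Suc (k div 2)]))"

definition w_tuple :: "nat \<Rightarrow> int list" where
  "w_tuple h = simple_admissible h"

definition v_tuple :: "nat \<Rightarrow> nat \<Rightarrow> int list" where
  "v_tuple m h = shift_tuple (- int m) (simple_admissible (m - h - 1))"

definition cw_tuple :: "nat \<Rightarrow> int list" where
  "cw_tuple h = simple_complement h"

definition cv_tuple :: "nat \<Rightarrow> nat \<Rightarrow> int list" where
  "cv_tuple m h = shift_tuple (- int m) (simple_complement (m - h - 1))"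

section \<open>Matrix assignments and Fiedler matrices\<close>

definition matrix_assignment :: "nat \<Rightarrow> int list \<Rightarrow> complex mat list \<Rightarrow> bool" where
  "matrix_assignment n ts Xs \<longleftrightarrow> length Xs = length ts \<and> set Xs \<subseteq> carrier_mat n n"

definition nonsingular_assignment :: "nat \<Rightarrow> nat \<Rightarrow> int list \<Rightarrow> complex mat list \<Rightarrow> bool" where
  "nonsingular_assignment n m ts Xs \<longleftrightarrow> matrix_assignment n ts Xs \<and>
     (\<forall>j < length ts. ts ! j = 0 \<or> ts ! j = - int m \<longrightarrow> invertible_mat (Xs ! j))"

definition elem_mat :: "nat \<Rightarrow> nat \<Rightarrow> int \<Rightarrow> complex mat \<Rightarrow> complex mat" where
  "elem_mat n m i X =
     (if i = 0 then diag_block_mat [1\<^sub>m ((m - 1) * n), X]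
      else if i = - int m then diag_block_mat [X, 1\<^sub>m ((m - 1) * n)]
      else if i > 0 then
        diag_block_mat [1\<^sub>m ((m - nat i - 1) * n),
          four_block_mat X (1\<^sub>m n) (1\<^sub>m n) (0\<^sub>m n n), 1\<^sub>m ((nat i - 1) * n)]
      else
        diag_block_mat [1\<^sub>m ((m - nat (- i) - 1) * n),
          four_block_mat (0\<^sub>m n n) (1\<^sub>m n) (1\<^sub>m n) X, 1\<^sub>m ((nat (- i) - 1) * n)])"

definition fiedler_P :: "nat \<Rightarrow> nat \<Rightarrow> (nat \<Rightarrow> complex mat) \<Rightarrow> int \<Rightarrow> complex mat" where
  "fiedler_P n m As i =
     (if i \<ge> 0 then elem_mat n m i (- As (nat i)) else elem_mat n m i (As (nat (- i))))"

text \<open>The passage from \<open>M\<close> to the corresponding matrix of size \<open>mn + r\<close>.\<close>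

definition extend_mat :: "nat \<Rightarrow> complex mat \<Rightarrow> complex mat" where
  "extend_mat r M = diag_block_mat [M, 1\<^sub>m r]"

definition fiedler_S ::
  "nat \<Rightarrow> nat \<Rightarrow> nat \<Rightarrow> (nat \<Rightarrow> complex mat) \<Rightarrow> complex mat \<Rightarrow> complex mat \<Rightarrow>
   complex mat \<Rightarrow> int \<Rightarrow> complex mat" where
  "fiedler_S n m r As A E B i =
     (if i = 0 then
        four_block_mat (fiedler_P n m As 0) (- (e_col m m \<otimes>\<^sub>K transpose_mat B))
                       (- (transpose_mat (e_col m m) \<otimes>\<^sub>K B)) (- A)
      else if i = - int m then diag_block_mat [fiedler_P n m As i, - E]
      else if i > 0 then extend_mat r (fiedler_P n m As i)
      else mat_inv (extend_mat r (fiedler_P n m As (- i))))"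

definition elem_prod :: "nat \<Rightarrow> nat \<Rightarrow> int list \<Rightarrow> complex mat list \<Rightarrow> complex mat" where
  "elem_prod n m ts Xs = mat_prod (m * n) (map2 (elem_mat n m) ts Xs)"

definition ext_elem_prod ::
  "nat \<Rightarrow> nat \<Rightarrow> nat \<Rightarrow> int list \<Rightarrow> complex mat list \<Rightarrow> complex mat" where
  "ext_elem_prod n m r ts Xs =
     mat_prod (m * n + r) (map2 (\<lambda>i X. extend_mat r (elem_mat n m i X)) ts Xs)"

definition fiedler_P_prod ::
  "nat \<Rightarrow> nat \<Rightarrow> (nat \<Rightarrow> complex mat) \<Rightarrow> int list \<Rightarrow> complex mat" where
  "fiedler_P_prod n m As ts = mat_prod (m * n) (map (fiedler_P n m As) ts)"

definition ext_fiedler_P_prod ::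
  "nat \<Rightarrow> nat \<Rightarrow> nat \<Rightarrow> (nat \<Rightarrow> complex mat) \<Rightarrow> int list \<Rightarrow> complex mat" where
  "ext_fiedler_P_prod n m r As ts =
     mat_prod (m * n + r) (map (\<lambda>i. extend_mat r (fiedler_P n m As i)) ts)"

definition fiedler_S_prod ::
  "nat \<Rightarrow> nat \<Rightarrow> nat \<Rightarrow> (nat \<Rightarrow> complex mat) \<Rightarrow> complex mat \<Rightarrow> complex mat \<Rightarrow>
   complex mat \<Rightarrow> int list \<Rightarrow> complex mat" where
  "fiedler_S_prod n m r As A E B ts = mat_prod (m * n + r) (map (fiedler_S n m r As A E B) ts)"

section \<open>The block symmetric pencils\<close>

definition L_P ::
  "nat \<Rightarrow> nat \<Rightarrow> (nat \<Rightarrow> complex mat) \<Rightarrow> nat \<Rightarrow> int list \<Rightarrow> int list \<Rightarrow>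
   complex mat list \<Rightarrow> complex mat list \<Rightarrow> complex poly mat" where
  "L_P n m As h tw tv Xs Ys =
     const_mat (elem_prod n m (tv @ tw) (Ys @ Xs))
     * pencil (fiedler_P_prod n m As (v_tuple m h)) (fiedler_P_prod n m As (w_tuple h))
     * const_mat (fiedler_P_prod n m As (cw_tuple h @ cv_tuple m h))
     * const_mat (elem_prod n m (rev tw @ rev tv) (rev Xs @ rev Ys))"

definition L_S ::
  "nat \<Rightarrow> nat \<Rightarrow> nat \<Rightarrow> (nat \<Rightarrow> complex mat) \<Rightarrow> complex mat \<Rightarrow> complex mat \<Rightarrow>
   complex mat \<Rightarrow> nat \<Rightarrow> int list \<Rightarrow> int list \<Rightarrow>
   complex mat list \<Rightarrow> complex mat list \<Rightarrow> complex poly mat" where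
  "L_S n m r As A E B h tw tv Xs Ys =
     const_mat (ext_elem_prod n m r (tv @ tw) (Ys @ Xs))
     * pencil (fiedler_S_prod n m r As A E B (v_tuple m h))
              (fiedler_S_prod n m r As A E B (w_tuple h))
     * const_mat (ext_fiedler_P_prod n m r As (cw_tuple h @ cv_tuple m h))
     * const_mat (ext_elem_prod n m r (rev tw @ rev tv) (rev Xs @ rev Ys))"

end

theory Submission
  imports
    Defs
    "Jordan_Normal_Form.Schur_Decomposition"
    "HOL-Combinatorics.Permutations"
begin

text \<open>
  Write \<open>G = P + S\<close> with the strictly proper part \<open>S = B\<^sup>T (\<lambda>E - A)\<^sup>-\<^sup>1 B\<close>. In the block form of the
  pencil (\<open>L_S_eq\<close>) the off-diagonal blocks are \<open>e\<^bsub>m-\<alpha>\<^esub> \<otimes> B\<^sup>T\<close> and its transpose, and the lower diagonal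
  block is \<open>A - \<lambda>E\<close>. Hence the transfer function is \<open>L + J S J\<^sup>T\<close>, where \<open>J = e\<^bsub>m-\<alpha>\<^esub> \<otimes> I\<^sub>n\<close> has
  orthonormal columns. Both \<open>G\<close> and the transfer function are thus the sum of a polynomial and of
  the same matrix \<open>S\<close>, up to an isometric embedding. The index depends only on how many eigenvalues
  tend to \<open>+\<infinity>\<close> on either side of every real point. There polynomials are bounded, and
  bounded perturbations and the zero eigenvalues added by the embedding do not change these
  numbers (\<open>eig_dominated_compression\<close>, which rests on \<open>inertia_comparison\<close>). So the indices are
  equal.

  The index is defined through systems of eigenvalue curves, which have to exist for both matrices
  (\<open>eigenvalue_curves_exist\<close>). Between poles the sorted eigenvalues are continuous by Weyl's
  inequality. At a pole, the characteristic polynomial, suitably scaled, has a nonzero limit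
  that is the same from both sides. Seen on the projective line, the eigenvalues therefore
  have the same limits with the same multiplicities on both sides, and a permutation continues
  the curves across the pole (\<open>pole_link\<close>). For any system of curves, the number of upward jumps
  minus the number of downward jumps is a sum over the poles of differences of the
  numbers above (\<open>jump_difference\<close>), so it does not depend on the system (\<open>Ind_CM_eqI\<close>).

  Real and symmetric coefficients of \<open>P\<close> come from the uniqueness of the decomposition of \<open>G\<close> into a
  polynomial and a strictly proper part (\<open>realization_parts\<close>). The pencil \<open>L\<close> is
  symmetric because moving commuting elementary matrices turns its core into nested
  products \<open>M X M\<close> with \<open>M\<close> and \<open>X\<close> symmetric (\<open>palindromic_symmetric\<close>). For the off-diagonal blocks,
  one follows the position of a block column \<open>e\<^bsub>m-j\<^esub> \<otimes> B\<^sup>T\<close>: an elementary matrix with index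
  \<open>j + 1\<close> raises \<open>j\<close> by one, and the other indices that occur leave it fixed. This is the greedy
  search for the longest subtuple \<open>(p, \<dots>, 1, 0)\<close>, whose result is \<open>\<alpha>\<close> (\<open>subseq_climb\<close>, \<open>Q_col\<close>).
\<close>

section \<open>The spectral theorem and comparison of inertia\<close>

definition adjoint_mat :: "complex mat \<Rightarrow> complex mat" where
  "adjoint_mat A = mat (dim_col A) (dim_row A) (\<lambda>(i, j). cnj (A $$ (j, i)))"

definition hermitian_mat :: "complex mat \<Rightarrow> bool" where
  "hermitian_mat A \<longleftrightarrow> adjoint_mat A = A"

definition diag_real :: "nat \<Rightarrow> (nat \<Rightarrow> real) \<Rightarrow> complex mat" where
  "diag_real n \<alpha> = mat n n (\<lambda>(i, j). if i = j then complex_of_real (\<alpha> i) else 0)"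

lemma diag_real_carrier [simp]: "diag_real n \<alpha> \<in> carrier_mat n n"
  by (simp add: diag_real_def)

lemma adjoint_mat_carrier [simp]: "A \<in> carrier_mat m n \<Longrightarrow> adjoint_mat A \<in> carrier_mat n m"
  by (auto simp: adjoint_mat_def)

lemma adjoint_mat_adjoint [simp]: "adjoint_mat (adjoint_mat A) = A"
  by (rule eq_matI) (auto simp: adjoint_mat_def)

lemma adjoint_mat_one [simp]: "adjoint_mat (1\<^sub>m n) = 1\<^sub>m n"
  by (rule eq_matI) (auto simp: adjoint_mat_def)

lemma adjoint_mat_mult:
  assumes "A \<in> carrier_mat m n" "B \<in> carrier_mat n k"
  shows "adjoint_mat (A * B) = adjoint_mat B * adjoint_mat A"
  using assms
  by (intro eq_matI) (auto simp: adjoint_mat_def scalar_prod_def mult.commute intro!: sum.cong)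

lemma adjoint_mat_inner:
  assumes A: "A \<in> carrier_mat m n" and x: "x \<in> carrier_vec n" and y: "y \<in> carrier_vec m"
  shows "(A *\<^sub>v x) \<bullet>c y = x \<bullet>c (adjoint_mat A *\<^sub>v y)"
proof -
  have "(A *\<^sub>v x) \<bullet>c y = (\<Sum>i<m. \<Sum>j<n. A $$ (i,j) * x $ j * cnj (y $ i))"
    using assms
    by (auto simp: scalar_prod_def mult_mat_vec_def sum_distrib_right atLeast0LessThan intro!: sum.cong)
  also have "\<dots> = (\<Sum>j<n. \<Sum>i<m. A $$ (i,j) * x $ j * cnj (y $ i))"
    by (rule sum.swap)
  also have "\<dots> = x \<bullet>c (adjoint_mat A *\<^sub>v y)"
    using assms
    by (auto simp: scalar_prod_def mult_mat_vec_def adjoint_mat_def sum_distrib_left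
        atLeast0LessThan mult_ac intro!: sum.cong)
  finally show ?thesis .
qed

lemma hermitian_congruence:
  assumes "A \<in> carrier_mat n n" "hermitian_mat A" "W \<in> carrier_mat n k"
  shows "hermitian_mat (adjoint_mat W * A * W)"
  using assms unfolding hermitian_mat_def
  by (simp add: adjoint_mat_mult[of _ k n] adjoint_mat_mult[of _ n n] adjoint_mat_mult[of _ k n _ k] assoc_mult_mat[of _ k n _ n _ k] adjoint_mat_mult[where m = k and n = n and k = n])

lemma csqnorm_real: "v \<bullet>c v = complex_of_real (\<Sum>i<dim_vec v. (cmod (v $ i))\<^sup>2)"
  for v :: "complex vec"
  by (auto simp: scalar_prod_def atLeast0LessThan complex_norm_square intro!: sum.cong
      simp del: of_real_power)

text \<open>
  Gram--Schmidt applied to a basis that starts with \<open>v\<close> leaves the first vector alone, so only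
  the normalization changes it; hence the scalar \<open>c\<close>.
\<close>

lemma unitary_with_first_column:
  fixes v :: "complex vec"
  assumes v: "v \<in> carrier_vec n" "v \<noteq> 0\<^sub>v n"
  shows "\<exists>W c. W \<in> carrier_mat n n \<and> adjoint_mat W * W = 1\<^sub>m n \<and> c \<noteq> 0 \<and> col W 0 = c \<cdot>\<^sub>v v"
proof -
  interpret cof_vec_space n "TYPE(complex)" .
  define b where "b = basis_completion v"
  define ws where "ws = gram_schmidt n b"
  have n: "n \<noteq> 0" using v by (auto)
  from basis_completion[OF v, folded b_def]
  have dist_b: "distinct b" and indep: "\<not> lin_dep (set b)" and b: "set b \<subseteq> carrier_vec n"
    and hdb: "hd b = v" and len_b: "length b = n" by auto
  from hdb len_b n obtain vs where bv: "b = v # vs" by (cases b, auto)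
  from gram_schmidt_result[OF b dist_b indep refl, folded ws_def]
  have ws: "set ws \<subseteq> carrier_vec n" "corthogonal ws" "length ws = n" by (auto simp: len_b)
  from gram_schmidt_hd[OF v(1), of vs, folded bv] have hdws: "hd ws = v" unfolding ws_def .
  define N where "N j = sqrt (\<Sum>i<n. (cmod (ws ! j $ i))\<^sup>2)" for j
  have wsc: "j < n \<Longrightarrow> ws ! j \<in> carrier_vec n" for j using ws by auto
  have N2: "ws ! j \<bullet>c ws ! j = complex_of_real (N j ^ 2)" if "j < n" for j
    using wsc[OF that] by (subst csqnorm_real) (auto simp: N_def sum_nonneg)
  have N0: "N j \<noteq> 0" if "j < n" for j
    using corthogonalD[OF ws(2), of j j] that ws(3) N2[OF that] by auto
  define W where "W = mat n n (\<lambda>(i,j). ws ! j $ i / complex_of_real (N j))"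
  have W: "W \<in> carrier_mat n n" by (simp add: W_def)
  have "adjoint_mat W * W = 1\<^sub>m n"
  proof (rule eq_matI)
    fix i j assume "i < dim_row (1\<^sub>m n :: complex mat)" "j < dim_col (1\<^sub>m n :: complex mat)"
    hence ij: "i < n" "j < n" by auto
    have "(adjoint_mat W * W) $$ (i,j) =
        (\<Sum>k<n. cnj (ws ! i $ k) * ws ! j $ k) / complex_of_real (N i * N j)"
      using ij by (auto simp: adjoint_mat_def W_def scalar_prod_def atLeast0LessThan
          sum_divide_distrib)
    also have "(\<Sum>k<n. cnj (ws ! i $ k) * ws ! j $ k) = ws ! j \<bullet>c ws ! i"
      using wsc[OF ij(1)] wsc[OF ij(2)]
      by (auto simp: scalar_prod_def atLeast0LessThan mult_ac)
    also have "\<dots> = (if i = j then complex_of_real (N i * N j) else 0)"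
      using corthogonalD[OF ws(2), of j i] ij ws(3) N2 by (auto simp: power2_eq_square)
    finally show "(adjoint_mat W * W) $$ (i,j) = 1\<^sub>m n $$ (i,j)"
      using ij N0 by auto
  qed (auto simp: W_def adjoint_mat_def)
  moreover have "ws ! 0 = v" using hdws ws(3) n by (cases ws) auto
  hence "col W 0 = (1 / complex_of_real (N 0)) \<cdot>\<^sub>v v"
    using n v by (intro eq_vecI) (auto simp: W_def)
  ultimately show ?thesis using W N0[of 0] n by (intro exI[of _ W] exI[of _ "1 / complex_of_real (N 0)"]) auto
qed

text \<open>
  Induction on the size. A unitary change of basis whose first vector is an eigenvector makes
  the first column a multiple of the first unit vector; as the matrix stays hermitian, the first
  row has the same shape, the eigenvalue is real and a smaller hermitian block remains.
\<close>

theorem hermitian_diagonalization: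
  assumes "A \<in> carrier_mat n n" "hermitian_mat A"
  shows "\<exists>U \<alpha>. U \<in> carrier_mat n n \<and> adjoint_mat U * U = 1\<^sub>m n
    \<and> adjoint_mat U * A * U = diag_real n \<alpha>"
  using assms
proof (induction n arbitrary: A)
  case 0
  show ?case
    by (rule exI[of _ "1\<^sub>m 0"]) (use 0 in \<open>auto simp: diag_real_def intro!: eq_matI\<close>)
next
  case (Suc k)
  note A = Suc.prems(1)
  obtain as where as: "char_poly A = (\<Prod>a\<leftarrow>as. [:- a, 1:])" "length as = Suc k"
    using char_poly_factorized[OF A] by auto
  then obtain e where "poly (char_poly A) e = 0" by (cases as) auto
  then obtain v where "eigenvector A v e"
    using eigenvalue_root_char_poly[OF A] unfolding eigenvalue_def by auto
  hence v: "v \<in> carrier_vec (Suc k)" "v \<noteq> 0\<^sub>v (Suc k)" "A *\<^sub>v v = e \<cdot>\<^sub>v v"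
    using A unfolding eigenvector_def by auto
  from unitary_with_first_column[OF v(1,2)] obtain W c where
    W: "W \<in> carrier_mat (Suc k) (Suc k)" "adjoint_mat W * W = 1\<^sub>m (Suc k)" and
    c: "c \<noteq> 0" and col0: "col W 0 = c \<cdot>\<^sub>v v" by blast
  define C where "C = adjoint_mat W * A * W"
  have C: "C \<in> carrier_mat (Suc k) (Suc k)" using A W unfolding C_def
    by (meson adjoint_mat_carrier mult_carrier_mat)
  have hC: "hermitian_mat C" unfolding C_def by (rule hermitian_congruence[OF A Suc.prems(2) W(1)])
  have hC': "C $$ (i,j) = cnj (C $$ (j,i))" if "i < Suc k" "j < Suc k" for i j
  proof -
    have "C $$ (i,j) = adjoint_mat C $$ (i,j)" using hC by (simp add: hermitian_mat_def)
    thus ?thesis using that C by (simp add: adjoint_mat_def)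
  qed
  have "col C 0 = adjoint_mat W *\<^sub>v (A *\<^sub>v col W 0)"
  proof -
    have "C = adjoint_mat W * (A * W)" unfolding C_def
      using A W by (simp add: assoc_mult_mat[of _ "Suc k" "Suc k" _ "Suc k" _ "Suc k"])
    thus ?thesis using A W by (metis adjoint_mat_carrier col_mult2 mult_carrier_mat zero_less_Suc)
  qed
  also have "A *\<^sub>v col W 0 = e \<cdot>\<^sub>v col W 0"
    unfolding col0 using v A by (simp add: mult_mat_vec smult_smult_assoc mult.commute)
  also have "adjoint_mat W *\<^sub>v (e \<cdot>\<^sub>v col W 0) = e \<cdot>\<^sub>v (adjoint_mat W *\<^sub>v col W 0)"
    using W by (intro mult_mat_vec[of _ "Suc k" "Suc k"] col_carrier_vec adjoint_mat_carrier) auto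
  also have "adjoint_mat W *\<^sub>v col W 0 = col (adjoint_mat W * W) 0"
    using W by (metis adjoint_mat_carrier col_mult2 zero_less_Suc)
  also have "\<dots> = unit_vec (Suc k) 0" using W by simp
  finally have colC: "col C 0 = e \<cdot>\<^sub>v unit_vec (Suc k) 0" .
  have Ci0: "C $$ (i,0) = (if i = 0 then e else 0)" if "i < Suc k" for i
    using arg_cong[OF colC, of "\<lambda>v. v $ i"] that C by (auto simp: unit_vec_def)
  have C0i: "C $$ (0,i) = (if i = 0 then e else 0)" if "i < Suc k" for i
    using hC'[of 0 i] hC'[of i 0] Ci0[OF that] that by (cases "i = 0") auto
  have ereal: "e = complex_of_real (Re e)"
    using hC'[of 0 0] Ci0[of 0] by (simp add: complex_eq_iff)
  define C1 where "C1 = mat k k (\<lambda>(i,j). C $$ (Suc i, Suc j))"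
  have C1: "C1 \<in> carrier_mat k k" by (simp add: C1_def)
  have "hermitian_mat C1" unfolding hermitian_mat_def
    by (rule eq_matI, unfold C1_def adjoint_mat_def) (simp_all add: hC'[symmetric])
  from Suc.IH[OF C1 this] obtain U1 \<alpha>1 where
    U1: "U1 \<in> carrier_mat k k" "adjoint_mat U1 * U1 = 1\<^sub>m k" "adjoint_mat U1 * C1 * U1 = diag_real k \<alpha>1"
    by blast
  define V where "V = four_block_mat (1\<^sub>m 1) (0\<^sub>m 1 k) (0\<^sub>m k 1) U1"
  have V: "V \<in> carrier_mat (Suc k) (Suc k)" unfolding V_def using U1 by auto
  have aV: "adjoint_mat V = four_block_mat (1\<^sub>m 1) (0\<^sub>m 1 k) (0\<^sub>m k 1) (adjoint_mat U1)"
    using U1 by (intro eq_matI) (auto simp: V_def adjoint_mat_def)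
  have Cb: "C = four_block_mat (mat 1 1 (\<lambda>_. e)) (0\<^sub>m 1 k) (0\<^sub>m k 1) C1"
    using C C0i Ci0 by (intro eq_matI) (auto simp: C1_def)
  have aU1: "adjoint_mat U1 \<in> carrier_mat k k" using U1 by simp
  have aVV: "adjoint_mat V * V = 1\<^sub>m (Suc k)"
    unfolding aV unfolding V_def
    by (subst mult_four_block_mat[of _ 1 1 _ k _ k _ _ 1 _ k])
       (use U1 aU1 right_mult_zero_mat[OF aU1, of "Suc 0"] in \<open>auto\<close>)
  have VCV: "adjoint_mat V * C * V = four_block_mat (mat 1 1 (\<lambda>_. e)) (0\<^sub>m 1 k) (0\<^sub>m k 1) (diag_real k \<alpha>1)"
  proof -
    let ?e = "mat 1 1 (\<lambda>_. e)"
    have e: "?e \<in> carrier_mat 1 1" by simp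
    have aUC: "adjoint_mat U1 * C1 \<in> carrier_mat k k" using aU1 C1 by simp
    have "adjoint_mat V * C = four_block_mat ?e (0\<^sub>m 1 k) (0\<^sub>m k 1) (adjoint_mat U1 * C1)"
      unfolding aV Cb
      using right_mult_zero_mat[OF aU1, of "Suc 0"] C1 aUC
      by (subst mult_four_block_mat[OF one_carrier_mat zero_carrier_mat zero_carrier_mat aU1
            e zero_carrier_mat zero_carrier_mat C1]) auto
    hence *: "adjoint_mat V * C * V = four_block_mat ?e (0\<^sub>m 1 k) (0\<^sub>m k 1) (adjoint_mat U1 * C1) * V"
      by simp
    show ?thesis
      unfolding * unfolding V_def
      using right_mult_zero_mat[OF aUC, of "Suc 0"] U1
      by (subst mult_four_block_mat[OF e zero_carrier_mat zero_carrier_mat aUC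
            one_carrier_mat zero_carrier_mat zero_carrier_mat U1(1)]) auto
  qed
  define \<alpha> where "\<alpha> i = (case i of 0 \<Rightarrow> Re e | Suc j \<Rightarrow> \<alpha>1 j)" for i
  have D: "four_block_mat (mat 1 1 (\<lambda>_. e)) (0\<^sub>m 1 k) (0\<^sub>m k 1) (diag_real k \<alpha>1) = diag_real (Suc k) \<alpha>"
    using ereal by (intro eq_matI) (auto simp: diag_real_def \<alpha>_def split: nat.splits)
  have aW: "adjoint_mat W \<in> carrier_mat (Suc k) (Suc k)" and aV': "adjoint_mat V \<in> carrier_mat (Suc k) (Suc k)"
    using W V by auto
  note assoc = assoc_mult_mat[of _ "Suc k" "Suc k" _ "Suc k" _ "Suc k"] mult_carrier_mat[of _ "Suc k" "Suc k" _ "Suc k"]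
  have adj: "adjoint_mat (W * V) = adjoint_mat V * adjoint_mat W"
    by (rule adjoint_mat_mult[OF W(1) V])
  have "adjoint_mat (W * V) * (W * V) = adjoint_mat V * (adjoint_mat W * W) * V"
    unfolding adj using W(1) V aW aV' by (simp add: assoc)
  hence 1: "adjoint_mat (W * V) * (W * V) = 1\<^sub>m (Suc k)"
    unfolding W(2) using aVV V aV' by simp
  have "adjoint_mat (W * V) * A * (W * V) = adjoint_mat V * C * V"
    unfolding adj C_def using W(1) V aW aV' A by (simp add: assoc)
  with 1 VCV D V W(1) show ?case
    by (intro exI[of _ "W * V"] exI[of _ \<alpha>]) auto
qed

abbreviation roots_poly :: "nat \<Rightarrow> (nat \<Rightarrow> real) \<Rightarrow> complex poly" where
  "roots_poly n \<alpha> \<equiv> \<Prod>i<n. [:- complex_of_real (\<alpha> i), 1:]"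

definition hform :: "complex mat \<Rightarrow> complex vec \<Rightarrow> real" where
  "hform A x = Re ((A *\<^sub>v x) \<bullet>c x)"

definition sqn :: "complex vec \<Rightarrow> real" where
  "sqn x = (\<Sum>i<dim_vec x. (cmod (x $ i))\<^sup>2)"

lemma sqn_nonneg [simp]: "0 \<le> sqn x"
  by (simp add: sqn_def sum_nonneg)

lemma sqn_eq_0_iff: "x \<in> carrier_vec n \<Longrightarrow> sqn x = 0 \<longleftrightarrow> x = 0\<^sub>v n"
  by (auto simp: sqn_def sum_nonneg_eq_0_iff vec_eq_iff)

text \<open>
  Padding the rows with zero rows gives a singular square matrix; a kernel vector of it is
  what is wanted.
\<close>

lemma common_orthogonal_vector:
  fixes vs :: "'a :: field vec list"
  assumes "set vs \<subseteq> carrier_vec n" "length vs < n"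
  shows "\<exists>x \<in> carrier_vec n. x \<noteq> 0\<^sub>v n \<and> (\<forall>v \<in> set vs. v \<bullet> x = 0)"
proof -
  define us where "us = vs @ replicate (n - length vs) (0\<^sub>v n)"
  have us: "length us = n" "set us \<subseteq> carrier_vec n" using assms by (auto simp: us_def)
  define M where "M = mat_of_rows n us"
  have M: "M \<in> carrier_mat n n" using us mat_of_rows_carrier(1)[of n us] by (simp add: M_def)
  have "M = mat\<^sub>r n n (\<lambda>i. if i = n - 1 then 0\<^sub>v n else us ! i)"
    using us assms by (intro eq_matI) (auto simp: M_def mat_of_rows_def us_def nth_append)
  moreover have "(\<lambda>i. us ! i) \<in> {0..<n} \<rightarrow> carrier_vec n" using us by auto
  hence "det (mat\<^sub>r n n (\<lambda>i. if i = n - 1 then 0\<^sub>v n else us ! i)) = 0"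
    using assms(2) by (intro det_row_0) auto
  ultimately have "det M = 0" by simp
  then obtain x where x: "x \<in> carrier_vec n" "x \<noteq> 0\<^sub>v n" "M *\<^sub>v x = 0\<^sub>v n"
    using det_0_iff_vec_prod_zero_field[OF M] by blast
  have "v \<bullet> x = 0" if "v \<in> set us" for v
  proof -
    from that obtain i where i: "i < n" "v = us ! i" using us by (auto simp: in_set_conv_nth)
    hence "row M i = v" using us that unfolding M_def by (subst mat_of_rows_row) auto
    thus ?thesis using arg_cong[OF x(3), of "\<lambda>w. w $ i"] i M by auto
  qed
  thus ?thesis using x by (auto simp: us_def)
qed

lemma diagonalized_form:
  assumes A: "A \<in> carrier_mat n n" and U: "U \<in> carrier_mat n n" "adjoint_mat U * U = 1\<^sub>m n"
    "adjoint_mat U * A * U = diag_real n \<alpha>" and x: "x \<in> carrier_vec n"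
  defines "y \<equiv> adjoint_mat U *\<^sub>v x"
  shows "hform A x = (\<Sum>i<n. \<alpha> i * (cmod (y $ i))\<^sup>2)" "sqn x = (\<Sum>i<n. (cmod (y $ i))\<^sup>2)"
    "char_poly A = roots_poly n \<alpha>"
proof -
  have aU: "adjoint_mat U \<in> carrier_mat n n" using U by simp
  have UU: "U * adjoint_mat U = 1\<^sub>m n"
    by (rule mat_mult_left_right_inverse[OF aU U(1,2)])
  have y: "y \<in> carrier_vec n" unfolding y_def using aU x by simp
  note assoc = assoc_mult_mat[of _ n n _ n _ n] mult_carrier_mat[of _ n n _ n]
  have A_eq: "A = U * diag_real n \<alpha> * adjoint_mat U"
  proof -
    have "U * diag_real n \<alpha> * adjoint_mat U = (U * adjoint_mat U) * A * (U * adjoint_mat U)"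
      unfolding U(3)[symmetric] using A U(1) aU by (simp add: assoc)
    thus ?thesis using A UU by simp
  qed
  have D: "diag_real n \<alpha> *\<^sub>v y = vec n (\<lambda>i. complex_of_real (\<alpha> i) * y $ i)"
  proof (rule eq_vecI)
    fix i assume i: "i < dim_vec (vec n (\<lambda>i. complex_of_real (\<alpha> i) * y $ i))"
    hence "(diag_real n \<alpha> *\<^sub>v y) $ i = (\<Sum>j<n. (if i = j then complex_of_real (\<alpha> i) else 0) * y $ j)"
      using y by (auto simp: diag_real_def mult_mat_vec_def scalar_prod_def atLeast0LessThan)
    also have "\<dots> = (\<Sum>j\<in>{i}. complex_of_real (\<alpha> j) * y $ j)"
      using i by (intro sum.mono_neutral_cong_right) auto
    finally show "(diag_real n \<alpha> *\<^sub>v y) $ i = vec n (\<lambda>i. complex_of_real (\<alpha> i) * y $ i) $ i"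
      using i by simp
  qed (auto simp: diag_real_def)
  have "A *\<^sub>v x = U *\<^sub>v (diag_real n \<alpha> *\<^sub>v y)"
    unfolding A_eq y_def using U(1) aU x
    by (simp add: assoc_mult_mat_vec[of _ n n _ n] assoc)
  hence "(A *\<^sub>v x) \<bullet>c x = (diag_real n \<alpha> *\<^sub>v y) \<bullet>c y"
    using adjoint_mat_inner[OF U(1), of "diag_real n \<alpha> *\<^sub>v y" x] x y unfolding y_def
    by (metis diag_real_carrier mult_mat_vec_carrier y y_def)
  also have "\<dots> = (\<Sum>i<n. complex_of_real (\<alpha> i * (cmod (y $ i))\<^sup>2))"
    unfolding D using y by (auto simp: scalar_prod_def atLeast0LessThan complex_norm_square
        intro!: sum.cong simp del: of_real_power)
  finally show "hform A x = (\<Sum>i<n. \<alpha> i * (cmod (y $ i))\<^sup>2)"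
    unfolding hform_def by simp
  have "complex_of_real (sqn x) = x \<bullet>c x" by (simp add: csqnorm_real sqn_def)
  also have x_eq: "x = U *\<^sub>v y" unfolding y_def using UU U(1) aU x
    by (metis assoc_mult_mat_vec one_mult_mat_vec)
  have "x \<bullet>c x = (U *\<^sub>v y) \<bullet>c (U *\<^sub>v y)" unfolding x_eq[symmetric] ..
  also have "(U *\<^sub>v y) \<bullet>c (U *\<^sub>v y) = y \<bullet>c (adjoint_mat U *\<^sub>v (U *\<^sub>v y))"
    using adjoint_mat_inner[OF U(1) y, of "U *\<^sub>v y"] U(1) y by simp
  also have "adjoint_mat U *\<^sub>v (U *\<^sub>v y) = y"
    using U aU y by (metis assoc_mult_mat_vec one_mult_mat_vec)
  finally have "complex_of_real (sqn x) = complex_of_real (\<Sum>i<n. (cmod (y $ i))\<^sup>2)"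
    using y by (simp only: csqnorm_real carrier_vecD)
  thus "sqn x = (\<Sum>i<n. (cmod (y $ i))\<^sup>2)" by (simp only: of_real_eq_iff)
  have "similar_mat A (diag_real n \<alpha>)"
    by (rule similar_matI[of _ _ U "adjoint_mat U" n]) (use A U aU UU A_eq in auto)
  hence "char_poly A = char_poly (diag_real n \<alpha>)" by (rule char_poly_similar)
  also have "\<dots> = (\<Prod>a\<leftarrow>diag_mat (diag_real n \<alpha>). [:- a, 1:])"
    by (rule char_poly_upper_triangular[of _ n]) (auto simp: diag_real_def)
  also have "\<dots> = (\<Prod>i\<leftarrow>[0..<n]. [:- complex_of_real (\<alpha> i), 1:])"
    unfolding diag_mat_def by (rule arg_cong[of _ _ prod_list]) (auto simp: diag_real_def)
  also have "\<dots> = roots_poly n \<alpha>"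
    by (subst prod.distinct_set_conv_list[symmetric]) (auto simp: atLeast0LessThan)
  finally show "char_poly A = roots_poly n \<alpha>" .
qed

lemma real_roots_mset_eq:
  assumes "roots_poly n \<alpha> = roots_poly n \<beta>"
  shows "image_mset \<alpha> (mset_set {..<n}) = image_mset \<beta> (mset_set {..<n})"
proof -
  have *: "proots (roots_poly n \<gamma>) = image_mset (complex_of_real \<circ> \<gamma>) (mset_set {..<n})" for \<gamma>
    by (subst proots_prod) (auto simp: sum_unfold_sum_mset, metis (lifting) comp_def image_mset.compositionality sum_mset_singleton_mset)
  have "image_mset complex_of_real (image_mset \<alpha> (mset_set {..<n})) =
        image_mset complex_of_real (image_mset \<beta> (mset_set {..<n}))"
    using *[of \<alpha>] *[of \<beta>] assms by (simp add: image_mset.compositionality)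
  from arg_cong[OF this, of "image_mset Re"] show ?thesis
    by (simp add: image_mset.compositionality o_def)
qed

text \<open>
  A polynomial determines the multiset of its roots, so a number of eigenvalues does not depend
  on how they are enumerated.
\<close>

lemma card_root_pred_eq:
  fixes \<alpha> \<beta> :: "nat \<Rightarrow> real"
  assumes "roots_poly n \<alpha> = roots_poly n \<beta>"
  shows "card {i. i < n \<and> Q (\<alpha> i)} = card {i. i < n \<and> Q (\<beta> i)}"
proof -
  have *: "card {i. i < n \<and> Q (\<gamma> i)} = size (filter_mset Q (image_mset \<gamma> (mset_set {..<n})))" for \<gamma> :: "nat \<Rightarrow> real"
  proof -
    have "filter_mset Q (image_mset \<gamma> (mset_set {..<n})) = image_mset \<gamma> (mset_set {i. i < n \<and> Q (\<gamma> i)})"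
      by (simp add: filter_mset_image_mset lessThan_def)
    thus ?thesis by simp
  qed
  show ?thesis unfolding * real_roots_mset_eq[OF assms] ..
qed

text \<open>
  This is the only form in which eigenvalues of different matrices are compared; \<open>T = 1\<close> gives
  Weyl's inequality. If there were more eigenvalues \<open>\<alpha> i > a\<close> of \<open>A\<close> than eigenvalues
  \<open>\<beta> j > b\<close> of \<open>B\<close>, then fewer than \<open>p\<close> linear conditions would force \<open>x\<close> into the span of the
  eigenvectors for the former and \<open>T x\<close> into the span of those for the eigenvalues \<open>\<beta> j \<le> b\<close>.
  Some \<open>x \<noteq> 0\<close> would satisfy them, and the two forms at \<open>x\<close> and \<open>T x\<close> contradict the hypothesis.
\<close>

theorem inertia_comparison:
  assumes A: "A \<in> carrier_mat p p" "hermitian_mat A" "char_poly A = roots_poly p \<alpha>"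
    and B: "B \<in> carrier_mat q q" "hermitian_mat B" "char_poly B = roots_poly q \<beta>"
    and T: "T \<in> carrier_mat q p"
    and le: "\<And>x. x \<in> carrier_vec p \<Longrightarrow> hform A x > a * sqn x \<Longrightarrow> hform B (T *\<^sub>v x) > b * sqn (T *\<^sub>v x)"
  shows "card {i. i < p \<and> \<alpha> i > a} \<le> card {i. i < q \<and> \<beta> i > b}"
proof (rule ccontr)
  assume neg: "\<not> ?thesis"
  obtain U \<alpha>' where U: "U \<in> carrier_mat p p" "adjoint_mat U * U = 1\<^sub>m p" "adjoint_mat U * A * U = diag_real p \<alpha>'"
    using hermitian_diagonalization[OF A(1,2)] by blast
  obtain V \<beta>' where V: "V \<in> carrier_mat q q" "adjoint_mat V * V = 1\<^sub>m q" "adjoint_mat V * B * V = diag_real q \<beta>'"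
    using hermitian_diagonalization[OF B(1,2)] by blast
  note fA = diagonalized_form[OF A(1) U] and fB = diagonalized_form[OF B(1) V]
  have cA: "card {i. i < p \<and> \<alpha> i > a} = card {i. i < p \<and> \<alpha>' i > a}"
    by (rule card_root_pred_eq) (metis A(3) fA(3) zero_carrier_vec)
  have cB: "card {i. i < q \<and> \<beta> i > b} = card {i. i < q \<and> \<beta>' i > b}"
    by (rule card_root_pred_eq) (metis B(3) fB(3) zero_carrier_vec)
  define I where "I = {i. i < p \<and> \<not> \<alpha>' i > a}"
  define J where "J = {j. j < q \<and> \<beta>' j > b}"
  \<comment> \<open>the conditions on x: coordinates in the two eigenbases that have to vanish\<close>
  define vs where "vs = map (row (adjoint_mat U)) (sorted_list_of_set I) @
     map (row (adjoint_mat V * T)) (sorted_list_of_set J)"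
  have fin: "finite I" "finite J" by (auto simp: I_def J_def)
  have "card {..<p} = card {i. i < p \<and> \<alpha>' i > a} + card I"
    unfolding I_def by (subst card_Un_disjoint[symmetric]) (auto intro!: arg_cong[of _ _ card] simp del: card_lessThan)
  hence len: "length vs < p" using neg cA cB by (simp add: vs_def J_def)
  have aU: "adjoint_mat U \<in> carrier_mat p p" and aV: "adjoint_mat V \<in> carrier_mat q q"
    using U V by auto
  have "set vs \<subseteq> carrier_vec p"
    using aU aV T fin by (auto simp: vs_def I_def J_def)
  from common_orthogonal_vector[OF this len] obtain x where
    x: "x \<in> carrier_vec p" "x \<noteq> 0\<^sub>v p" "\<And>v. v \<in> set vs \<Longrightarrow> v \<bullet> x = 0" by blast
  define y where "y = adjoint_mat U *\<^sub>v x"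
  define z where "z = adjoint_mat V *\<^sub>v (T *\<^sub>v x)"
  have Tx: "T *\<^sub>v x \<in> carrier_vec q" using T x by simp
  have y0: "y $ i = 0" if "i \<in> I" for i
    using x(3)[of "row (adjoint_mat U) i"] that fin aU by (auto simp: y_def vs_def I_def)
  have z0: "z $ j = 0" if "j \<in> J" for j
  proof -
    have "z = (adjoint_mat V * T) *\<^sub>v x"
      unfolding z_def using aV T x by (simp add: assoc_mult_mat_vec[of _ q q _ p])
    thus ?thesis
      using x(3)[of "row (adjoint_mat V * T) j"] that fin aV by (auto simp: vs_def J_def)
  qed
  have "0 < sqn x" using sqn_eq_0_iff[OF x(1)] x(2) sqn_nonneg[of x] by linarith
  hence "0 < (\<Sum>i<p. (cmod (y $ i))\<^sup>2)" using fA(2)[OF x(1)] y_def by simp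
  then obtain i0 where i0: "i0 < p" "y $ i0 \<noteq> 0"
    by (metis (no_types, lifting) lessThan_iff less_irrefl norm_zero sum.neutral zero_power2)
  have "0 < (\<Sum>i<p. (\<alpha>' i - a) * (cmod (y $ i))\<^sup>2)"
  proof (rule sum_pos2[of _ i0])
    show "0 < (\<alpha>' i0 - a) * (cmod (y $ i0))\<^sup>2"
      using i0 y0[of i0] by (intro mult_pos_pos) (auto simp: I_def)
    show "0 \<le> (\<alpha>' i - a) * (cmod (y $ i))\<^sup>2" if "i \<in> {..<p}" for i
      using y0[of i] that by (cases "i \<in> I") (auto simp: I_def)
  qed (use i0 in auto)
  also have "\<dots> = hform A x - a * sqn x"
    using fA(1,2)[OF x(1)] by (simp add: y_def algebra_simps sum_subtractf sum_distrib_left)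
  finally have "hform B (T *\<^sub>v x) > b * sqn (T *\<^sub>v x)" using le[OF x(1)] by simp
  moreover have "(\<Sum>i<q. (\<beta>' i - b) * (cmod (z $ i))\<^sup>2) \<le> 0"
  proof (rule sum_nonpos)
    fix i assume "i \<in> {..<q}"
    thus "(\<beta>' i - b) * (cmod (z $ i))\<^sup>2 \<le> 0"
      using z0[of i] by (cases "i \<in> J") (auto simp: J_def mult_nonpos_nonneg)
  qed
  moreover have "(\<Sum>i<q. (\<beta>' i - b) * (cmod (z $ i))\<^sup>2) = hform B (T *\<^sub>v x) - b * sqn (T *\<^sub>v x)"
    using fB(1,2)[OF Tx] by (simp add: z_def algebra_simps sum_subtractf sum_distrib_left)
  ultimately show False by simp
qed

section \<open>Evaluation of rational matrices at real points\<close>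

definition fr_pole :: "complex poly fract \<Rightarrow> real \<Rightarrow> bool" where
  "fr_pole f t \<longleftrightarrow> poly (snd (quot_of_fract f)) (complex_of_real t) = 0"

definition fr_eval :: "complex poly fract \<Rightarrow> real \<Rightarrow> complex" where
  "fr_eval f t = poly (fst (quot_of_fract f)) (complex_of_real t) / poly (snd (quot_of_fract f)) (complex_of_real t)"

lemma has_pole_iff: "has_pole F t \<longleftrightarrow> (\<exists>i<dim_row F. \<exists>j<dim_col F. fr_pole (F $$ (i,j)) t)"
  by (simp add: has_pole_def fr_pole_def)

lemma eval_mat_eq: "eval_mat F t = map_mat (\<lambda>f. fr_eval f t) F"
  by (simp add: eval_mat_def fr_eval_def)

lemma eval_mat_carrier [simp]: "F \<in> carrier_mat m n \<Longrightarrow> eval_mat F t \<in> carrier_mat m n"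
  by (simp add: eval_mat_eq)

lemma dim_eval_mat [simp]: "dim_row (eval_mat F t) = dim_row F" "dim_col (eval_mat F t) = dim_col F"
  by (simp_all add: eval_mat_eq)

lemma eval_mat_index [simp]:
  "i < dim_row F \<Longrightarrow> j < dim_col F \<Longrightarrow> eval_mat F t $$ (i,j) = fr_eval (F $$ (i,j)) t"
  by (simp add: eval_mat_eq)

text \<open>
  Evaluation is defined through the coprime representation, but any representation whose
  denominator does not vanish gives the same value. Therefore evaluation is compatible with
  sums and products away from the poles.
\<close>

lemma fr_eval_Fract:
  assumes "poly b (complex_of_real t) \<noteq> 0"
  shows "\<not> fr_pole (Fract a b) t" "fr_eval (Fract a b) t = poly a (of_real t) / poly b (of_real t)"
proof -
  define p q where "p = fst (quot_of_fract (Fract a b))" and "q = snd (quot_of_fract (Fract a b))"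
  have b: "b \<noteq> 0" using assms by auto
  have q: "q \<noteq> 0" by (simp add: q_def)
  have "Fract p q = Fract a b" by (simp add: p_def q_def)
  hence eq: "p * b = a * q" using b q by (simp add: eq_fract)
  have "coprime q p" using coprime_quot_of_fract[of "Fract a b"] by (simp add: p_def q_def coprime_commute)
  moreover have "q dvd p * b" unfolding eq by simp
  ultimately have "q dvd b" by (simp add: coprime_dvd_mult_right_iff)
  then obtain c where c: "b = q * c" by auto
  have "poly b (of_real t) = poly q (of_real t) * poly c (of_real t)"
    by (subst c) simp
  hence q0: "poly q (of_real t) \<noteq> 0" using assms by auto
  thus "\<not> fr_pole (Fract a b) t" unfolding fr_pole_def q_def .
  have "poly p (of_real t) * poly b (of_real t) = poly a (of_real t) * poly q (of_real t)"
    using arg_cong[OF eq, of "\<lambda>p. poly p (of_real t)"] by simp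
  hence "poly p (of_real t) / poly q (of_real t) = poly a (of_real t) / poly b (of_real t)"
    using assms q0 by (simp add: frac_eq_eq)
  thus "fr_eval (Fract a b) t = poly a (of_real t) / poly b (of_real t)"
    unfolding fr_eval_def p_def q_def .
qed

lemma fract_num_den:
  assumes "\<not> fr_pole f t"
  obtains p q where "f = Fract p q" "poly q (complex_of_real t) \<noteq> 0"
  using assms Fract_quot_of_fract[of f] unfolding fr_pole_def by metis

lemma fr_eval_add:
  assumes "\<not> fr_pole f t" "\<not> fr_pole g t"
  shows "\<not> fr_pole (f + g) t" "fr_eval (f + g) t = fr_eval f t + fr_eval g t"
proof -
  obtain p q where f: "f = Fract p q" "poly q (complex_of_real t) \<noteq> 0" using fract_num_den[OF assms(1)] .
  obtain p' q' where g: "g = Fract p' q'" "poly q' (complex_of_real t) \<noteq> 0" using fract_num_den[OF assms(2)] .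
  have nz: "q \<noteq> 0" "q' \<noteq> 0" using f g by auto
  have fg: "f + g = Fract (p * q' + p' * q) (q * q')" using nz unfolding f(1) g(1) by simp
  have nn: "poly (q * q') (complex_of_real t) \<noteq> 0" using f(2) g(2) by simp
  show "\<not> fr_pole (f + g) t" unfolding fg by (rule fr_eval_Fract(1)[OF nn])
  show "fr_eval (f + g) t = fr_eval f t + fr_eval g t"
    unfolding fg unfolding f(1) g(1) fr_eval_Fract(2)[OF nn] fr_eval_Fract(2)[OF f(2)] fr_eval_Fract(2)[OF g(2)]
    unfolding poly_add poly_mult by (rule add_frac_eq[OF f(2) g(2), symmetric])
qed

lemma fr_eval_mult:
  assumes "\<not> fr_pole f t" "\<not> fr_pole g t"
  shows "\<not> fr_pole (f * g) t" "fr_eval (f * g) t = fr_eval f t * fr_eval g t"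
proof -
  obtain p q where f: "f = Fract p q" "poly q (complex_of_real t) \<noteq> 0" using fract_num_den[OF assms(1)] .
  obtain p' q' where g: "g = Fract p' q'" "poly q' (complex_of_real t) \<noteq> 0" using fract_num_den[OF assms(2)] .
  have fg: "f * g = Fract (p * p') (q * q')" unfolding f(1) g(1) by simp
  have nn: "poly (q * q') (complex_of_real t) \<noteq> 0" using f(2) g(2) by simp
  show "\<not> fr_pole (f * g) t" unfolding fg by (rule fr_eval_Fract(1)[OF nn])
  show "fr_eval (f * g) t = fr_eval f t * fr_eval g t"
    unfolding fg unfolding f(1) g(1) fr_eval_Fract(2)[OF nn] fr_eval_Fract(2)[OF f(2)] fr_eval_Fract(2)[OF g(2)]
    by simp
qed

lemma fr_eval_to_fract [simp]: "\<not> fr_pole (to_fract p) t" "fr_eval (to_fract p) t = poly p (of_real t)"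
  by (auto simp: fr_eval_def fr_pole_def)

lemma fr_eval_sum:
  assumes "finite I" "\<And>i. i \<in> I \<Longrightarrow> \<not> fr_pole (f i) t"
  shows "\<not> fr_pole (\<Sum>i\<in>I. f i) t \<and> fr_eval (\<Sum>i\<in>I. f i) t = (\<Sum>i\<in>I. fr_eval (f i) t)"
  using assms
proof (induction I rule: finite_induct)
  case empty
  show ?case using fr_eval_to_fract[of 0 t] by (simp del: fr_eval_to_fract)
next
  case (insert x F)
  thus ?case using fr_eval_add[of "f x" t "sum f F"] by simp
qed

lemma eval_mat_add:
  assumes "A \<in> carrier_mat m n" "B \<in> carrier_mat m n" "\<not> has_pole A t" "\<not> has_pole B t"
  shows "\<not> has_pole (A + B) t" "eval_mat (A + B) t = eval_mat A t + eval_mat B t"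
  using assms by (auto simp: has_pole_iff fr_eval_add intro!: eq_matI)

lemma eval_mat_mult:
  assumes A: "A \<in> carrier_mat m n" and B: "B \<in> carrier_mat n k"
    and pA: "\<not> has_pole A t" and pB: "\<not> has_pole B t"
  shows "\<not> has_pole (A * B) t" "eval_mat (A * B) t = eval_mat A t * eval_mat B t"
proof -
  have ent: "(A * B) $$ (i,j) = (\<Sum>l<n. A $$ (i,l) * B $$ (l,j))" if "i < m" "j < k" for i j
    using that A B by (auto simp: scalar_prod_def atLeast0LessThan)
  have np: "\<not> fr_pole (A $$ (i,l) * B $$ (l,j)) t" "\<not> fr_pole (A $$ (i,l)) t" "\<not> fr_pole (B $$ (l,j)) t"
    if "i < m" "j < k" "l < n" for i j l
    using that pA pB A B fr_eval_mult(1)[of "A $$ (i,l)" t "B $$ (l,j)"] by (auto simp: has_pole_iff)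
  have *: "\<not> fr_pole ((A * B) $$ (i,j)) t \<and>
      fr_eval ((A * B) $$ (i,j)) t = (\<Sum>l<n. fr_eval (A $$ (i,l)) t * fr_eval (B $$ (l,j)) t)"
    if ij: "i < m" "j < k" for i j
  proof -
    have "(\<Sum>l<n. fr_eval (A $$ (i,l) * B $$ (l,j)) t) = (\<Sum>l<n. fr_eval (A $$ (i,l)) t * fr_eval (B $$ (l,j)) t)"
      using np[OF ij] by (intro sum.cong refl fr_eval_mult(2)) auto
    thus ?thesis
      unfolding ent[OF ij]
      using fr_eval_sum[of "{..<n}" "\<lambda>l. A $$ (i,l) * B $$ (l,j)" t] np(1)[OF ij] by simp
  qed
  have dims: "dim_row (A * B) = m" "dim_col (A * B) = k" using A B by auto
  show "\<not> has_pole (A * B) t" unfolding has_pole_iff dims using * by blast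
  show "eval_mat (A * B) t = eval_mat A t * eval_mat B t"
  proof (rule eq_matI)
    fix i j assume "i < dim_row (eval_mat A t * eval_mat B t)" "j < dim_col (eval_mat A t * eval_mat B t)"
    hence ij: "i < m" "j < k" using A B by auto
    hence "eval_mat (A * B) t $$ (i,j) = fr_eval ((A * B) $$ (i,j)) t"
      using dims by (intro eval_mat_index) auto
    also have "\<dots> = (\<Sum>l<n. fr_eval (A $$ (i,l)) t * fr_eval (B $$ (l,j)) t)" using *[OF ij] by blast
    also have "\<dots> = (eval_mat A t * eval_mat B t) $$ (i,j)"
      using ij A B by (simp add: scalar_prod_def atLeast0LessThan)
    finally show "eval_mat (A * B) t $$ (i,j) = (eval_mat A t * eval_mat B t) $$ (i,j)" .
  qed (use dims A B in auto)
qed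

lemma eval_mat_rat_mat:
  "\<not> has_pole (rat_mat X) t" "eval_mat (rat_mat X) t = map_mat (\<lambda>p. poly p (of_real t)) X"
  by (auto simp: has_pole_iff rat_mat_def intro!: eq_matI)

lemma finite_real_roots:
  fixes p :: "complex poly"
  assumes "p \<noteq> 0"
  shows "finite {t :: real. poly p (of_real t) = 0}"
proof -
  have "finite {z. poly p z = 0}" using assms poly_roots_finite by blast
  hence "finite (of_real -` {z. poly p z = 0} :: real set)"
    by (rule finite_vimageI) (simp add: inj_on_def)
  thus ?thesis by (simp add: vimage_def)
qed

lemma finite_poles: "finite {t. has_pole F t}"
proof -
  have "{t. has_pole F t} = (\<Union>i\<in>{..<dim_row F}. \<Union>j\<in>{..<dim_col F}.
      {t. poly (snd (quot_of_fract (F $$ (i,j)))) (complex_of_real t) = 0})"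
    by (auto simp: has_pole_def)
  also have "finite \<dots>" by (intro finite_UN_I finite_real_roots) auto
  finally show ?thesis .
qed

lemma eventually_notin_finite:
  fixes t :: "'a :: t1_space"
  assumes "finite S"
  shows "eventually (\<lambda>s. s \<notin> S) (at t within A)"
proof -
  have "eventually (\<lambda>s. \<forall>u\<in>S. s \<noteq> u) (at t within A)"
    using assms by (intro eventually_ball_finite) (auto intro: eventually_neq_at_within)
  thus ?thesis by (rule eventually_mono) auto
qed

lemma eventually_no_pole: "eventually (\<lambda>s. \<not> has_pole F s) (at t within A)"
  using eventually_notin_finite[OF finite_poles[of F]] by simp

lemma isCont_poly_of_real [continuous_intros]: "isCont (\<lambda>s. poly p (complex_of_real s)) t"
  by (intro continuous_intros)

lemma fr_eval_isCont: "\<not> fr_pole f t \<Longrightarrow> isCont (fr_eval f) t"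
  unfolding fr_eval_def fr_pole_def
  by (rule isCont_divide) (auto intro: isCont_poly_of_real)

lemma poly_of_real_poly: "poly (map_poly complex_of_real p) (of_real x) = of_real (poly p x)"
  by (induction p) (auto simp: map_poly_pCons)

text \<open>
  A real representation may have a common zero of numerator and denominator at \<open>t\<close>. Near \<open>t\<close>
  the values are real, and at \<open>t\<close> the value is their limit.
\<close>

lemma real_fract_eval:
  assumes "real_fract f" "\<not> fr_pole f t"
  shows "fr_eval f t \<in> \<real>"
proof -
  from assms(1) obtain p q :: "real poly" where q: "q \<noteq> 0" and
    f: "f = Fract (map_poly complex_of_real p) (map_poly complex_of_real q)"
    unfolding real_fract_def by blast
  have q': "map_poly complex_of_real q \<noteq> 0" using q by (simp add: map_poly_eq_0_iff)
  have "eventually (\<lambda>s. s \<notin> {s. poly (map_poly complex_of_real q) (of_real s) = 0}) (at t)"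
    by (rule eventually_notin_finite[OF finite_real_roots[OF q']])
  hence "eventually (\<lambda>s. Im (fr_eval f s) = 0) (at t)"
  proof eventually_elim
    case (elim s)
    hence "fr_eval f s = of_real (poly p s / poly q s)"
      unfolding f by (subst fr_eval_Fract) (auto simp: poly_of_real_poly)
    thus ?case by simp
  qed
  moreover have "((\<lambda>s. Im (fr_eval f s)) \<longlongrightarrow> Im (fr_eval f t)) (at t)"
    using fr_eval_isCont[OF assms(2)] by (intro tendsto_intros) (simp add: isCont_def)
  ultimately have "((\<lambda>s. 0) \<longlongrightarrow> Im (fr_eval f t)) (at t)"
    by (rule Lim_transform_eventually[rotated])
  hence "Im (fr_eval f t) = 0" by (rule LIM_unique[OF _ tendsto_const])
  thus ?thesis by (simp add: complex_is_Real_iff)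
qed

lemma eval_mat_hermitian:
  assumes F: "F \<in> carrier_mat n n" "real_rational_mat F" "symmetric_matrix F" and t: "\<not> has_pole F t"
  shows "hermitian_mat (eval_mat F t)"
proof -
  have "F $$ (j,i) = F $$ (i,j)" if "i < n" "j < n" for i j
  proof -
    have "F $$ (j,i) = transpose_mat F $$ (j,i)" using F(3) by (simp add: symmetric_matrix_def)
    thus ?thesis using that F(1) by simp
  qed
  moreover have "cnj (fr_eval (F $$ (i,j)) t) = fr_eval (F $$ (i,j)) t" if "i < n" "j < n" for i j
    using F that t by (intro Reals_cnj_iff[THEN iffD1] real_fract_eval) (auto simp: real_rational_mat_def has_pole_iff)
  ultimately show ?thesis using F(1)
    unfolding hermitian_mat_def adjoint_mat_def by (intro eq_matI) auto
qed

lemma common_denominator: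
  fixes F :: "complex poly fract mat"
  obtains D N where "D \<noteq> 0" "N \<in> carrier_mat (dim_row F) (dim_col F)"
    "\<And>i j. i < dim_row F \<Longrightarrow> j < dim_col F \<Longrightarrow> F $$ (i,j) = Fract (N $$ (i,j)) D"
proof -
  define I where "I = {..<dim_row F} \<times> {..<dim_col F}"
  define d where "d = (\<lambda>ij. snd (quot_of_fract (F $$ ij)))"
  define D where "D = prod d I"
  have fin: "finite I" by (simp add: I_def)
  have D: "D \<noteq> 0" by (simp add: D_def d_def fin)
  define N where "N = mat (dim_row F) (dim_col F) (\<lambda>ij. fst (quot_of_fract (F $$ ij)) * prod d (I - {ij}))"
  have "F $$ (i,j) = Fract (N $$ (i,j)) D" if "i < dim_row F" "j < dim_col F" for i j
  proof -
    have "D = d (i,j) * prod d (I - {(i,j)})"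
      unfolding D_def by (rule prod.remove[OF fin]) (use that in \<open>simp add: I_def\<close>)
    moreover have "prod d (I - {(i,j)}) \<noteq> 0" by (simp add: d_def fin)
    ultimately have "Fract (N $$ (i,j)) D = Fract (fst (quot_of_fract (F $$ (i,j)))) (d (i,j))"
      using mult_fract_cancel[of "prod d (I - {(i,j)})" "fst (quot_of_fract (F $$ (i,j)))" "d (i,j)"] that
      by (simp add: N_def mult.commute)
    thus ?thesis by (simp add: d_def)
  qed
  moreover have "N \<in> carrier_mat (dim_row F) (dim_col F)" by (simp add: N_def)
  ultimately show ?thesis using that[OF D, of N] by blast
qed

text \<open>
  A polynomial in the two variables \<open>s\<close> (inner) and \<open>x\<close> (outer), with \<open>s\<close> specialized.
\<close>

definition eval_coeffs :: "complex poly poly \<Rightarrow> real \<Rightarrow> complex poly" where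
  "eval_coeffs Q s = map_poly (\<lambda>p. poly p (of_real s)) Q"

lemma coeff_eval_coeffs: "coeff (eval_coeffs Q s) i = poly (coeff Q i) (of_real s)"
  by (simp add: eval_coeffs_def coeff_map_poly)

lemma poly_eval_coeffs:
  "poly (eval_coeffs Q s) x = (\<Sum>i\<le>degree Q. poly (coeff Q i) (of_real s) * x ^ i)"
proof -
  have "poly (eval_coeffs Q s) x = (\<Sum>i\<le>degree Q. coeff (eval_coeffs Q s) i * x ^ i)"
    unfolding poly_altdef
  proof (rule sum.mono_neutral_left)
    show "{..degree (eval_coeffs Q s)} \<subseteq> {..degree Q}"
      by (simp add: eval_coeffs_def degree_map_poly_le)
    show "\<forall>i\<in>{..degree Q} - {..degree (eval_coeffs Q s)}.
        coeff (eval_coeffs Q s) i * x ^ i = 0"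
      by (auto intro: coeff_eq_0)
  qed simp
  thus ?thesis by (simp add: coeff_eval_coeffs)
qed

lemma tendsto_poly_eval_coeffs:
  assumes "(f \<longlongrightarrow> t) Fl" "(g \<longlongrightarrow> x) Fl"
  shows "((\<lambda>s. poly (eval_coeffs Q (f s)) (g s)) \<longlongrightarrow> poly (eval_coeffs Q t) x) Fl"
  unfolding poly_eval_coeffs using assms by (intro tendsto_intros)

text \<open>
  Dividing all coefficients by the highest common power of the linear factor; the degree of the
  leading coefficient decreases with every division.
\<close>

lemma extract_linear_power:
  fixes Q :: "complex poly poly"
  assumes "Q \<noteq> 0"
  shows "\<exists>k Q'. Q = Polynomial.smult ([:- of_real t, 1:] ^ k) Q' \<and> eval_coeffs Q' t \<noteq> 0"
  using assms
proof (induction "degree (lead_coeff Q)" arbitrary: Q rule: less_induct)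
  case less
  show ?case
  proof (cases "eval_coeffs Q t = 0")
    case False
    thus ?thesis by (intro exI[of _ 0] exI[of _ Q]) simp
  next
    case True
    have "poly (coeff Q i) (of_real t) = 0" for i
      using arg_cong[OF True, of "\<lambda>p. coeff p i"] by (simp add: coeff_eval_coeffs)
    hence dvd: "[:- of_real t, 1:] dvd coeff Q i" for i by (simp add: poly_eq_0_iff_dvd)
    define Q1 where "Q1 = map_poly (\<lambda>p. p div [:- of_real t, 1:]) Q"
    have Q1: "Q = Polynomial.smult [:- of_real t, 1:] Q1"
      by (rule poly_eqI) (use dvd in \<open>simp add: Q1_def coeff_map_poly dvd_mult_div_cancel del: mult_pCons_left\<close>)
    hence "Q1 \<noteq> 0" using less.prems by auto
    have "lead_coeff Q = [:- of_real t, 1:] * lead_coeff Q1" using arg_cong[OF Q1, of lead_coeff] by (simp only: lead_coeff_smult)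
    hence "degree (lead_coeff Q1) < degree (lead_coeff Q)"
      using \<open>Q1 \<noteq> 0\<close> by (simp add: degree_mult_eq del: mult_pCons_left)
    from less.hyps[OF this \<open>Q1 \<noteq> 0\<close>] obtain k Q' where
      "Q1 = Polynomial.smult ([:- of_real t, 1:] ^ k) Q'" "eval_coeffs Q' t \<noteq> 0" by blast
    thus ?thesis by (intro exI[of _ "Suc k"] exI[of _ Q']) (subst Q1, simp)
  qed
qed

text \<open>
  At a pole the characteristic polynomial itself has no limit, but a multiple of it by a scalar
  depending on \<open>s\<close> extends continuously to a nonzero polynomial at \<open>t\<close>: clear denominators
  and divide by the largest power of \<open>\<lambda> - t\<close> contained in all coefficients. The degree
  may drop at \<open>t\<close>; the missing roots are those that escape to infinity.
\<close>

theorem char_poly_near_pole: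
  assumes F: "F \<in> carrier_mat n n"
  shows "\<exists>Q. eval_coeffs Q t \<noteq> 0 \<and>
    eventually (\<lambda>s. \<exists>w. w \<noteq> 0 \<and> eval_coeffs Q s = Polynomial.smult w (char_poly (eval_mat F s))) (at t)"
proof -
  obtain D N where D: "D \<noteq> 0" and N: "N \<in> carrier_mat n n"
    and FN: "\<And>i j. i < n \<Longrightarrow> j < n \<Longrightarrow> F $$ (i,j) = Fract (N $$ (i,j)) D"
    using common_denominator[of F] F by (metis carrier_matD)
  define Qm where "Qm = mat n n (\<lambda>(i,j). if i = j then [:- N $$ (i,j), D:] else [:- N $$ (i,j):])"
  define Q where "Q = det Qm"
  have ev: "eval_coeffs Q s = Polynomial.smult (poly D (of_real s) ^ n) (char_poly (eval_mat F s))"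
    if s: "poly D (of_real s) \<noteq> 0" for s
  proof -
    interpret h: comm_ring_hom "\<lambda>p :: complex poly. poly p (of_real s)" by unfold_locales auto
    interpret mh: map_poly_comm_ring_hom "\<lambda>p :: complex poly. poly p (of_real s)" ..
    have mp: "map_poly (\<lambda>p. poly p (complex_of_real s)) [:a, b:] = [:poly a (of_real s), poly b (of_real s):]" for a b
      by (rule poly_eqI) (simp add: coeff_map_poly coeff_pCons split: nat.split)
    have "eval_coeffs Q s = det (map_mat (map_poly (\<lambda>p. poly p (of_real s))) Qm)"
      unfolding Q_def eval_coeffs_def by (rule mh.hom_det[symmetric])
    also have "map_mat (map_poly (\<lambda>p. poly p (of_real s))) Qm =
       [:poly D (of_real s):] \<cdot>\<^sub>m char_poly_matrix (eval_mat F s)"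
    proof (rule eq_matI)
      fix i j assume "i < dim_row ([:poly D (of_real s):] \<cdot>\<^sub>m char_poly_matrix (eval_mat F s))"
        "j < dim_col ([:poly D (of_real s):] \<cdot>\<^sub>m char_poly_matrix (eval_mat F s))"
      hence ij: "i < n" "j < n" using F by (auto simp: char_poly_matrix_def)
      have "poly D (of_real s) * fr_eval (F $$ (i,j)) s = poly (N $$ (i,j)) (of_real s)"
        unfolding FN[OF ij] fr_eval_Fract(2)[OF s] using s by simp
      thus "map_mat (map_poly (\<lambda>p. poly p (of_real s))) Qm $$ (i,j) =
        ([:poly D (of_real s):] \<cdot>\<^sub>m char_poly_matrix (eval_mat F s)) $$ (i,j)"
        using ij F by (auto simp: Qm_def char_poly_matrix_def mp mp[of _ 0, simplified] mult.commute)
    qed (use F in \<open>auto simp: Qm_def char_poly_matrix_def\<close>)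
    also have "det \<dots> = [:poly D (of_real s):] ^ n * char_poly (eval_mat F s)"
      using F by (simp add: char_poly_def char_poly_matrix_def)
    also have "\<dots> = Polynomial.smult (poly D (of_real s) ^ n) (char_poly (eval_mat F s))"
      by (simp add: poly_const_pow)
    finally show ?thesis .
  qed
  have evD: "eventually (\<lambda>s. poly D (of_real s) \<noteq> 0) (at t)"
    using eventually_notin_finite[OF finite_real_roots[OF D], of t UNIV] by simp
  then obtain s0 where s0: "poly D (complex_of_real s0) \<noteq> 0"
    using eventually_happens'[OF at_neq_bot] by blast
  have "Q \<noteq> 0"
  proof
    assume "Q = 0"
    hence "Polynomial.smult (poly D (of_real s0) ^ n) (char_poly (eval_mat F s0)) = 0"
      using ev[OF s0] by (simp add: eval_coeffs_def)
    hence "char_poly (eval_mat F s0) = 0" using s0 by simp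
    thus False using degree_monic_char_poly[of "eval_mat F s0" n] F by simp
  qed
  then obtain k Q' where Q': "Q = Polynomial.smult ([:- of_real t, 1:] ^ k) Q'" "eval_coeffs Q' t \<noteq> 0"
    using extract_linear_power by blast
  have "eventually (\<lambda>s. s \<noteq> t) (at t)" by (rule eventually_neq_at_within)
  with evD have "eventually (\<lambda>s. \<exists>w. w \<noteq> 0 \<and> eval_coeffs Q' s = Polynomial.smult w (char_poly (eval_mat F s))) (at t)"
  proof eventually_elim
    case (elim s)
    define c where "c = (complex_of_real s - of_real t) ^ k"
    have c: "c \<noteq> 0" using elim by (simp add: c_def)
    have "eval_coeffs Q s = Polynomial.smult c (eval_coeffs Q' s)"
      by (rule poly_eqI) (simp add: Q'(1) coeff_eval_coeffs c_def)
    hence "eval_coeffs Q' s = Polynomial.smult (poly D (of_real s) ^ n / c) (char_poly (eval_mat F s))"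
      using arg_cong[OF ev[OF elim(1)], of "Polynomial.smult (1 / c)"] c by simp
    thus ?case using elim c by (intro exI[of _ "poly D (of_real s) ^ n / c"]) auto
  qed
  with Q'(2) show ?thesis by blast
qed

section \<open>Sorted eigenvalues and one-sided limits\<close>

text \<open>
  Translates between single sorted eigenvalues and the counts that occur in the comparison of
  inertia.
\<close>

lemma sorted_nth_gt_iff:
  fixes xs :: "real list"
  assumes xs: "sorted xs" "length xs = n" and k: "k < n"
  shows "xs ! k > c \<longleftrightarrow> n - k \<le> card {i. i < n \<and> xs ! i > c}"
proof
  assume "xs ! k > c"
  hence "{k..<n} \<subseteq> {i. i < n \<and> xs ! i > c}"
    using xs sorted_nth_mono[OF xs(1), of k] by fastforce
  from card_mono[OF _ this] show "n - k \<le> card {i. i < n \<and> xs ! i > c}" by simp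
next
  assume le: "n - k \<le> card {i. i < n \<and> xs ! i > c}"
  show "xs ! k > c"
  proof (rule ccontr)
    assume "\<not> xs ! k > c"
    hence "xs ! i \<le> c" if "i \<le> k" for i
      using sorted_nth_mono[OF xs(1) that] k xs(2) by linarith
    hence "{i. i < n \<and> xs ! i > c} \<subseteq> {Suc k..<n}"
      by (auto simp: not_less_eq_eq[symmetric]) (meson leD leI)
    from card_mono[OF _ this] le k show False by simp
  qed
qed

lemma hform_eq_sum:
  assumes "A \<in> carrier_mat n n" "x \<in> carrier_vec n"
  shows "hform A x = (\<Sum>i<n. \<Sum>j<n. Re (A $$ (i,j) * x $ j * cnj (x $ i)))"
  using assms by (auto simp: hform_def scalar_prod_def mult_mat_vec_def atLeast0LessThan
      sum_distrib_right intro!: sum.cong)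

definition entry_norm :: "nat \<Rightarrow> complex mat \<Rightarrow> real" where
  "entry_norm n A = (\<Sum>i<n. \<Sum>j<n. cmod (A $$ (i,j)))"

lemma abs_hform_le:
  assumes A: "A \<in> carrier_mat n n" and x: "x \<in> carrier_vec n"
  shows "\<bar>hform A x\<bar> \<le> entry_norm n A * sqn x"
proof -
  have xi: "cmod (x $ i) \<le> sqrt (sqn x)" if "i < n" for i
  proof (rule real_le_rsqrt)
    show "(cmod (x $ i))\<^sup>2 \<le> sqn x"
      unfolding sqn_def using that x member_le_sum[of i "{..<n}" "\<lambda>i. (cmod (x $ i))\<^sup>2"] by auto
  qed
  have "\<bar>hform A x\<bar> \<le> (\<Sum>i<n. \<Sum>j<n. \<bar>Re (A $$ (i,j) * x $ j * cnj (x $ i))\<bar>)"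
    unfolding hform_eq_sum[OF assms] by (intro order_trans[OF sum_abs] sum_mono order.refl)
  also have "\<dots> \<le> (\<Sum>i<n. \<Sum>j<n. cmod (A $$ (i,j)) * sqn x)"
  proof (intro sum_mono)
    fix i j assume "i \<in> {..<n}" "j \<in> {..<n}"
    hence ij: "i < n" "j < n" by auto
    have "\<bar>Re (A $$ (i,j) * x $ j * cnj (x $ i))\<bar> \<le> cmod (A $$ (i,j) * x $ j * cnj (x $ i))"
      by (rule abs_Re_le_cmod)
    also have "\<dots> = cmod (A $$ (i,j)) * (cmod (x $ j) * cmod (x $ i))"
      by (simp add: norm_mult)
    also have "\<dots> \<le> cmod (A $$ (i,j)) * (sqrt (sqn x) * sqrt (sqn x))"
      by (intro mult_left_mono mult_mono xi ij) auto
    finally show "\<bar>Re (A $$ (i,j) * x $ j * cnj (x $ i))\<bar> \<le> cmod (A $$ (i,j)) * sqn x" by simp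
  qed
  also have "\<dots> = entry_norm n A * sqn x"
    by (simp add: entry_norm_def sum_distrib_right)
  finally show ?thesis .
qed

lemma hform_add:
  assumes "A \<in> carrier_mat n n" "B \<in> carrier_mat n n" "x \<in> carrier_vec n"
  shows "hform (A + B) x = hform A x + hform B x"
  using assms
  by (simp add: hform_eq_sum[of _ n] sum.distrib distrib_right)

lemma hform_diff:
  assumes "A \<in> carrier_mat n n" "B \<in> carrier_mat n n" "x \<in> carrier_vec n"
  shows "hform (A - B) x = hform A x - hform B x"
  unfolding hform_eq_sum[OF minus_carrier_mat[OF assms(2)] assms(3)] hform_eq_sum[OF assms(1,3)]
    hform_eq_sum[OF assms(2,3)] sum_subtractf[symmetric]
  using assms by (intro sum.cong) (auto simp: algebra_simps)

lemma sorted_eigenvalues_exist: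
  assumes "A \<in> carrier_mat n n" "hermitian_mat A"
  shows "\<exists>xs. sorted xs \<and> length xs = n \<and> char_poly A = roots_poly n (nth xs)"
proof -
  obtain U \<alpha> where U: "U \<in> carrier_mat n n" "adjoint_mat U * U = 1\<^sub>m n" "adjoint_mat U * A * U = diag_real n \<alpha>"
    using hermitian_diagonalization[OF assms] by blast
  define xs where "xs = sort (map \<alpha> [0..<n])"
  have "char_poly A = roots_poly n \<alpha>"
    using diagonalized_form(3)[OF assms(1) U zero_carrier_vec] .
  also have "\<dots> = prod_list (map (\<lambda>x. [:- complex_of_real x, 1:]) (map \<alpha> [0..<n]))"
    by (simp add: prod.distinct_set_conv_list[symmetric] atLeast0LessThan o_def)
  also have "\<dots> = prod_mset (image_mset (\<lambda>x. [:- complex_of_real x, 1:]) (mset (map \<alpha> [0..<n])))"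
    by (simp only: prod_mset_prod_list[symmetric] mset_map)
  also have "mset (map \<alpha> [0..<n]) = mset xs" by (simp add: xs_def)
  also have "prod_mset (image_mset (\<lambda>x. [:- complex_of_real x, 1:]) (mset xs)) =
      prod_list (map (\<lambda>x. [:- complex_of_real x, 1:]) (map (\<lambda>i. xs ! i) [0..<length xs]))"
    unfolding map_nth by (simp only: prod_mset_prod_list[symmetric] mset_map)
  also have "\<dots> = roots_poly (length xs) (nth xs)"
    by (subst map_map, subst prod.distinct_set_conv_list[symmetric]) (simp_all add: atLeast0LessThan o_def)
  finally show ?thesis by (intro exI[of _ xs]) (simp add: xs_def)
qed

definition sorted_eigenvalue :: "complex mat \<Rightarrow> nat \<Rightarrow> real" where
  "sorted_eigenvalue A k = (SOME xs. sorted xs \<and> length xs = dim_row A \<and>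
     char_poly A = roots_poly (dim_row A) (nth xs)) ! k"

lemma sorted_eigenvalue:
  assumes "A \<in> carrier_mat n n" "hermitian_mat A"
  shows "char_poly A = roots_poly n (sorted_eigenvalue A)"
    and "k < n \<Longrightarrow> sorted_eigenvalue A k > c \<longleftrightarrow> n - k \<le> card {i. i < n \<and> sorted_eigenvalue A i > c}"
proof -
  define xs where "xs = (SOME xs. sorted xs \<and> length xs = dim_row A \<and>
     char_poly A = roots_poly (dim_row A) (nth xs))"
  have "sorted xs \<and> length xs = dim_row A \<and> char_poly A = roots_poly (dim_row A) (nth xs)"
    unfolding xs_def by (rule someI_ex) (use sorted_eigenvalues_exist[OF assms] assms in simp)
  hence xs: "sorted xs" "length xs = n" "char_poly A = roots_poly n (nth xs)"
    using assms by auto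
  have e: "sorted_eigenvalue A i = xs ! i" for i by (simp add: sorted_eigenvalue_def xs_def)
  show "char_poly A = roots_poly n (sorted_eigenvalue A)" unfolding e by (fact xs)
  show "sorted_eigenvalue A k > c \<longleftrightarrow> n - k \<le> card {i. i < n \<and> sorted_eigenvalue A i > c}" if "k < n"
    unfolding e by (rule sorted_nth_gt_iff[OF xs(1,2) that])
qed

text \<open>
  Weyl's inequality: the forms of \<open>A\<close> and \<open>B\<close> differ by at most \<open>entry_norm n (A - B)\<close> times the
  squared norm.
\<close>

lemma sorted_eigenvalue_le_add:
  assumes A: "A \<in> carrier_mat n n" "hermitian_mat A" and B: "B \<in> carrier_mat n n" "hermitian_mat B"
    and k: "k < n"
  shows "sorted_eigenvalue A k \<le> sorted_eigenvalue B k + entry_norm n (A - B)"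
proof (rule ccontr)
  define e where "e = entry_norm n (A - B)"
  define c where "c = sorted_eigenvalue B k"
  assume "\<not> ?thesis"
  hence "sorted_eigenvalue A k > c + e" by (simp add: e_def c_def)
  hence "n - k \<le> card {i. i < n \<and> sorted_eigenvalue A i > c + e}"
    using sorted_eigenvalue(2)[OF A k] by blast
  also have "\<dots> \<le> card {i. i < n \<and> sorted_eigenvalue B i > c}"
  proof (rule inertia_comparison[OF A sorted_eigenvalue(1)[OF A] B sorted_eigenvalue(1)[OF B] one_carrier_mat])
    fix x :: "complex vec" assume x: "x \<in> carrier_vec n" and gt: "(c + e) * sqn x < hform A x"
    have "\<bar>hform A x - hform B x\<bar> \<le> e * sqn x"
      using abs_hform_le[of "A - B" n x] hform_diff[OF A(1) B(1) x] A B x by (simp add: e_def minus_carrier_mat)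
    with gt show "c * sqn (1\<^sub>m n *\<^sub>v x) < hform B (1\<^sub>m n *\<^sub>v x)"
      using x by (simp add: algebra_simps)
  qed
  finally have "sorted_eigenvalue B k > c" using sorted_eigenvalue(2)[OF B k] by blast
  thus False by (simp add: c_def)
qed

lemma abs_sorted_eigenvalue_diff_le:
  assumes A: "A \<in> carrier_mat n n" "hermitian_mat A" and B: "B \<in> carrier_mat n n" "hermitian_mat B"
    and k: "k < n"
  shows "\<bar>sorted_eigenvalue A k - sorted_eigenvalue B k\<bar> \<le> entry_norm n (A - B)"
proof -
  have "entry_norm n (B - A) = entry_norm n (A - B)"
    using A B by (auto simp: entry_norm_def norm_minus_commute)
  thus ?thesis
    using sorted_eigenvalue_le_add[OF A B k] sorted_eigenvalue_le_add[OF B A k] by linarith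
qed

locale real_symmetric_rational =
  fixes n :: nat and F :: "complex poly fract mat"
  assumes carrier: "F \<in> carrier_mat n n"
    and real: "real_rational_mat F" and symmetric: "symmetric_matrix F"
begin

text \<open>
  The value of \<open>ev k\<close> at a pole has no meaning.
\<close>

definition ev :: "nat \<Rightarrow> real \<Rightarrow> real" where
  "ev k s = sorted_eigenvalue (eval_mat F s) k"

lemma hermitian: "\<not> has_pole F s \<Longrightarrow> hermitian_mat (eval_mat F s)"
  by (rule eval_mat_hermitian[OF carrier real symmetric])

lemma char_poly_ev:
  "\<not> has_pole F s \<Longrightarrow> char_poly (eval_mat F s) = roots_poly n (\<lambda>i. ev i s)"
  unfolding ev_def by (rule sorted_eigenvalue(1)) (use carrier hermitian in auto)

lemma isCont_ev:
  assumes t: "\<not> has_pole F t" and k: "k < n"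
  shows "isCont (ev k) t"
proof -
  have np: "eventually (\<lambda>s. \<not> has_pole F s) (at t)" by (rule eventually_no_pole)
  have ent: "((\<lambda>s. fr_eval (F $$ (i,j)) s) \<longlongrightarrow> fr_eval (F $$ (i,j)) t) (at t)" if "i < n" "j < n" for i j
    using fr_eval_isCont[of "F $$ (i,j)" t] t carrier that by (auto simp: has_pole_iff isCont_def)
  have "((\<lambda>s. \<Sum>i<n. \<Sum>j<n. cmod (fr_eval (F $$ (i,j)) s - fr_eval (F $$ (i,j)) t)) \<longlongrightarrow>
      (\<Sum>i<n. \<Sum>j<n. cmod (fr_eval (F $$ (i,j)) t - fr_eval (F $$ (i,j)) t))) (at t)"
    by (intro tendsto_intros ent) auto
  hence lim: "((\<lambda>s. entry_norm n (eval_mat F s - eval_mat F t)) \<longlongrightarrow> 0) (at t)"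
    using carrier by (simp add: entry_norm_def)
  have "eventually (\<lambda>s. norm (ev k s - ev k t) \<le> entry_norm n (eval_mat F s - eval_mat F t)) (at t)"
    using np
  proof eventually_elim
    case (elim s)
    show ?case unfolding ev_def real_norm_def
      by (rule abs_sorted_eigenvalue_diff_le) (use elim t k carrier hermitian in auto)
  qed
  hence "eventually (\<lambda>s. norm (ev k s - ev k t) \<le> norm (entry_norm n (eval_mat F s - eval_mat F t)) * 1) (at t)"
    by eventually_elim simp
  from tendsto_0_le[OF lim this] have "((\<lambda>s. ev k s - ev k t) \<longlongrightarrow> 0) (at t)" .
  thus ?thesis unfolding isCont_def by (simp add: LIM_zero_iff)
qed

end

text \<open>
  The intermediate value theorem.
\<close>

lemma eventually_right_avoid:
  fixes f :: "real \<Rightarrow> real"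
  assumes "eventually (\<lambda>s. isCont f s) (at_right t)" "eventually (\<lambda>s. f s \<noteq> c) (at_right t)"
  shows "eventually (\<lambda>s. f s < c) (at_right t) \<or> eventually (\<lambda>s. f s > c) (at_right t)"
proof -
  have "eventually (\<lambda>s. isCont f s \<and> f s \<noteq> c) (at_right t)" using assms by eventually_elim auto
  then obtain b where b: "b > t" "\<And>s. t < s \<Longrightarrow> s < b \<Longrightarrow> isCont f s \<and> f s \<noteq> c"
    unfolding eventually_at_right_field by blast
  have no: "\<not> (f u < c \<and> f v > c)" if u: "t < u" "u < b" and v: "t < v" "v < b" for u v
  proof
    assume uv: "f u < c \<and> f v > c"
    have "u \<noteq> v" using uv by auto
    then consider "u < v" | "v < u" by linarith
    thus False
    proof cases
      case 1
      have "\<forall>x. u \<le> x \<and> x \<le> v \<longrightarrow> isCont f x" using b u v by (meson le_less_trans less_le_trans)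
      from IVT[of f u c v, OF _ _ _ this] uv 1 obtain x where "u \<le> x" "x \<le> v" "f x = c" by auto
      thus False using b(2)[of x] u v by auto
    next
      case 2
      have "\<forall>x. v \<le> x \<and> x \<le> u \<longrightarrow> isCont f x" using b u v by (meson le_less_trans less_le_trans)
      from IVT2[of f u c v, OF _ _ _ this] uv 2 obtain x where "v \<le> x" "x \<le> u" "f x = c" by auto
      thus False using b(2)[of x] u v by auto
    qed
  qed
  show ?thesis
  proof (cases "\<exists>u. t < u \<and> u < b \<and> f u < c")
    case True
    then obtain u where u: "t < u" "u < b" "f u < c" by blast
    have "f s < c" if "t < s" "s < b" for s
      using no[OF u(1,2) that] u(3) b(2)[OF that] by linarith
    thus ?thesis using b(1) by (auto simp: eventually_at_right_field)
  next
    case False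
    have "f s > c" if "t < s" "s < b" for s
      using False b(2)[OF that] that by (meson linorder_neqE_linordered_idom)
    thus ?thesis using b(1) by (auto simp: eventually_at_right_field)
  qed
qed

text \<open>
  If almost every value is avoided near \<open>t\<close>, the function is eventually on one side of almost
  every real number. The supremum of the numbers that it exceeds is then its limit.
\<close>

lemma right_limit_exists:
  fixes f :: "real \<Rightarrow> real"
  assumes cont: "eventually (\<lambda>s. isCont f s) (at_right t)" and Z: "finite Z"
    and avoid: "\<And>c. c \<notin> Z \<Longrightarrow> eventually (\<lambda>s. f s \<noteq> c) (at_right t)"
  shows "(\<exists>l. (f \<longlongrightarrow> l) (at_right t)) \<or> filterlim f at_top (at_right t) \<or> filterlim f at_bot (at_right t)"
proof -
  define S where "S = {c. c \<notin> Z \<and> eventually (\<lambda>s. f s > c) (at_right t)}"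
  have less: "eventually (\<lambda>s. f s < c) (at_right t)" if "c \<notin> Z" "c \<notin> S" for c
    using eventually_right_avoid[OF cont avoid[OF that(1)]] that by (auto simp: S_def)
  have between: "\<exists>c. a < c \<and> c < b \<and> c \<notin> Z" if "a < b" for a b :: real
  proof -
    have "infinite ({a<..<b} - Z)" using that Z by (simp add: infinite_Ioo)
    then obtain c where "c \<in> {a<..<b} - Z" by (metis ex_in_conv finite.emptyI)
    thus ?thesis by auto
  qed
  show ?thesis
  proof (cases "S = {}")
    case True
    have "eventually (\<lambda>s. f s \<le> B) (at_right t)" for B
    proof -
      obtain c where c: "B - 1 < c" "c < B" "c \<notin> Z" using between[of "B - 1" B] by auto
      show ?thesis using less[OF c(3)] True c(2) by (auto elim!: eventually_mono)
    qed
    hence "filterlim f at_bot (at_right t)" by (simp add: filterlim_at_bot)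
    thus ?thesis by blast
  next
    case ne: False
    show ?thesis
    proof (cases "bdd_above S")
    case False
    have "eventually (\<lambda>s. f s \<ge> B) (at_right t)" for B
    proof -
      obtain c where c: "c \<in> S" "c > B" using False by (metis bdd_aboveI not_le)
      hence "eventually (\<lambda>s. f s > c) (at_right t)" by (simp add: S_def)
      thus ?thesis using c(2) by (auto elim!: eventually_mono)
    qed
    hence "filterlim f at_top (at_right t)" by (simp add: filterlim_at_top)
    thus ?thesis by blast
  next
    case True
    define l where "l = Sup S"
    have "(f \<longlongrightarrow> l) (at_right t)"
    proof (rule order_tendstoI)
      fix a assume "a < l"
      then obtain c where c: "c \<in> S" "a < c" unfolding l_def using ne less_cSupE by metis
      hence "eventually (\<lambda>s. f s > c) (at_right t)" by (simp add: S_def)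
      thus "eventually (\<lambda>s. a < f s) (at_right t)" using c(2) by (auto elim!: eventually_mono)
    next
      fix a assume "l < a"
      then obtain c where c: "l < c" "c < a" "c \<notin> Z" using between by blast
      have "c \<notin> S" using c(1) cSup_upper[of c S] True by (auto simp: l_def)
      from less[OF c(3) this] show "eventually (\<lambda>s. f s < a) (at_right t)"
        using c(2) by (auto elim!: eventually_mono)
    qed
    thus ?thesis by blast
    qed
  qed
qed

lemma left_limit_exists:
  fixes f :: "real \<Rightarrow> real"
  assumes cont: "eventually (\<lambda>s. isCont f s) (at_left t)" and Z: "finite Z"
    and avoid: "\<And>c. c \<notin> Z \<Longrightarrow> eventually (\<lambda>s. f s \<noteq> c) (at_left t)"
  shows "(\<exists>l. (f \<longlongrightarrow> l) (at_left t)) \<or> filterlim f at_top (at_left t) \<or> filterlim f at_bot (at_left t)"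
proof -
  define g where "g s = f (- s)" for s
  have "eventually (\<lambda>s. isCont g s) (at_right (- t))"
  proof -
    have "eventually (\<lambda>s. isCont f (- s)) (at_right (- t))"
      using cont by (simp add: eventually_at_left_to_right)
    thus ?thesis
    proof eventually_elim
      case (elim s)
      show ?case unfolding g_def
        using isCont_o2[where f = uminus and g = f and a = s] elim by (simp add: continuous_intros)
    qed
  qed
  moreover have "eventually (\<lambda>s. g s \<noteq> c) (at_right (- t))" if "c \<notin> Z" for c
    using avoid[OF that] by (simp add: eventually_at_left_to_right g_def)
  ultimately have "(\<exists>l. (g \<longlongrightarrow> l) (at_right (- t))) \<or> filterlim g at_top (at_right (- t)) \<or> filterlim g at_bot (at_right (- t))"
    by (intro right_limit_exists[OF _ Z])
  thus ?thesis unfolding g_def filterlim_at_left_to_right .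
qed

section \<open>Eigenvalue curves and the index\<close>

lemma poly_eq_on_nonzero_reals:
  fixes p q :: "complex poly"
  assumes "\<And>y :: real. y \<noteq> 0 \<Longrightarrow> poly p (of_real y) = poly q (of_real y)"
  shows "p = q"
proof (rule ccontr)
  assume "p \<noteq> q"
  hence "finite {y :: real. poly (p - q) (of_real y) = 0}" by (intro finite_real_roots) simp
  moreover have "- {0} \<subseteq> {y :: real. poly (p - q) (of_real y) = 0}" using assms by auto
  ultimately have "finite (- {0 :: real})" by (rule finite_subset[rotated])
  thus False using infinite_UNIV_char_0[where 'a = real] by (simp add: Compl_eq_Diff_UNIV)
qed

lemma eventually_left_avoid:
  fixes f :: "real \<Rightarrow> real"
  assumes "eventually (\<lambda>s. isCont f s) (at_left t)" "eventually (\<lambda>s. f s \<noteq> c) (at_left t)"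
  shows "eventually (\<lambda>s. f s < c) (at_left t) \<or> eventually (\<lambda>s. f s > c) (at_left t)"
proof -
  have "eventually (\<lambda>s. isCont f (- s)) (at_right (- t))"
    using assms(1) by (simp add: eventually_at_left_to_right)
  hence "eventually (\<lambda>s. isCont (\<lambda>s. f (- s)) s) (at_right (- t))"
  proof eventually_elim
    case (elim s)
    show ?case using isCont_o2[where f = uminus and g = f and a = s] elim by (simp add: continuous_intros)
  qed
  from eventually_right_avoid[OF this, of c] assms(2) show ?thesis
    by (simp add: eventually_at_left_to_right)
qed

lemma filterlim_at_bot_imp_at_infinity:
  fixes f :: "'a \<Rightarrow> real"
  shows "filterlim f at_bot Fl \<Longrightarrow> filterlim f at_infinity Fl"
  by (rule filterlim_mono[OF _ at_bot_le_at_infinity order.refl])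

definition jump_sum :: "complex poly fract mat \<Rightarrow> (nat \<Rightarrow> real \<Rightarrow> real) \<Rightarrow> int" where
  "jump_sum F \<mu> = int (card {(j, t). j < dim_row F \<and> jumps_up (\<mu> j) t})
     - int (card {(j, t). j < dim_row F \<and> jumps_down (\<mu> j) t})"

context real_symmetric_rational
begin

text \<open>
  The chart
  \<open>x \<mapsto> 1 / (x - c)\<close> of the projective line is finite at infinity. Choose \<open>c\<close> that is not a root
  of the limit polynomial \<open>q\<close> of the characteristic polynomials. In this chart every sorted eigenvalue has
  a limit on either side. The monic polynomial whose roots are the eigenvalues in this chart
  converges to one polynomial from both sides,
  \<open>y\<^sup>n q(c + 1 / y) / q(c)\<close>, because \<open>q\<close> is a two-sided limit. So the left and the right limits agree as
  multisets, and a permutation \<open>\<pi>\<close> matches them.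
\<close>

lemma pole_link:
  "\<exists>c \<pi> \<gamma>. \<pi> permutes {..<n} \<and> eventually (\<lambda>s. \<forall>k<n. ev k s \<noteq> c) (at t) \<and>
     (\<forall>k<n. ((\<lambda>s. inverse (ev k s - c)) \<longlongrightarrow> \<gamma> k) (at_left t) \<and>
            ((\<lambda>s. inverse (ev (\<pi> k) s - c)) \<longlongrightarrow> \<gamma> k) (at_right t))"
proof -
  obtain Q where Q: "eval_coeffs Q t \<noteq> 0"
    "eventually (\<lambda>s. \<exists>w. w \<noteq> 0 \<and> eval_coeffs Q s = Polynomial.smult w (char_poly (eval_mat F s))) (at t)"
    using char_poly_near_pole[OF carrier] by blast
  define q where "q = eval_coeffs Q t"
  define p where "p s x = poly (eval_coeffs Q s) (complex_of_real x)" for s x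
  have fin: "finite {x :: real. poly q (of_real x) = 0}"
    using Q(1) by (intro finite_real_roots) (simp add: q_def)
  then obtain c where c: "poly q (complex_of_real c) \<noteq> 0"
    using ex_new_if_finite[OF infinite_UNIV_char_0 fin] by blast
  have fact: "eventually (\<lambda>s. \<exists>w. w \<noteq> 0 \<and> (\<forall>x. p s x = w * (\<Prod>i<n. complex_of_real (x - ev i s)))) (at t)"
    using Q(2) eventually_no_pole[of F t UNIV]
  proof eventually_elim
    case (elim s)
    then obtain w where "w \<noteq> 0" "eval_coeffs Q s = Polynomial.smult w (roots_poly n (\<lambda>i. ev i s))"
      using char_poly_ev by auto
    thus ?case by (intro exI[of _ w]) (simp add: p_def poly_prod)
  qed
  have lim: "((\<lambda>s. p s (f s)) \<longlongrightarrow> poly q (of_real x)) Fl" if "Fl \<le> at t" "(f \<longlongrightarrow> x) Fl" for f x Fl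
    unfolding p_def q_def using that
    by (intro tendsto_poly_eval_coeffs tendsto_of_real) (auto intro: tendsto_mono)
  have avoid: "eventually (\<lambda>s. \<forall>k<n. ev k s \<noteq> x) (at t)" if x: "poly q (complex_of_real x) \<noteq> 0" for x
  proof -
    have "eventually (\<lambda>s. p s x \<noteq> 0) (at t)"
      using lim[of "at t" "\<lambda>_. x" x] x by (intro tendsto_imp_eventually_ne) auto
    thus ?thesis using fact
    proof eventually_elim
      case (elim s)
      then obtain w where "p s x = w * (\<Prod>i<n. complex_of_real (x - ev i s))" by blast
      with elim(1) have "(\<Prod>i<n. complex_of_real (x - ev i s)) \<noteq> 0" by auto
      thus ?case by auto
    qed
  qed
  note avoid_c = avoid[OF c]
  define g where "g k s = inverse (ev k s - c)" for k s
  have cont: "eventually (\<lambda>s. isCont (g k) s) (at t)" if k: "k < n" for k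
    using avoid_c eventually_no_pole[of F t UNIV]
  proof eventually_elim
    case (elim s)
    thus ?case using isCont_ev[of s k] k unfolding g_def by (intro continuous_intros) auto
  qed
  \<comment> \<open>the values that the transformed eigenvalues may approach: the images of infinity and of the roots of q\<close>
  define Z where "Z = insert 0 ((\<lambda>x. 1 / (x - c)) ` {x :: real. poly q (of_real x) = 0})"
  have Z: "finite Z" using fin by (simp add: Z_def)
  have gZ: "eventually (\<lambda>s. g k s \<noteq> y) (at t)" if k: "k < n" and y: "y \<notin> Z" for k y
  proof -
    have y0: "y \<noteq> 0" using y by (auto simp: Z_def)
    have "poly q (complex_of_real (c + 1 / y)) \<noteq> 0"
    proof
      assume "poly q (complex_of_real (c + 1 / y)) = 0"
      hence "1 / ((c + 1 / y) - c) \<in> Z" unfolding Z_def by (intro insertI2 imageI) simp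
      thus False using y y0 by simp
    qed
    moreover have "x = c + 1 / y" if "inverse (x - c) = y" for x
    proof -
      have "inverse y = x - c" unfolding that[symmetric] by simp
      thus ?thesis by (simp add: inverse_eq_divide)
    qed
    ultimately show ?thesis
      using avoid[of "c + 1 / y"] k unfolding g_def by (auto elim!: eventually_mono)
  qed
  \<comment> \<open>an infinite limit in the chart would mean that an eigenvalue tends to c, which is not a root of q\<close>
  have noinf: False if "Fl \<le> at t" "Fl \<noteq> bot" "k < n" "filterlim (g k) at_infinity Fl" for k Fl
  proof -
    have "((\<lambda>s. c + inverse (g k s)) \<longlongrightarrow> c + 0) Fl"
      by (intro tendsto_intros filterlim_compose[OF tendsto_inverse_0 that(4)])
    hence "((\<lambda>s. ev k s) \<longlongrightarrow> c) Fl" by (simp add: g_def)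
    from lim[OF that(1) this] have "((\<lambda>s. p s (ev k s)) \<longlongrightarrow> poly q (of_real c)) Fl" .
    moreover have "eventually (\<lambda>s. p s (ev k s) = 0) Fl"
      using filter_leD[OF that(1) fact] by eventually_elim (use that(3) in auto)
    ultimately have "((\<lambda>s. 0) \<longlongrightarrow> poly q (of_real c)) Fl"
      by (rule Lim_transform_eventually)
    hence "poly q (complex_of_real c) = 0" using that(2) by (simp add: tendsto_const_iff)
    thus False using c by simp
  qed
  have le: "at_left t \<le> at t" "at_right t \<le> at t" by (auto intro: at_le)
  have "\<exists>l. (g k \<longlongrightarrow> l) (at_left t)" if k: "k < n" for k
    using left_limit_exists[OF filter_leD[OF le(1) cont[OF k]] Z filter_leD[OF le(1) gZ[OF k]]]
      noinf[OF le(1) _ k] filterlim_at_top_imp_at_infinity filterlim_at_bot_imp_at_infinity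
    by (metis trivial_limit_at_left_real)
  then obtain \<gamma>L where gL: "\<And>k. k < n \<Longrightarrow> (g k \<longlongrightarrow> \<gamma>L k) (at_left t)" by metis
  have "\<exists>l. (g k \<longlongrightarrow> l) (at_right t)" if k: "k < n" for k
    using right_limit_exists[OF filter_leD[OF le(2) cont[OF k]] Z filter_leD[OF le(2) gZ[OF k]]]
      noinf[OF le(2) _ k] filterlim_at_top_imp_at_infinity filterlim_at_bot_imp_at_infinity
    by (metis trivial_limit_at_right_real)
  then obtain \<gamma>R where gR: "\<And>k. k < n \<Longrightarrow> (g k \<longlongrightarrow> \<gamma>R k) (at_right t)" by metis
  have prodlim: "(\<Prod>k<n. complex_of_real (y - \<gamma> k)) = of_real y ^ n * poly q (of_real (c + 1 / y)) / poly q (of_real c)"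
    if y: "y \<noteq> 0" and Fl: "Fl \<le> at t" "Fl \<noteq> bot" and g: "\<And>k. k < n \<Longrightarrow> (g k \<longlongrightarrow> \<gamma> k) Fl" for y \<gamma> Fl
  proof -
    have lim1: "((\<lambda>s. \<Prod>k<n. complex_of_real (y - g k s)) \<longlongrightarrow> (\<Prod>k<n. complex_of_real (y - \<gamma> k))) Fl"
      by (intro tendsto_prod tendsto_of_real tendsto_diff tendsto_const g) auto
    have lim2: "((\<lambda>s. of_real y ^ n * p s (c + 1 / y) / p s c) \<longlongrightarrow>
        of_real y ^ n * poly q (of_real (c + 1 / y)) / poly q (of_real c)) Fl"
      by (intro tendsto_intros lim Fl c)
    have eq: "eventually (\<lambda>s. of_real y ^ n * p s (c + 1 / y) / p s c = (\<Prod>k<n. complex_of_real (y - g k s))) Fl"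
      using filter_leD[OF Fl(1) fact] filter_leD[OF Fl(1) avoid_c]
    proof eventually_elim
      case (elim s)
      then obtain w where w: "w \<noteq> 0" "\<And>x. p s x = w * (\<Prod>i<n. complex_of_real (x - ev i s))" by blast
      have "(\<Prod>k<n. complex_of_real (y - g k s)) =
          (\<Prod>k<n. complex_of_real y * complex_of_real (c + 1 / y - ev k s) / complex_of_real (c - ev k s))"
      proof (intro prod.cong refl)
        fix k assume "k \<in> {..<n}"
        hence "ev k s \<noteq> c" using elim(2) by auto
        define d where "d = ev k s - c"
        have d: "d \<noteq> 0" using \<open>ev k s \<noteq> c\<close> by (simp add: d_def)
        have "y * (c + 1 / y - ev k s) = 1 - y * d"
          using y by (simp add: d_def right_diff_distrib distrib_left)
        moreover have "(y - inverse d) * (- d) = 1 - y * d"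
          using d by (simp add: left_diff_distrib)
        hence "y - inverse d = (1 - y * d) / (- d)"
          using d by (intro nonzero_eq_divide_eq[THEN iffD2]) auto
        ultimately have "y - g k s = y * (c + 1 / y - ev k s) / (c - ev k s)"
          by (simp add: g_def d_def)
        thus "complex_of_real (y - g k s) =
          complex_of_real y * complex_of_real (c + 1 / y - ev k s) / complex_of_real (c - ev k s)"
          by (simp only: of_real_mult of_real_divide)
      qed
      also have "\<dots> = of_real y ^ n * p s (c + 1 / y) / p s c"
        using w by (simp only: prod_dividef prod.distrib prod_constant card_lessThan) simp
      finally show ?case by simp
    qed
    show ?thesis by (rule tendsto_unique[OF Fl(2) lim1 Lim_transform_eventually[OF lim2 eq]])
  qed
  have "roots_poly n \<gamma>L = roots_poly n \<gamma>R"
  proof (rule poly_eq_on_nonzero_reals)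
    fix y :: real assume y: "y \<noteq> 0"
    have "(\<Prod>k<n. complex_of_real (y - \<gamma>L k)) = (\<Prod>k<n. complex_of_real (y - \<gamma>R k))"
      using prodlim[OF y le(1) _ gL] prodlim[OF y le(2) _ gR] by simp
    thus "poly (roots_poly n \<gamma>L) (of_real y) =
        poly (roots_poly n \<gamma>R) (of_real y)"
      by (simp add: poly_prod)
  qed
  from real_roots_mset_eq[OF this]
  obtain \<pi> where \<pi>: "\<pi> permutes {..<n}" "\<forall>k\<in>{..<n}. \<gamma>L k = \<gamma>R (\<pi> k)"
    using image_mset_eq_implies_permutes[of "{..<n}" \<gamma>L \<gamma>R] by blast
  have "(g (\<pi> k) \<longlongrightarrow> \<gamma>L k) (at_right t)" if "k < n" for k
    using gR[of "\<pi> k"] \<pi> that permutes_in_image[OF \<pi>(1), of k] by auto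
  thus ?thesis using \<pi>(1) avoid_c gL unfolding g_def
    by (intro exI[of _ c] exI[of _ \<pi>] exI[of _ \<gamma>L]) auto
qed

text \<open>
  Between consecutive poles take the sorted eigenvalues, and renumber them at every pole by the
  permutation of the preceding lemma. The permutation used at \<open>s\<close> is the composition of
  those of all poles left of \<open>s\<close>, in increasing order. At a pole itself a curve with finite limits
  has to take the limit as value.
\<close>

theorem eigenvalue_curves_exist: "\<exists>\<mu>. eigenvalue_curves F \<mu>"
proof -
  define R where "R t c \<pi> \<gamma> \<longleftrightarrow> \<pi> permutes {..<n} \<and> eventually (\<lambda>s. \<forall>k<n. ev k s \<noteq> c) (at t) \<and>
     (\<forall>k<n. ((\<lambda>s. inverse (ev k s - c)) \<longlongrightarrow> \<gamma> k) (at_left t) \<and>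
            ((\<lambda>s. inverse (ev (\<pi> k) s - c)) \<longlongrightarrow> \<gamma> k) (at_right t))" for t c \<pi> \<gamma>
  have "\<forall>t. \<exists>c \<pi> \<gamma>. R t c \<pi> \<gamma>" unfolding R_def using pole_link by blast
  then obtain c \<pi> \<gamma> where "\<And>t. R t (c t) (\<pi> t) (\<gamma> t)" by metis
  hence link: "\<And>t. \<pi> t permutes {..<n}"
      "\<And>t. eventually (\<lambda>s. \<forall>k<n. ev k s \<noteq> c t) (at t)"
      "\<And>t k. k < n \<Longrightarrow> ((\<lambda>s. inverse (ev k s - c t)) \<longlongrightarrow> \<gamma> t k) (at_left t)"
      "\<And>t k. k < n \<Longrightarrow> ((\<lambda>s. inverse (ev (\<pi> t k) s - c t)) \<longlongrightarrow> \<gamma> t k) (at_right t)"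
    unfolding R_def by blast+
  define ps where "ps = sorted_list_of_set {t. has_pole F t}"
  have ps: "sorted ps" "distinct ps" "set ps = {t. has_pole F t}"
    using finite_poles[of F] by (auto simp: ps_def)
  define \<sigma> where "\<sigma> s = fold (\<lambda>p \<tau>. \<pi> p \<circ> \<tau>) (filter (\<lambda>p. p < s) ps) id" for s
  have "fold (\<lambda>p \<tau>. \<pi> p \<circ> \<tau>) xs \<tau> permutes {..<n}" if "\<tau> permutes {..<n}" for xs \<tau>
    using that by (induction xs arbitrary: \<tau>) (auto intro: permutes_compose link(1))
  hence \<sigma>: "\<sigma> s permutes {..<n}" for s unfolding \<sigma>_def using permutes_id by blast
  have \<sigma>n: "\<sigma> s k < n \<longleftrightarrow> k < n" for s k using permutes_in_image[OF \<sigma>, of s k] by auto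
  have near: "eventually (\<lambda>s. (\<forall>p. has_pole F p \<longrightarrow> p = t \<or> (p < s \<longleftrightarrow> p < t)) \<and> \<not> has_pole F s \<and> s \<noteq> t) (at t)" for t
  proof -
    obtain d where d: "d > 0" "\<And>s. s \<noteq> t \<Longrightarrow> dist s t < d \<Longrightarrow> \<not> has_pole F s"
      using eventually_no_pole[of F t UNIV] unfolding eventually_at by auto
    have "p = t \<or> (p < s \<longleftrightarrow> p < t)" if "dist s t < d" "has_pole F p" for s p
    proof -
      have "p = t \<or> \<bar>p - t\<bar> \<ge> d" using d(2)[of p] that(2) unfolding dist_real_def by (meson not_less)
      moreover have "\<bar>s - t\<bar> < d" using that(1) by (simp add: dist_real_def)
      ultimately show ?thesis by arith
    qed
    thus ?thesis using d unfolding eventually_at by blast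
  qed
  have \<sigma>_left: "\<sigma> s = \<sigma> t" if "\<forall>p. has_pole F p \<longrightarrow> p = t \<or> (p < s \<longleftrightarrow> p < t)" "s < t \<or> \<not> has_pole F t" for s t
  proof -
    have "filter (\<lambda>p. p < s) ps = filter (\<lambda>p. p < t) ps"
      using that ps(3) by (intro filter_cong) auto
    thus ?thesis by (simp add: \<sigma>_def)
  qed
  have \<sigma>_right: "\<sigma> s = \<pi> t \<circ> \<sigma> t"
    if *: "\<forall>p. has_pole F p \<longrightarrow> p = t \<or> (p < s \<longleftrightarrow> p < t)" "t < s" "has_pole F t" for s t
  proof -
    have "filter (\<lambda>p. p < s) ps = filter (\<lambda>p. p < t) ps @ [t]"
      by (rule sorted_distinct_set_unique) (use ps * in \<open>auto simp: sorted_append intro: sorted_wrt_filter\<close>)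
    thus ?thesis by (simp add: \<sigma>_def)
  qed
  define cv where "cv k s = ev (\<sigma> s k) s" for k s
  define \<mu> where "\<mu> k s = (if has_pole F s then Lim (at s) (cv k) else cv k s)" for k s
  have "char_poly (eval_mat F t) = roots_poly n (\<lambda>j. \<mu> j t)" if "\<not> has_pole F t" for t
  proof -
    have "roots_poly n (\<lambda>j. \<mu> j t) = (\<Prod>j<n. [:- complex_of_real (ev (\<sigma> t j) t), 1:])"
      using that by (simp add: \<mu>_def cv_def)
    also have "\<dots> = roots_poly n (\<lambda>j. ev j t)"
      using prod.permute[OF \<sigma>[of t], of "\<lambda>j. [:- complex_of_real (ev j t), 1:]"] by (simp add: o_def)
    finally show ?thesis using char_poly_ev[OF that] by simp
  qed
  moreover have "isCont (\<mu> k) t \<or> filterlim (\<mu> k) at_infinity (at t)" if k: "k < n" for k t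
  proof (cases "has_pole F t")
    case False
    have "eventually (\<lambda>s. \<mu> k s = ev (\<sigma> t k) s) (at t)"
      using near[of t]
    proof eventually_elim
      case (elim s)
      have "\<sigma> s = \<sigma> t" by (rule \<sigma>_left) (use elim False in blast)+
      thus ?case using elim by (simp add: \<mu>_def cv_def)
    qed
    hence "eventually (\<lambda>s. \<mu> k s = ev (\<sigma> t k) s) (nhds t)"
      using False by (simp add: eventually_nhds_conv_at \<mu>_def cv_def)
    thus ?thesis using isCont_ev[OF False, of "\<sigma> t k"] k \<sigma>n isCont_cong by blast
  next
    case True
    define G where "G s = inverse (cv k s - c t)" for s
    have \<mu>cv: "eventually (\<lambda>s. cv k s = \<mu> k s) (at t)"
      using near[of t] by eventually_elim (simp add: \<mu>_def)
    have n1: "eventually (\<lambda>s. (\<forall>p. has_pole F p \<longrightarrow> p = t \<or> (p < s \<longleftrightarrow> p < t)) \<and> s < t) (at_left t)"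
      using near[of t] by (auto simp: eventually_at_filter elim!: eventually_mono)
    have n2: "eventually (\<lambda>s. (\<forall>p. has_pole F p \<longrightarrow> p = t \<or> (p < s \<longleftrightarrow> p < t)) \<and> t < s) (at_right t)"
      using near[of t] by (auto simp: eventually_at_filter elim!: eventually_mono)
    have "eventually (\<lambda>s. inverse (ev (\<sigma> t k) s - c t) = G s) (at_left t)"
      using n1
    proof eventually_elim
      case (elim s)
      have "\<sigma> s = \<sigma> t" by (rule \<sigma>_left) (use elim in blast)+
      thus ?case by (simp add: G_def cv_def)
    qed
    from Lim_transform_eventually[OF link(3)[of "\<sigma> t k" t] this]
    have GL: "(G \<longlongrightarrow> \<gamma> t (\<sigma> t k)) (at_left t)" using k \<sigma>n by simp
    have "eventually (\<lambda>s. inverse (ev (\<pi> t (\<sigma> t k)) s - c t) = G s) (at_right t)"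
      using n2
    proof eventually_elim
      case (elim s)
      have "\<sigma> s = \<pi> t \<circ> \<sigma> t" by (rule \<sigma>_right) (use elim True in blast)+
      thus ?case by (simp add: G_def cv_def)
    qed
    from Lim_transform_eventually[OF link(4)[of "\<sigma> t k" t] this]
    have "(G \<longlongrightarrow> \<gamma> t (\<sigma> t k)) (at_right t)" using k \<sigma>n by simp
    with GL have G: "(G \<longlongrightarrow> \<gamma> t (\<sigma> t k)) (at t)" using filterlim_split_at by blast
    show ?thesis
    proof (cases "\<gamma> t (\<sigma> t k) = 0")
      case False
      define L where "L = c t + inverse (\<gamma> t (\<sigma> t k))"
      have "((\<lambda>s. c t + inverse (G s)) \<longlongrightarrow> L) (at t)"
        unfolding L_def by (intro tendsto_intros G False)
      hence cvL: "(cv k \<longlongrightarrow> L) (at t)" by (simp add: G_def)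
      hence "Lim (at t) (cv k) = L" by (intro tendsto_Lim) auto
      hence "\<mu> k t = L" using True by (simp add: \<mu>_def)
      with Lim_transform_eventually[OF cvL \<mu>cv] have "isCont (\<mu> k) t" by (simp add: isCont_def)
      thus ?thesis ..
    next
      case True
      have "eventually (\<lambda>s. G s \<noteq> 0) (at t)"
        using link(2)[of t] by eventually_elim (use k \<sigma>n in \<open>auto simp: G_def cv_def\<close>)
      with G True have "filterlim G (at 0) (at t)" by (simp add: filterlim_at)
      hence "filterlim (\<lambda>s. inverse (G s)) at_infinity (at t)"
        by (rule filterlim_compose[OF filterlim_inverse_at_infinity])
      from tendsto_add_filterlim_at_infinity[OF tendsto_const this, of "c t"]
      have "filterlim (cv k) at_infinity (at t)" by (simp add: G_def)
      hence "filterlim (\<mu> k) at_infinity (at t)"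
        using filterlim_cong[OF refl refl \<mu>cv] by simp
      thus ?thesis ..
    qed
  qed
  ultimately have "eigenvalue_curves F \<mu>" using carrier by (auto simp: eigenvalue_curves_def)
  thus ?thesis by (blast intro: exI[of _ \<mu>])
qed

lemma curve_value_is_eigenvalue:
  assumes \<mu>: "eigenvalue_curves F \<mu>" and t: "\<not> has_pole F t" and j: "j < n"
  shows "\<exists>k<n. \<mu> j t = ev k t"
proof -
  have "roots_poly n (\<lambda>j. \<mu> j t) = roots_poly n (\<lambda>k. ev k t)"
    using \<mu> t carrier char_poly_ev[OF t] by (auto simp: eigenvalue_curves_def)
  from arg_cong[OF this, of "\<lambda>p. poly p (of_real (\<mu> j t))"]
  have "(\<Prod>k<n. complex_of_real (\<mu> j t - \<mu> k t)) = (\<Prod>k<n. complex_of_real (\<mu> j t - ev k t))"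
    by (simp add: poly_prod)
  moreover have "(\<Prod>k<n. complex_of_real (\<mu> j t - \<mu> k t)) = 0" using j by auto
  ultimately have "(\<Prod>k<n. complex_of_real (\<mu> j t - ev k t)) = 0" by simp
  thus ?thesis by auto
qed

text \<open>
  The definition of eigenvalue curves would allow a curve to tend to infinity anywhere, but near
  a point that is no pole the eigenvalues are bounded.
\<close>

lemma curve_isCont:
  assumes \<mu>: "eigenvalue_curves F \<mu>" and t: "\<not> has_pole F t" and j: "j < n"
  shows "isCont (\<mu> j) t"
proof (rule ccontr)
  assume "\<not> ?thesis"
  hence "filterlim (\<mu> j) at_infinity (at t)"
    using \<mu> j carrier by (auto simp: eigenvalue_curves_def)
  from filterlim_at_infinity_imp_norm_at_top[OF this]
  have "eventually (\<lambda>s. norm (\<mu> j s) \<ge> (\<Sum>k<n. \<bar>ev k t\<bar>) + 1) (at t)"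
    unfolding filterlim_at_top by blast
  moreover have "((\<lambda>s. \<Sum>k<n. \<bar>ev k s\<bar>) \<longlongrightarrow> (\<Sum>k<n. \<bar>ev k t\<bar>)) (at t)"
    using isCont_ev[OF t] by (intro tendsto_intros) (auto simp: isCont_def)
  hence "eventually (\<lambda>s. (\<Sum>k<n. \<bar>ev k s\<bar>) < (\<Sum>k<n. \<bar>ev k t\<bar>) + 1) (at t)"
    by (rule order_tendstoD) simp
  ultimately have "eventually (\<lambda>s. False) (at t)" using eventually_no_pole[of F t UNIV]
  proof eventually_elim
    case (elim s)
    obtain k where k: "k < n" "\<mu> j s = ev k s" using curve_value_is_eigenvalue[OF \<mu> elim(3) j] by blast
    have "\<bar>ev k s\<bar> \<le> (\<Sum>k<n. \<bar>ev k s\<bar>)" using k(1) by (intro member_le_sum) auto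
    thus False using elim k by simp
  qed
  thus False by simp
qed

text \<open>
  An unbounded curve does not change its sign on either side of the point, since it is
  continuous there.
\<close>

lemma curve_one_sided:
  assumes \<mu>: "eigenvalue_curves F \<mu>" and j: "j < n"
  shows "isCont (\<mu> j) t \<or> ((filterlim (\<mu> j) at_top (at_left t) \<or> filterlim (\<mu> j) at_bot (at_left t)) \<and>
    (filterlim (\<mu> j) at_top (at_right t) \<or> filterlim (\<mu> j) at_bot (at_right t)))"
proof (cases "isCont (\<mu> j) t")
  case False
  hence inf: "filterlim (\<mu> j) at_infinity (at t)"
    using \<mu> j carrier by (auto simp: eigenvalue_curves_def)
  have nz: "eventually (\<lambda>s. \<mu> j s \<noteq> 0) (at t)"
    using inf by (rule filterlim_at_infinity_imp_eventually_ne)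
  have cont: "eventually (\<lambda>s. isCont (\<mu> j) s) (at t)"
    using eventually_no_pole[of F t UNIV] by eventually_elim (rule curve_isCont[OF \<mu> _ j])
  have le: "at_left t \<le> at t" "at_right t \<le> at t" by (auto intro: at_le)
  have pos: "filterlim (\<mu> j) at_top Fl" if "Fl \<le> at t" "eventually (\<lambda>s. \<mu> j s > 0) Fl" for Fl
    using filterlim_at_infinity_imp_filterlim_at_top[OF filterlim_mono[OF inf order.refl that(1)] that(2)] .
  have neg: "filterlim (\<mu> j) at_bot Fl" if "Fl \<le> at t" "eventually (\<lambda>s. \<mu> j s < 0) Fl" for Fl
    using filterlim_at_infinity_imp_filterlim_at_bot[OF filterlim_mono[OF inf order.refl that(1)] that(2)] .
  show ?thesis
    using eventually_left_avoid[OF filter_leD[OF le(1) cont] filter_leD[OF le(1) nz]]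
      eventually_right_avoid[OF filter_leD[OF le(2) cont] filter_leD[OF le(2) nz]]
      pos[OF le(1)] pos[OF le(2)] neg[OF le(1)] neg[OF le(2)] by blast
qed simp

lemma isCont_not_infinite:
  fixes f :: "real \<Rightarrow> real"
  assumes "isCont f t" "Fl \<le> at t" "Fl \<noteq> bot"
  shows "\<not> filterlim f at_top Fl" "\<not> filterlim f at_bot Fl" "eventually (\<lambda>s. f s \<le> f t + 1) Fl"
proof -
  have lim: "(f \<longlongrightarrow> f t) Fl" using assms(1,2) by (auto simp: isCont_def intro: tendsto_mono)
  show "\<not> filterlim f at_top Fl" using not_tendsto_and_filterlim_at_infinity[OF assms(3) lim] filterlim_at_top_imp_at_infinity by blast
  show "\<not> filterlim f at_bot Fl" using not_tendsto_and_filterlim_at_infinity[OF assms(3) lim] filterlim_at_bot_imp_at_infinity by blast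
  have "eventually (\<lambda>s. f s < f t + 1) Fl" using lim by (rule order_tendstoD) simp
  thus "eventually (\<lambda>s. f s \<le> f t + 1) Fl" by eventually_elim simp
qed

lemma not_top_and_bot:
  fixes f :: "real \<Rightarrow> real"
  assumes "Fl \<noteq> bot" "filterlim f at_top Fl" "filterlim f at_bot Fl"
  shows False
proof -
  have "eventually (\<lambda>s. f s > 0) Fl" using assms(2) by (simp add: filterlim_at_top_dense)
  moreover have "eventually (\<lambda>s. f s < 0) Fl" using assms(3) by (simp add: filterlim_at_bot_dense)
  ultimately have "eventually (\<lambda>s. False) Fl" by eventually_elim simp
  thus False using assms(1) by simp
qed

text \<open>
  For \<open>Fl\<close> one of the filters \<open>at_left t\<close> and \<open>at_right t\<close>.
\<close>

definition top_count :: "(nat \<Rightarrow> real \<Rightarrow> real) \<Rightarrow> real filter \<Rightarrow> nat" where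
  "top_count \<mu> Fl = card {j. j < n \<and> filterlim (\<mu> j) at_top Fl}"

text \<open>
  A curve that tends to \<open>+\<infinity>\<close> on both sides of \<open>t\<close> cancels in the difference at \<open>t\<close>, and a curve
  that tends to \<open>-\<infinity>\<close> on both sides does not occur in it. What remains are the jumps.
\<close>

lemma jump_difference:
  assumes \<mu>: "eigenvalue_curves F \<mu>" and T: "finite T" "{t. has_pole F t} \<subseteq> T"
  shows "jump_sum F \<mu> = (\<Sum>t\<in>T. int (top_count \<mu> (at_right t)) - int (top_count \<mu> (at_left t)))"
proof -
  have le: "at_left t \<le> at t" "at_right t \<le> at t" for t :: real by (auto intro: at_le)
  have nb: "at_left t \<noteq> bot" "at_right t \<noteq> bot" for t :: real by auto
  have inT: "t \<in> T" if "j < n" "jumps_up (\<mu> j) t \<or> jumps_down (\<mu> j) t" for j t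
  proof (rule ccontr)
    assume "t \<notin> T"
    hence "isCont (\<mu> j) t" using T by (intro curve_isCont[OF \<mu> _ that(1)]) auto
    from isCont_not_infinite[OF this le(2) nb(2)] that(2) show False
      by (auto simp: jumps_up_def jumps_down_def)
  qed
  have dim: "dim_row F = n" using carrier by simp
  have count: "card {(j, t). j < dim_row F \<and> J (\<mu> j) t} = (\<Sum>t\<in>T. card {j. j < n \<and> J (\<mu> j) t})"
    if J: "\<And>j t. j < n \<Longrightarrow> J (\<mu> j) t \<Longrightarrow> t \<in> T" for J :: "(real \<Rightarrow> real) \<Rightarrow> real \<Rightarrow> bool"
  proof -
    have "{(j, t). j < dim_row F \<and> J (\<mu> j) t} = prod.swap ` (SIGMA t:T. {j. j < n \<and> J (\<mu> j) t})"
      using J by (auto simp: dim image_iff)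
    hence "card {(j, t). j < dim_row F \<and> J (\<mu> j) t} = card (SIGMA t:T. {j. j < n \<and> J (\<mu> j) t})"
      by (simp add: card_image)
    also have "\<dots> = (\<Sum>t\<in>T. card {j. j < n \<and> J (\<mu> j) t})"
      using T by (intro card_SigmaI) auto
    finally show ?thesis .
  qed
  have pt: "int (card {j. j < n \<and> jumps_up (\<mu> j) t}) - int (card {j. j < n \<and> jumps_down (\<mu> j) t}) =
     int (top_count \<mu> (at_right t)) - int (top_count \<mu> (at_left t))" for t
  proof -
    define R L B where "R = {j. j < n \<and> filterlim (\<mu> j) at_top (at_right t)}"
      and "L = {j. j < n \<and> filterlim (\<mu> j) at_top (at_left t)}" and "B = R \<inter> L"
    have fin: "finite R" "finite L" "finite B" by (auto simp: R_def L_def B_def)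
    have up: "{j. j < n \<and> jumps_up (\<mu> j) t} = R - B"
      using curve_one_sided[OF \<mu>, of _ t] isCont_not_infinite[OF _ le(2) nb(2)] not_top_and_bot[OF nb(1)]
      unfolding R_def L_def B_def jumps_up_def by blast
    have down: "{j. j < n \<and> jumps_down (\<mu> j) t} = L - B"
      using curve_one_sided[OF \<mu>, of _ t] isCont_not_infinite[OF _ le(1) nb(1)] not_top_and_bot[OF nb(2)]
      unfolding R_def L_def B_def jumps_down_def by blast
    have "card (R - B) + card B = card R" "card (L - B) + card B = card L"
      using fin by (auto simp: B_def card_Diff_subset card_mono)
    thus ?thesis unfolding up down top_count_def R_def[symmetric] L_def[symmetric] by linarith
  qed
  show ?thesis
    unfolding jump_sum_def
    using count[of jumps_up, OF inT[OF _ disjI1]] count[of jumps_down, OF inT[OF _ disjI2]]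
    by (simp add: pt[symmetric] sum_subtractf)
qed

lemma curve_top_or_bounded:
  assumes \<mu>: "eigenvalue_curves F \<mu>" and j: "j < n" and Fl: "Fl = at_left t \<or> Fl = at_right t"
  shows "filterlim (\<mu> j) at_top Fl \<or> (\<exists>K. eventually (\<lambda>s. \<mu> j s \<le> K) Fl)"
proof -
  have le: "at_left t \<le> at t" "at_right t \<le> at t" by (auto intro: at_le)
  hence "Fl \<le> at t" using Fl by auto
  moreover have "Fl \<noteq> bot" using Fl trivial_limit_at_left_real trivial_limit_at_right_real by metis
  ultimately have "isCont (\<mu> j) t \<Longrightarrow> ?thesis" using isCont_not_infinite(3) by blast
  moreover have "filterlim (\<mu> j) at_bot Fl \<Longrightarrow> ?thesis" by (auto simp: filterlim_at_bot)
  ultimately show ?thesis using curve_one_sided[OF \<mu> j, of t] Fl by blast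
qed

end

text \<open>
  Beyond a large threshold \<open>K\<close>, the curves \<open>\<nu> j\<close> with \<open>\<nu> j s > K\<close> are among those that tend to
  \<open>+\<infinity>\<close>; conversely all \<open>\<mu> j\<close> that tend to \<open>+\<infinity>\<close> eventually exceed \<open>K + C\<close>. So these numbers can be
  read off from the eigenvalues at points near \<open>t\<close>, without regard to the curves.
\<close>

lemma card_top_le:
  fixes \<mu> \<nu> :: "nat \<Rightarrow> 'a \<Rightarrow> real"
  assumes Fl: "Fl \<noteq> bot"
    and \<nu>: "\<And>j. j < n' \<Longrightarrow> filterlim (\<nu> j) at_top Fl \<or> (\<exists>K. eventually (\<lambda>s. \<nu> j s \<le> K) Fl)"
    and dom: "\<And>K. K \<ge> K0 \<Longrightarrow> eventually (\<lambda>s. card {i. i < n \<and> \<mu> i s > K + C} \<le> card {i. i < n' \<and> \<nu> i s > K}) Fl"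
  shows "card {j. j < n \<and> filterlim (\<mu> j) at_top Fl} \<le> card {j. j < n' \<and> filterlim (\<nu> j) at_top Fl}"
proof -
  obtain B where B: "\<And>j. j < n' \<Longrightarrow> \<not> filterlim (\<nu> j) at_top Fl \<Longrightarrow> eventually (\<lambda>s. \<nu> j s \<le> B j) Fl"
    using \<nu> by metis
  define K where "K = \<bar>K0\<bar> + (\<Sum>j<n'. \<bar>B j\<bar>)"
  have BK: "B j \<le> K" if "j < n'" for j
  proof -
    have "\<bar>B j\<bar> \<le> (\<Sum>j<n'. \<bar>B j\<bar>)" using that by (intro member_le_sum) auto
    thus ?thesis unfolding K_def by linarith
  qed
  have "0 \<le> (\<Sum>j<n'. \<bar>B j\<bar>)" by (simp add: sum_nonneg)
  hence "K \<ge> K0" unfolding K_def by linarith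
  note d = dom[OF this]
  have "eventually (\<lambda>s. \<forall>j\<in>{j. j < n \<and> filterlim (\<mu> j) at_top Fl}. \<mu> j s > K + C) Fl"
    by (intro eventually_ball_finite) (auto simp: filterlim_at_top_dense)
  moreover have "eventually (\<lambda>s. \<forall>j\<in>{j. j < n' \<and> \<not> filterlim (\<nu> j) at_top Fl}. \<nu> j s \<le> B j) Fl"
    by (intro eventually_ball_finite) (auto intro: B)
  ultimately have "eventually (\<lambda>s. card {j. j < n \<and> filterlim (\<mu> j) at_top Fl} \<le> card {j. j < n' \<and> filterlim (\<nu> j) at_top Fl}) Fl"
    using d
  proof eventually_elim
    case (elim s)
    have "card {j. j < n \<and> filterlim (\<mu> j) at_top Fl} \<le> card {i. i < n \<and> \<mu> i s > K + C}"
      using elim(1) by (intro card_mono) auto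
    also note elim(3)
    also have "card {i. i < n' \<and> \<nu> i s > K} \<le> card {j. j < n' \<and> filterlim (\<nu> j) at_top Fl}"
      using elim(2) BK by (intro card_mono) (auto, force)
    finally show ?case .
  qed
  thus ?thesis using Fl by simp
qed

definition large_eigenvalues_le ::
  "complex poly fract mat \<Rightarrow> real \<Rightarrow> complex poly fract mat \<Rightarrow> real \<Rightarrow> real \<Rightarrow> bool" where
  "large_eigenvalues_le F a F' b s \<longleftrightarrow> (\<forall>\<alpha> \<beta>.
     char_poly (eval_mat F s) = roots_poly (dim_row F) \<alpha> \<longrightarrow>
     char_poly (eval_mat F' s) = roots_poly (dim_row F') \<beta> \<longrightarrow>
     card {i. i < dim_row F \<and> \<alpha> i > a} \<le> card {i. i < dim_row F' \<and> \<beta> i > b})"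

text \<open>
  The shift \<open>C\<close> absorbs perturbations that stay bounded near \<open>t\<close>.
\<close>

definition eig_dominated :: "complex poly fract mat \<Rightarrow> complex poly fract mat \<Rightarrow> bool" where
  "eig_dominated F F' \<longleftrightarrow> (\<forall>t. \<exists>C K0. \<forall>K\<ge>K0.
     eventually (\<lambda>s. large_eigenvalues_le F (K + C) F' K s) (at t))"

lemma eig_dominated_refl: "eig_dominated F F"
proof -
  have "large_eigenvalues_le F K F K s" for K s
    unfolding large_eigenvalues_le_def
    by (auto intro!: eq_imp_le card_root_pred_eq[where Q = "\<lambda>x. x > K"])
  thus ?thesis unfolding eig_dominated_def by (intro allI exI[of _ 0] impI always_eventually) simp
qed

lemma large_eigenvalues_leI:
  assumes F: "real_symmetric_rational p F" "\<not> has_pole F s"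
    and F': "real_symmetric_rational q F'" "\<not> has_pole F' s" and T: "T \<in> carrier_mat q p"
    and le: "\<And>x. x \<in> carrier_vec p \<Longrightarrow> a * sqn x < hform (eval_mat F s) x \<Longrightarrow>
      b * sqn (T *\<^sub>v x) < hform (eval_mat F' s) (T *\<^sub>v x)"
  shows "large_eigenvalues_le F a F' b s"
proof -
  interpret F: real_symmetric_rational p F by (rule F(1))
  interpret F': real_symmetric_rational q F' by (rule F'(1))
  have dims: "dim_row F = p" "dim_row F' = q" using F.carrier F'.carrier by auto
  show ?thesis unfolding large_eigenvalues_le_def dims
    by (intro allI impI inertia_comparison[OF _ F.hermitian[OF F(2)] _ _ F'.hermitian[OF F'(2)] _ T le])
      (use F.carrier F'.carrier in auto)
qed

lemma top_count_le:
  assumes F: "real_symmetric_rational n F" and F': "real_symmetric_rational n' F'"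
    and dom: "eig_dominated F F'" and \<mu>: "eigenvalue_curves F \<mu>" and \<nu>: "eigenvalue_curves F' \<nu>"
    and Fl: "Fl = at_left t \<or> Fl = at_right t"
  shows "real_symmetric_rational.top_count n \<mu> Fl \<le> real_symmetric_rational.top_count n' \<nu> Fl"
proof -
  interpret F: real_symmetric_rational n F by fact
  interpret F': real_symmetric_rational n' F' by fact
  have dims: "dim_row F = n" "dim_row F' = n'" using F.carrier F'.carrier by auto
  have Fl': "Fl \<le> at t" using Fl by (auto intro: at_le)
  have Fl'': "Fl \<noteq> bot" using Fl trivial_limit_at_left_real trivial_limit_at_right_real by metis
  obtain C K0 where CK: "\<And>K. K \<ge> K0 \<Longrightarrow> eventually (\<lambda>s. large_eigenvalues_le F (K + C) F' K s) (at t)"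
    using dom unfolding eig_dominated_def by blast
  show ?thesis unfolding F.top_count_def F'.top_count_def
  proof (rule card_top_le[OF Fl''])
    show "filterlim (\<nu> j) at_top Fl \<or> (\<exists>K. eventually (\<lambda>s. \<nu> j s \<le> K) Fl)" if "j < n'" for j
      by (rule F'.curve_top_or_bounded[OF \<nu> that Fl])
    fix K assume K: "K \<ge> K0"
    show "eventually (\<lambda>s. card {i. i < n \<and> \<mu> i s > K + C} \<le> card {i. i < n' \<and> \<nu> i s > K}) Fl"
      using filter_leD[OF Fl' CK[OF K]] filter_leD[OF Fl' eventually_no_pole[of F t UNIV]]
        filter_leD[OF Fl' eventually_no_pole[of F' t UNIV]]
    proof eventually_elim
      case (elim s)
      have "char_poly (eval_mat F s) = roots_poly n (\<lambda>i. \<mu> i s)"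
        "char_poly (eval_mat F' s) = roots_poly n' (\<lambda>i. \<nu> i s)"
        using \<mu> \<nu> elim dims by (auto simp: eigenvalue_curves_def)
      from elim(1)[unfolded large_eigenvalues_le_def dims, rule_format, OF this] show ?case .
    qed
  qed
qed

lemma jump_difference_eq:
  assumes F: "real_symmetric_rational n F" and F': "real_symmetric_rational n' F'"
    and dom: "eig_dominated F F'" "eig_dominated F' F"
    and \<mu>: "eigenvalue_curves F \<mu>" and \<nu>: "eigenvalue_curves F' \<nu>"
  shows "jump_sum F \<mu> = jump_sum F' \<nu>"
proof -
  interpret F: real_symmetric_rational n F by fact
  interpret F': real_symmetric_rational n' F' by fact
  define T where "T = {t. has_pole F t} \<union> {t. has_pole F' t}"
  have T: "finite T" "{t. has_pole F t} \<subseteq> T" "{t. has_pole F' t} \<subseteq> T"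
    using finite_poles by (auto simp: T_def)
  have eq: "F.top_count \<mu> Fl = F'.top_count \<nu> Fl" if "Fl = at_left t \<or> Fl = at_right t" for Fl t
    using top_count_le[OF F F' dom(1) \<mu> \<nu> that] top_count_le[OF F' F dom(2) \<nu> \<mu> that] by simp
  thus ?thesis
    unfolding F.jump_difference[OF \<mu> T(1,2)] F'.jump_difference[OF \<nu> T(1,3)] using eq[OF disjI1[OF refl]] eq[OF disjI2[OF refl]] by simp
qed

text \<open>
  With \<open>F' = F\<close>, mutual domination holds and shows that the jump sum does not depend on the system of
  curves. Together with the existence of curves this makes the index well defined.
\<close>

theorem Ind_CM_eqI:
  assumes F: "real_symmetric_rational n F" and F': "real_symmetric_rational n' F'"
    and dom: "eig_dominated F F'" "eig_dominated F' F"
  shows "Ind_CM F = Ind_CM F'"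
proof -
  obtain \<mu> where \<mu>: "eigenvalue_curves F \<mu>" using real_symmetric_rational.eigenvalue_curves_exist[OF F] by blast
  obtain \<nu> where \<nu>: "eigenvalue_curves F' \<nu>" using real_symmetric_rational.eigenvalue_curves_exist[OF F'] by blast
  have Ind: "Ind_CM H = (THE c. \<exists>\<xi>. eigenvalue_curves H \<xi> \<and> c = jump_sum H \<xi>)" for H
    by (simp add: Ind_CM_def jump_sum_def)
  have "Ind_CM F = jump_sum F \<mu>" unfolding Ind
  proof (rule the_equality)
    show "\<exists>\<xi>. eigenvalue_curves F \<xi> \<and> jump_sum F \<mu> = jump_sum F \<xi>" using \<mu> by blast
    fix d assume "\<exists>\<xi>. eigenvalue_curves F \<xi> \<and> d = jump_sum F \<xi>"
    thus "d = jump_sum F \<mu>"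
      using jump_difference_eq[OF F F eig_dominated_refl eig_dominated_refl _ \<mu>] by blast
  qed
  moreover have "Ind_CM F' = jump_sum F' \<nu>" unfolding Ind
  proof (rule the_equality)
    show "\<exists>\<xi>. eigenvalue_curves F' \<xi> \<and> jump_sum F' \<nu> = jump_sum F' \<xi>" using \<nu> by blast
    fix d assume "\<exists>\<xi>. eigenvalue_curves F' \<xi> \<and> d = jump_sum F' \<xi>"
    thus "d = jump_sum F' \<nu>"
      using jump_difference_eq[OF F' F' eig_dominated_refl eig_dominated_refl _ \<nu>] by blast
  qed
  ultimately show ?thesis using jump_difference_eq[OF F F' dom \<mu> \<nu>] by simp
qed

section \<open>Polynomial and strictly proper parts\<close>

abbreviation rpoly :: "real poly \<Rightarrow> complex poly" where
  "rpoly \<equiv> map_poly complex_of_real"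

lemma rpoly_add: "rpoly (p + q) = rpoly p + rpoly q"
  by (rule poly_eqI) (simp add: coeff_map_poly)

lemma rpoly_mult: "rpoly (p * q) = rpoly p * rpoly q"
  by (rule poly_eqI) (simp add: coeff_map_poly coeff_mult)

lemma rpoly_eq_0_iff: "rpoly p = 0 \<longleftrightarrow> p = 0"
  by (simp add: map_poly_eq_0_iff)

lemma degree_rpoly: "degree (rpoly p) = degree p"
  by (simp add: degree_map_poly)

definition real_coeffs :: "complex poly \<Rightarrow> bool" where
  "real_coeffs p \<longleftrightarrow> (\<forall>i. coeff p i \<in> \<real>)"

lemma real_coeffs_rpoly: "real_coeffs p \<longleftrightarrow> (\<exists>q. p = rpoly q)"
proof
  assume "real_coeffs p"
  hence "p = rpoly (map_poly Re p)"
    by (intro poly_eqI) (auto simp: coeff_map_poly real_coeffs_def)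
  thus "\<exists>q. p = rpoly q" ..
qed (auto simp: real_coeffs_def coeff_map_poly)

lemma real_fract_to_fract:
  assumes "real_coeffs p" shows "real_fract (to_fract p)"
proof -
  obtain q where "p = rpoly q" using assms unfolding real_coeffs_rpoly by blast
  hence "to_fract p = Fract (rpoly q) (rpoly 1)" by (simp add: to_fract_def)
  thus ?thesis unfolding real_fract_def by (intro exI[of _ q] exI[of _ 1]) simp
qed

lemma real_fract_add:
  assumes "real_fract f" "real_fract g" shows "real_fract (f + g)"
proof -
  obtain p q p' q' where *: "q \<noteq> 0" "f = Fract (rpoly p) (rpoly q)" "q' \<noteq> 0" "g = Fract (rpoly p') (rpoly q')"
    using assms unfolding real_fract_def by blast
  hence "f + g = Fract (rpoly (p * q' + p' * q)) (rpoly (q * q'))"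
    by (simp add: rpoly_add rpoly_mult rpoly_eq_0_iff)
  moreover have "q * q' \<noteq> 0" using * by simp
  ultimately show ?thesis unfolding real_fract_def by blast
qed

lemma real_fract_mult:
  assumes "real_fract f" "real_fract g" shows "real_fract (f * g)"
proof -
  obtain p q p' q' where *: "q \<noteq> 0" "f = Fract (rpoly p) (rpoly q)" "q' \<noteq> 0" "g = Fract (rpoly p') (rpoly q')"
    using assms unfolding real_fract_def by blast
  hence "f * g = Fract (rpoly (p * p')) (rpoly (q * q'))"
    by (simp add: rpoly_mult)
  moreover have "q * q' \<noteq> 0" using * by simp
  ultimately show ?thesis unfolding real_fract_def by blast
qed

lemma real_fract_sum: "(\<And>i. i \<in> I \<Longrightarrow> real_fract (f i)) \<Longrightarrow> real_fract (sum f I)"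
proof (induction I rule: infinite_finite_induct)
  case (insert x F)
  thus ?case by (auto intro: real_fract_add)
qed (use real_fract_to_fract[of 0] in \<open>auto simp: real_coeffs_def\<close>)

lemma real_rational_mat_add:
  "A \<in> carrier_mat m n \<Longrightarrow> B \<in> carrier_mat m n \<Longrightarrow> real_rational_mat A \<Longrightarrow> real_rational_mat B
    \<Longrightarrow> real_rational_mat (A + B)"
  by (auto simp: real_rational_mat_def intro: real_fract_add)

lemma real_rational_mat_mult:
  assumes "A \<in> carrier_mat m n" "B \<in> carrier_mat n k" "real_rational_mat A" "real_rational_mat B"
  shows "real_rational_mat (A * B)"
  using assms
  by (auto simp: real_rational_mat_def scalar_prod_def intro!: real_fract_sum real_fract_mult)

text \<open>
  Division with remainder over the reals yields another decomposition into a polynomial and a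
  strictly proper part, and such a decomposition is unique for reasons of degree.
\<close>

lemma polynomial_part_real:
  assumes f: "real_fract f" "f = to_fract p + Fract u d" and d: "d \<noteq> 0" "u = 0 \<or> degree u < degree d"
  shows "real_coeffs p" "real_fract (Fract u d)"
proof -
  obtain a b where b: "b \<noteq> 0" and fab: "f = Fract (rpoly a) (rpoly b)"
    using f(1) unfolding real_fract_def by blast
  define s r where "s = a div b" and "r = a mod b"
  have a: "rpoly a = rpoly s * rpoly b + rpoly r"
    unfolding s_def r_def rpoly_mult[symmetric] rpoly_add[symmetric] by simp
  have Rb: "rpoly b \<noteq> 0" using b by (simp add: rpoly_eq_0_iff)
  have r: "rpoly r = 0 \<or> degree (rpoly r) < degree (rpoly b)"
    using degree_mod_less[OF b, of a] by (auto simp: r_def degree_rpoly rpoly_eq_0_iff)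
  have "f = to_fract (rpoly s) + Fract (rpoly r) (rpoly b)"
    unfolding fab a using Rb by (simp add: to_fract_def)
  hence "to_fract (rpoly s - p) = Fract u d - Fract (rpoly r) (rpoly b)"
    using f(2) by (simp add: algebra_simps)
  also have "\<dots> = Fract (u * rpoly b - rpoly r * d) (d * rpoly b)" using d Rb by simp
  finally have eq: "(rpoly s - p) * (d * rpoly b) = u * rpoly b - rpoly r * d"
    using d Rb by (simp add: to_fract_def eq_fract)
  have "rpoly s = p"
  proof (rule ccontr)
    assume "rpoly s \<noteq> p"
    hence ne: "rpoly s - p \<noteq> 0" by simp
    have "degree ((rpoly s - p) * (d * rpoly b)) = degree (rpoly s - p) + (degree d + degree (rpoly b))"
      using ne d Rb by (simp add: degree_mult_eq)
    moreover have "u * rpoly b - rpoly r * d \<noteq> 0" using eq ne d Rb by (metis mult_eq_0_iff)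
    hence "degree (u * rpoly b - rpoly r * d) < degree d + degree (rpoly b)"
    proof -
      have 1: "u * rpoly b = 0 \<or> degree (u * rpoly b) < degree d + degree (rpoly b)"
        using d(2) Rb by (cases "u = 0") (auto simp: degree_mult_eq)
      have 2: "rpoly r * d = 0 \<or> degree (rpoly r * d) < degree d + degree (rpoly b)"
        using r d(1) by (cases "rpoly r = 0") (auto simp: degree_mult_eq)
      from 1 2 \<open>u * rpoly b - rpoly r * d \<noteq> 0\<close> show ?thesis
        by (metis diff_zero degree_diff_less degree_minus diff_0)
    qed
    ultimately show False using eq by simp
  qed
  thus "real_coeffs p" unfolding real_coeffs_rpoly by metis
  have "Fract u d = Fract (rpoly r) (rpoly b)"
    using f(2) \<open>f = to_fract (rpoly s) + _\<close> \<open>rpoly s = p\<close> by simp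
  thus "real_fract (Fract u d)" unfolding real_fract_def using b by blast
qed

lemma rat_mat_carrier [simp]: "X \<in> carrier_mat m n \<Longrightarrow> rat_mat X \<in> carrier_mat m n"
  by (simp add: rat_mat_def)

lemma const_mat_carrier [simp]: "X \<in> carrier_mat m n \<Longrightarrow> const_mat X \<in> carrier_mat m n"
  by (simp add: const_mat_def)

lemma pencil_carrier [simp]:
  "X \<in> carrier_mat m n \<Longrightarrow> Y \<in> carrier_mat m n \<Longrightarrow> pencil X Y \<in> carrier_mat m n"
  by (simp add: pencil_def minus_carrier_mat)

lemma pencil_index:
  "X \<in> carrier_mat m n \<Longrightarrow> Y \<in> carrier_mat m n \<Longrightarrow> i < m \<Longrightarrow> j < n \<Longrightarrow>
    pencil X Y $$ (i,j) = [:- Y $$ (i,j), X $$ (i,j):]"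
  by (simp add: pencil_def const_mat_def)

lemma const_mat_mult:
  assumes "A \<in> carrier_mat m n" "B \<in> carrier_mat n k"
  shows "const_mat (A * B) = const_mat A * const_mat B"
proof -
  interpret comm_ring_hom "\<lambda>c :: complex. [:c:]" by unfold_locales auto
  show ?thesis unfolding const_mat_def by (rule mat_hom_mult[OF assms])
qed

lemma rat_mat_mult:
  assumes "A \<in> carrier_mat m n" "B \<in> carrier_mat n k"
  shows "rat_mat (A * B) = rat_mat A * rat_mat B"
proof -
  interpret comm_ring_hom "to_fract :: complex poly \<Rightarrow> complex poly fract" by unfold_locales auto
  show ?thesis unfolding rat_mat_def by (rule mat_hom_mult[OF assms])
qed

lemma rat_mat_transpose: "transpose_mat (rat_mat A) = rat_mat (transpose_mat A)"
  by (rule eq_matI) (auto simp: rat_mat_def)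

lemma const_mat_transpose: "transpose_mat (const_mat A) = const_mat (transpose_mat A)"
  by (rule eq_matI) (auto simp: const_mat_def)

lemma rat_mat_eq_iff: "rat_mat A = rat_mat B \<longleftrightarrow> A = B"
proof
  assume eq: "rat_mat A = rat_mat B"
  have d: "dim_row A = dim_row B" "dim_col A = dim_col B"
    using arg_cong[OF eq, of dim_row] arg_cong[OF eq, of dim_col] by (auto simp: rat_mat_def)
  show "A = B"
  proof (rule eq_matI)
    fix i j assume "i < dim_row B" "j < dim_col B"
    thus "A $$ (i,j) = B $$ (i,j)"
      using arg_cong[OF eq, of "\<lambda>M. M $$ (i,j)"] d by (simp add: rat_mat_def)
  qed (use d in auto)
qed simp

lemma real_mat_mult:
  assumes "A \<in> carrier_mat m n" "B \<in> carrier_mat n k" "real_mat A" "real_mat B"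
  shows "real_mat (A * B)"
  using assms by (auto simp: real_mat_def scalar_prod_def intro!: sum_in_Reals Reals_mult)

lemma real_rational_const_mat:
  "real_mat A \<Longrightarrow> real_rational_mat (rat_mat (const_mat A))"
  by (auto simp: real_rational_mat_def rat_mat_def const_mat_def real_mat_def real_coeffs_def coeff_pCons
      intro!: real_fract_to_fract split: nat.splits)

lemma real_rational_pencil:
  assumes "A \<in> carrier_mat m n" "B \<in> carrier_mat m n" "real_mat A" "real_mat B"
  shows "real_rational_mat (rat_mat (pencil A B))"
  using assms
  by (auto simp: real_rational_mat_def rat_mat_def pencil_index[OF assms(1,2)] carrier_matD[OF pencil_carrier[OF assms(1,2)]] real_mat_def real_coeffs_def coeff_pCons
      intro!: real_fract_to_fract split: nat.splits)

lemma mat_inv_eqI: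
  fixes M R :: "'a :: field mat"
  assumes M: "M \<in> carrier_mat n n" and R: "R \<in> carrier_mat n n" and MR: "M * R = 1\<^sub>m n"
  shows "mat_inv M = R"
proof -
  have RM: "R * M = 1\<^sub>m n" by (rule mat_mult_left_right_inverse[OF M R MR])
  have "M \<in> Units (ring_mat TYPE('a) n ())"
    using M R MR RM by (auto simp: Units_def ring_mat_simps)
  with mat_inverse(1)[OF M, of "()"] obtain R' where R': "mat_inverse M = Some R'"
    by (cases "mat_inverse M") auto
  from mat_inverse(2)[OF M this] have r: "M * R' = 1\<^sub>m n" "R' \<in> carrier_mat n n" by auto
  have "R' = (R * M) * R'" using r RM by simp
  also have "\<dots> = R * (M * R')" using M R r by (intro assoc_mult_mat[of _ n n _ n _ n]) auto
  also have "\<dots> = R" using r R by simp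
  finally show ?thesis by (simp add: mat_inv_def R')
qed

lemma degree_adj_mat_pencil:
  assumes E: "E \<in> carrier_mat r r" and A: "A \<in> carrier_mat r r" and i: "i < r" "j < r"
  shows "degree (adj_mat (pencil E A) $$ (i,j)) \<le> r - 1"
proof -
  define X where "X = pencil E A"
  have X: "X \<in> carrier_mat r r" using E A by (simp add: X_def)
  have del: "mat_delete X j i \<in> carrier_mat (r - 1) (r - 1)" using X by (simp add: mat_delete_def)
  have "degree (det (mat_delete X j i)) \<le> 1 * (r - 1)"
  proof (rule degree_det_le[OF _ del])
    fix k l assume kl: "k < r - 1" "l < r - 1"
    have "mat_delete X j i $$ (k,l) = X $$ (if k < j then k else Suc k, if l < i then l else Suc l)"
      using X kl by (simp add: mat_delete_def)
    also have "degree \<dots> \<le> 1"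
      unfolding X_def using kl by (subst pencil_index[OF E A]) auto
    finally show "degree (mat_delete X j i $$ (k,l)) \<le> 1" .
  qed
  moreover have "adj_mat X $$ (i,j) = (- 1) ^ (j + i) * det (mat_delete X j i)"
    using X i by (simp add: adj_mat_def cofactor_def)
  moreover have "degree ((- 1 :: complex poly) ^ (j + i) * det (mat_delete X j i)) = degree (det (mat_delete X j i))"
    by (cases "even (j + i)") auto
  ultimately show ?thesis by (simp add: X_def)
qed

text \<open>
  Factoring out \<open>E\<close> leaves the characteristic matrix of \<open>E\<^sup>-\<^sup>1 A\<close>, so up to the factor \<open>det E\<close> the
  determinant is a characteristic polynomial.
\<close>

lemma degree_det_pencil:
  assumes E: "E \<in> carrier_mat r r" "invertible_mat E" and A: "A \<in> carrier_mat r r"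
  shows "det (pencil E A) \<noteq> 0" "degree (det (pencil E A)) = r"
proof -
  obtain E' where "inverts_mat E E'" "inverts_mat E' E" using E(2) by (auto simp: invertible_mat_def)
  hence EE': "E * E' = 1\<^sub>m r" "E' * E = 1\<^sub>m (dim_row E')" using E(1) by (auto simp: inverts_mat_def)
  have E': "E' \<in> carrier_mat r r"
  proof -
    have "dim_col E' = r" using arg_cong[OF EE'(1), of dim_col] by simp
    moreover have "dim_row E' = r" using arg_cong[OF EE'(2), of dim_col] E(1) by simp
    ultimately show ?thesis by auto
  qed
  have "det E * det E' = 1" using arg_cong[OF EE'(1), of det] det_mult[OF E(1) E'] by simp
  hence dE: "det E \<noteq> 0" by auto
  define M where "M = E' * A"
  have M: "M \<in> carrier_mat r r" using E' A by (simp add: M_def)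
  have EM: "E * M = A" unfolding M_def using E(1) E' A EE'(1)
    by (simp add: assoc_mult_mat[of _ r r _ r _ r, symmetric])
  have "pencil E A = const_mat E * char_poly_matrix M"
  proof (rule eq_matI)
    fix i j assume "i < dim_row (const_mat E * char_poly_matrix M)" "j < dim_col (const_mat E * char_poly_matrix M)"
    hence ij: "i < r" "j < r" using E M by (auto simp: const_mat_def char_poly_matrix_def)
    have "(const_mat E * char_poly_matrix M) $$ (i,j) =
        (\<Sum>k<r. [:E $$ (i,k):] * (if k = j then [:- M $$ (k,j), 1:] else [:- M $$ (k,j):]))"
      using ij E M by (auto simp: const_mat_def char_poly_matrix_def scalar_prod_def atLeast0LessThan intro!: sum.cong)
    also have "\<dots> = (\<Sum>k<r. [:- (E $$ (i,k) * M $$ (k,j)):] + (if k = j then [:0, E $$ (i,k):] else 0))"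
      by (intro sum.cong) auto
    also have "\<dots> = (\<Sum>k<r. [:- (E $$ (i,k) * M $$ (k,j)):]) + [:0, E $$ (i,j):]"
      using ij by (simp add: sum.distrib)
    also have "(\<Sum>k<r. [:- (E $$ (i,k) * M $$ (k,j)):]) = [:- (\<Sum>k<r. E $$ (i,k) * M $$ (k,j)):]"
      by (rule poly_eqI) (auto simp: coeff_sum coeff_pCons sum_negf split: nat.split)
    also have "(\<Sum>k<r. E $$ (i,k) * M $$ (k,j)) = A $$ (i,j)"
      using arg_cong[OF EM, of "\<lambda>M. M $$ (i,j)"] ij E M by (simp add: scalar_prod_def atLeast0LessThan)
    finally show "pencil E A $$ (i,j) = (const_mat E * char_poly_matrix M) $$ (i,j)"
      using ij by (simp add: pencil_index[OF E(1) A])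
  qed (use E A M in \<open>auto simp: pencil_def const_mat_def char_poly_matrix_def\<close>)
  hence "det (pencil E A) = det (const_mat E) * char_poly M"
    using det_mult[of "const_mat E" r "char_poly_matrix M"] E M by (simp add: char_poly_def)
  also have "det (const_mat E) = [:det E:]"
  proof -
    interpret comm_ring_hom "\<lambda>c :: complex. [:c:]" by unfold_locales auto
    show ?thesis unfolding const_mat_def by (rule hom_det)
  qed
  finally have d: "det (pencil E A) = Polynomial.smult (det E) (char_poly M)" by simp
  show "det (pencil E A) \<noteq> 0" "degree (det (pencil E A)) = r"
    using degree_monic_char_poly[OF M] dE unfolding d by auto
qed

context
  fixes r n :: nat and E A B :: "complex mat"
  assumes E: "E \<in> carrier_mat r r" "invertible_mat E" and A: "A \<in> carrier_mat r r" and B: "B \<in> carrier_mat r n"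
    and symE: "symmetric_matrix E" and symA: "symmetric_matrix A"
begin

lemma pencil_inverse:
  "mat_inv (rat_mat (pencil E A)) = inverse (to_fract (det (pencil E A))) \<cdot>\<^sub>m rat_mat (adj_mat (pencil E A))" (is ?th1)
  "mat_inv (rat_mat (pencil E A)) \<in> carrier_mat r r" (is ?th2)
  "transpose_mat (mat_inv (rat_mat (pencil E A))) = mat_inv (rat_mat (pencil E A))" (is ?th3)
proof -
  define X where "X = pencil E A"
  define d where "d = to_fract (det X)"
  have X: "X \<in> carrier_mat r r" using E A by (simp add: X_def)
  have d: "d \<noteq> 0" using degree_det_pencil(1)[OF E A] by (simp add: d_def X_def)
  define R where "R = inverse d \<cdot>\<^sub>m rat_mat (adj_mat X)"
  have aX: "adj_mat X \<in> carrier_mat r r" using adj_mat(1)[OF X] .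
  have R: "R \<in> carrier_mat r r" unfolding R_def using aX by simp
  have "rat_mat X * rat_mat (adj_mat X) = rat_mat (det X \<cdot>\<^sub>m 1\<^sub>m r)"
    using rat_mat_mult[OF X aX] adj_mat(2)[OF X] by simp
  also have "\<dots> = d \<cdot>\<^sub>m 1\<^sub>m r" by (rule eq_matI) (auto simp: rat_mat_def d_def)
  finally have "rat_mat X * rat_mat (adj_mat X) = d \<cdot>\<^sub>m 1\<^sub>m r" .
  hence "rat_mat X * R = inverse d \<cdot>\<^sub>m (d \<cdot>\<^sub>m 1\<^sub>m r)"
    unfolding R_def using mult_smult_distrib[OF rat_mat_carrier[OF X] rat_mat_carrier[OF aX]] by simp
  also have "\<dots> = 1\<^sub>m r" using d by (intro eq_matI) auto
  finally have XR: "rat_mat X * R = 1\<^sub>m r" .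
  have inv: "mat_inv (rat_mat X) = R" by (rule mat_inv_eqI[OF rat_mat_carrier[OF X] R XR])
  thus ?th1 by (simp add: R_def d_def X_def)
  show ?th2 using inv R by (simp add: X_def)
  have XT: "transpose_mat X = X"
  proof (rule eq_matI)
    fix i j assume "i < dim_row X" "j < dim_col X"
    hence ij: "i < r" "j < r" using X by auto
    have "A $$ (j,i) = A $$ (i,j)" "E $$ (j,i) = E $$ (i,j)"
      using ij E A symE symA unfolding symmetric_matrix_def by (metis carrier_matD index_transpose_mat(1))+
    thus "transpose_mat X $$ (i,j) = X $$ (i,j)"
      using ij X by (simp add: X_def pencil_index[OF E(1) A])
  qed (use X in auto)
  have "R * rat_mat X = 1\<^sub>m r"
    using mat_mult_left_right_inverse[OF rat_mat_carrier[OF X] R XR] .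
  hence "transpose_mat (rat_mat X) * transpose_mat R = 1\<^sub>m r"
    using transpose_mult[OF R rat_mat_carrier[OF X]] by (metis transpose_one)
  hence "rat_mat X * transpose_mat R = 1\<^sub>m r" unfolding rat_mat_transpose XT .
  hence "mat_inv (rat_mat X) = transpose_mat R"
    by (intro mat_inv_eqI[of _ r]) (use X R in auto)
  thus ?th3 using inv by (simp add: X_def)
qed

definition proper_part :: "complex poly fract mat" where
  "proper_part = rat_mat (const_mat (transpose_mat B)) * mat_inv (rat_mat (pencil E A)) * rat_mat (const_mat B)"

lemma proper_part_carrier: "proper_part \<in> carrier_mat n n"
  unfolding proper_part_def using pencil_inverse(2) B
  by (intro mult_carrier_mat[of _ _ r]) simp_all

lemma proper_part_symmetric: "transpose_mat proper_part = proper_part"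
proof -
  define R where "R = mat_inv (rat_mat (pencil E A))"
  have R: "R \<in> carrier_mat r r" "transpose_mat R = R" using pencil_inverse by (auto simp: R_def)
  define b where "b = rat_mat (const_mat B)"
  have b: "b \<in> carrier_mat r n" using B by (simp add: b_def)
  have bT: "transpose_mat b = rat_mat (const_mat (transpose_mat B))"
    by (simp add: b_def rat_mat_transpose const_mat_transpose)
  have "transpose_mat (transpose_mat b * R * b) = transpose_mat b * (transpose_mat R * b)"
    using b R by (subst transpose_mult[of _ n r _ n]) (auto simp: transpose_mult[of _ n r _ r])
  also have "\<dots> = transpose_mat b * R * b"
    unfolding R(2) using b R by (subst assoc_mult_mat[of _ n r _ r _ n]) auto
  finally show ?thesis unfolding proper_part_def bT[symmetric] b_def[symmetric] R_def[symmetric] .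
qed

text \<open>
  By Cramer's rule the numerators are combinations of minors of size \<open>r - 1\<close> of the pencil, while
  the denominator has degree \<open>r\<close>.
\<close>

lemma proper_part_entry:
  assumes ij: "i < n" "j < n"
  shows "\<exists>u. proper_part $$ (i,j) = Fract u (det (pencil E A)) \<and> (u = 0 \<or> degree u < degree (det (pencil E A)))"
proof -
  define X where "X = pencil E A"
  define U where "U = const_mat (transpose_mat B) * adj_mat X * const_mat B"
  have X: "X \<in> carrier_mat r r" using E A by (simp add: X_def)
  have aX: "adj_mat X \<in> carrier_mat r r" using adj_mat(1)[OF X] .
  have cB: "const_mat B \<in> carrier_mat r n" "const_mat (transpose_mat B) \<in> carrier_mat n r" using B by auto
  have U: "U \<in> carrier_mat n n" using aX cB by (simp add: U_def)
  have "proper_part = inverse (to_fract (det X)) \<cdot>\<^sub>m rat_mat U"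
    unfolding proper_part_def U_def
    using pencil_inverse(1)[folded X_def] X_def aX cB rat_mat_mult[OF cB(2) aX] rat_mat_mult[of "const_mat (transpose_mat B) * adj_mat X" n r "const_mat B" n]
      mult_smult_distrib[OF rat_mat_carrier[OF cB(2)] rat_mat_carrier[OF aX]]
      mult_smult_assoc_mat[of "rat_mat (const_mat (transpose_mat B)) * rat_mat (adj_mat X)" n r "rat_mat (const_mat B)" n]
    by (simp add: mult_carrier_mat[of _ n r _ r])
  hence "proper_part $$ (i,j) = Fract (U $$ (i,j)) (det X)"
    using ij U by (simp add: rat_mat_def Fract_conv_to_fract divide_inverse mult.commute)
  moreover have "U $$ (i,j) = 0 \<or> degree (U $$ (i,j)) < degree (det X)"
  proof (cases "r = 0")
    case True
    have "U $$ (i,j) = 0" using ij cB aX unfolding U_def True by (simp add: scalar_prod_def)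
    thus ?thesis ..
  next
    case False
    have "U $$ (i,j) = (\<Sum>l<r. (\<Sum>k<r. [:B $$ (k,i):] * adj_mat X $$ (k,l)) * [:B $$ (l,j):])"
      using ij aX B unfolding U_def const_mat_def by (simp add: scalar_prod_def atLeast0LessThan del: assoc_mult_mat)
    also have "degree \<dots> \<le> r - 1"
    proof (intro degree_sum_le)
      fix l assume l: "l \<in> {..<r}"
      have "degree (\<Sum>k<r. [:B $$ (k,i):] * adj_mat X $$ (k,l)) \<le> r - 1"
      proof (intro degree_sum_le)
        fix k assume k: "k \<in> {..<r}"
        have "degree ([:B $$ (k,i):] * adj_mat X $$ (k,l)) \<le> degree (adj_mat X $$ (k,l))"
          by (simp add: degree_smult_le)
        thus "degree ([:B $$ (k,i):] * adj_mat X $$ (k,l)) \<le> r - 1"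
          using degree_adj_mat_pencil[OF E(1) A, of k l] k l unfolding X_def by simp
      qed simp
      moreover have "degree ((\<Sum>k<r. [:B $$ (k,i):] * adj_mat X $$ (k,l)) * [:B $$ (l,j):]) \<le>
         degree (\<Sum>k<r. [:B $$ (k,i):] * adj_mat X $$ (k,l)) + degree [:B $$ (l,j):]"
        by (rule degree_mult_le)
      ultimately show "degree ((\<Sum>k<r. [:B $$ (k,i):] * adj_mat X $$ (k,l)) * [:B $$ (l,j):]) \<le> r - 1" by simp
    qed simp
    also have "r - 1 < degree (det X)" using degree_det_pencil(2)[OF E A] False by (simp add: X_def)
    finally show ?thesis ..
  qed
  ultimately show ?thesis unfolding X_def by blast
qed

text \<open>
  The matrices \<open>A\<close>, \<open>E\<close> and \<open>B\<close> may be complex. Nevertheless both summands of a real \<open>G\<close> are real,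
  because the decomposition into a polynomial and a strictly proper part is unique.
\<close>

lemma realization_parts:
  assumes G: "real_rational_mat G" "symmetric_matrix G" and P: "P \<in> carrier_mat n n"
    and eq: "G = rat_mat P + proper_part"
  shows "real_rational_mat proper_part" "\<And>i j. i < n \<Longrightarrow> j < n \<Longrightarrow> real_coeffs (P $$ (i,j))"
    "transpose_mat P = P"
proof -
  have sp: "proper_part \<in> carrier_mat n n" by (rule proper_part_carrier)
  have Gc: "G \<in> carrier_mat n n" using eq P sp by simp
  have ent: "real_coeffs (P $$ (i,j)) \<and> real_fract (proper_part $$ (i,j))" if ij: "i < n" "j < n" for i j
  proof -
    obtain u where u: "proper_part $$ (i,j) = Fract u (det (pencil E A))" "u = 0 \<or> degree u < degree (det (pencil E A))"
      using proper_part_entry[OF ij] by blast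
    have "real_fract (G $$ (i,j))" using G(1) ij Gc by (auto simp: real_rational_mat_def)
    moreover have "G $$ (i,j) = to_fract (P $$ (i,j)) + Fract u (det (pencil E A))"
      unfolding u(1)[symmetric] eq using ij P sp by (simp add: rat_mat_def)
    ultimately show ?thesis
      using polynomial_part_real[OF _ _ degree_det_pencil(1)[OF E A] u(2)] u(1) by simp
  qed
  show "real_rational_mat proper_part" unfolding real_rational_mat_def using ent sp by auto
  show "real_coeffs (P $$ (i,j))" if "i < n" "j < n" for i j using ent[OF that] by blast
  have "transpose_mat G = transpose_mat (rat_mat P) + transpose_mat proper_part"
    unfolding eq using P sp by (intro transpose_add) auto
  hence "rat_mat (transpose_mat P) + proper_part = rat_mat P + proper_part"
    using G(2) eq by (simp add: rat_mat_transpose proper_part_symmetric symmetric_matrix_def)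
  note sums = this
  have "rat_mat (transpose_mat P) = rat_mat P"
  proof (rule eq_matI)
    fix i j assume "i < dim_row (rat_mat P)" "j < dim_col (rat_mat P)"
    hence ij: "i < n" "j < n" using P by (auto simp: rat_mat_def)
    from arg_cong[OF sums, of "\<lambda>M. M $$ (i,j)"]
    show "rat_mat (transpose_mat P) $$ (i,j) = rat_mat P $$ (i,j)"
      using ij P sp by (simp add: rat_mat_def)
  qed (use P in \<open>auto simp: rat_mat_def\<close>)
  thus "transpose_mat P = P" by (simp add: rat_mat_eq_iff)
qed

end

section \<open>Polynomial summands and isometric embedding\<close>

lemma of_real_sqn: "complex_of_real (sqn x) = x \<bullet>c x"
  by (simp add: csqnorm_real sqn_def)

lemma sqn_isometry:
  assumes J: "J \<in> carrier_mat N n" "adjoint_mat J * J = 1\<^sub>m n" and x: "x \<in> carrier_vec n"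
  shows "sqn (J *\<^sub>v x) = sqn x" "adjoint_mat J *\<^sub>v (J *\<^sub>v x) = x"
proof -
  have aJ: "adjoint_mat J \<in> carrier_mat n N" using J by simp
  show *: "adjoint_mat J *\<^sub>v (J *\<^sub>v x) = x"
    using J x aJ by (metis assoc_mult_mat_vec one_mult_mat_vec)
  have "(J *\<^sub>v x) \<bullet>c (J *\<^sub>v x) = x \<bullet>c (adjoint_mat J *\<^sub>v (J *\<^sub>v x))"
    by (rule adjoint_mat_inner[OF J(1) x]) (use J x in simp)
  hence "complex_of_real (sqn (J *\<^sub>v x)) = complex_of_real (sqn x)"
    unfolding of_real_sqn * .
  thus "sqn (J *\<^sub>v x) = sqn x" by (simp only: of_real_eq_iff)
qed

text \<open>
  Pythagoras: \<open>J J\<^sup>* y\<close> is the orthogonal projection of \<open>y\<close> to the range of \<open>J\<close>.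
\<close>

lemma sqn_adjoint_isometry_le:
  assumes J: "J \<in> carrier_mat N n" "adjoint_mat J * J = 1\<^sub>m n" and y: "y \<in> carrier_vec N"
  shows "sqn (adjoint_mat J *\<^sub>v y) \<le> sqn y"
proof -
  have aJ: "adjoint_mat J \<in> carrier_mat n N" using J by simp
  define w where "w = adjoint_mat J *\<^sub>v y"
  define z where "z = J *\<^sub>v w"
  have w: "w \<in> carrier_vec n" unfolding w_def by (rule mult_mat_vec_carrier[OF aJ y])
  have z: "z \<in> carrier_vec N" unfolding z_def by (rule mult_mat_vec_carrier[OF J(1) w])
  have cy: "conjugate y \<in> carrier_vec N" and cz: "conjugate z \<in> carrier_vec N" using y z by auto
  have zz: "z \<bullet>c z = w \<bullet>c w"
    using sqn_isometry(1)[OF J w] by (simp add: of_real_sqn[symmetric] z_def)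
  have zy: "z \<bullet>c y = w \<bullet>c w"
    using adjoint_mat_inner[OF J(1) w y] by (simp add: z_def w_def)
  have yz: "y \<bullet>c z = w \<bullet>c w"
    using adjoint_mat_inner[OF aJ y w] by (simp add: z_def w_def)
  have "(y - z) \<bullet>c (y - z) = y \<bullet>c y - z \<bullet>c y - (y \<bullet>c z - z \<bullet>c z)"
    using y z by (simp add: scalar_prod_def sum_subtractf ring_distribs carrier_vecD)
  hence "complex_of_real (sqn (y - z)) = complex_of_real (sqn y - sqn w)"
    using zz zy yz by (simp add: of_real_sqn)
  hence "sqn (y - z) = sqn y - sqn w" by (simp only: of_real_eq_iff)
  thus ?thesis using sqn_nonneg[of "y - z"] by (simp add: w_def)
qed

lemma hform_compression:
  assumes S: "S \<in> carrier_mat n n" and J: "J \<in> carrier_mat N n" and y: "y \<in> carrier_vec N"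
  shows "hform (J * S * adjoint_mat J) y = hform S (adjoint_mat J *\<^sub>v y)"
proof -
  have aJ: "adjoint_mat J \<in> carrier_mat n N" using J by simp
  have w: "adjoint_mat J *\<^sub>v y \<in> carrier_vec n" by (rule mult_mat_vec_carrier[OF aJ y])
  have "(J * S * adjoint_mat J) *\<^sub>v y = J *\<^sub>v (S *\<^sub>v (adjoint_mat J *\<^sub>v y))"
    unfolding assoc_mult_mat_vec[OF mult_carrier_mat[OF J S] aJ y] assoc_mult_mat_vec[OF J S w] ..
  thus ?thesis
    unfolding hform_def
    using adjoint_mat_inner[OF J, of "S *\<^sub>v (adjoint_mat J *\<^sub>v y)" y] S aJ y by simp
qed

lemma polynomial_matrix_bounded:
  assumes X: "X \<in> carrier_mat n n"
  obtains b where "b \<ge> 0" "eventually (\<lambda>s. \<forall>x \<in> carrier_vec n. \<bar>hform (eval_mat (rat_mat X) s) x\<bar> \<le> b * sqn x) (at t)"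
proof -
  have "((\<lambda>s. \<Sum>i<n. \<Sum>j<n. cmod (poly (X $$ (i,j)) (complex_of_real s))) \<longlongrightarrow>
      (\<Sum>i<n. \<Sum>j<n. cmod (poly (X $$ (i,j)) (complex_of_real t)))) (at t)"
    by (intro tendsto_intros)
  hence lim: "((\<lambda>s. entry_norm n (eval_mat (rat_mat X) s)) \<longlongrightarrow> entry_norm n (eval_mat (rat_mat X) t)) (at t)"
    using X by (simp add: entry_norm_def eval_mat_rat_mat)
  define b where "b = entry_norm n (eval_mat (rat_mat X) t) + 1"
  have b: "b \<ge> 0" by (auto simp: b_def entry_norm_def intro!: add_nonneg_nonneg sum_nonneg)
  have "eventually (\<lambda>s. entry_norm n (eval_mat (rat_mat X) s) < b) (at t)"
    using lim by (rule order_tendstoD) (simp add: b_def)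
  hence "eventually (\<lambda>s. \<forall>x \<in> carrier_vec n. \<bar>hform (eval_mat (rat_mat X) s) x\<bar> \<le> b * sqn x) (at t)"
  proof eventually_elim
    case (elim s)
    show ?case
    proof
      fix x :: "complex vec" assume x: "x \<in> carrier_vec n"
      have "\<bar>hform (eval_mat (rat_mat X) s) x\<bar> \<le> entry_norm n (eval_mat (rat_mat X) s) * sqn x"
        using X x by (intro abs_hform_le) auto
      also have "\<dots> \<le> b * sqn x" using elim by (intro mult_right_mono) auto
      finally show "\<bar>hform (eval_mat (rat_mat X) s) x\<bar> \<le> b * sqn x" .
    qed
  qed
  with b show ?thesis using that by blast
qed

lemma eval_const_mat: "eval_mat (rat_mat (const_mat J)) s = J"
  unfolding eval_mat_rat_mat by (rule eq_matI) (auto simp: const_mat_def)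

text \<open>
  Near any real point the polynomials \<open>P\<close> and \<open>L\<close> are bounded, and the remaining parts of the forms
  agree: at \<open>J x\<close> the form of \<open>J S J\<^sup>*\<close> is the form of \<open>S\<close> at \<open>x\<close>, and at \<open>y\<close> it is the form of \<open>S\<close> at
  \<open>J\<^sup>* y\<close>. So the comparison of inertia applies with \<open>T = J\<close> in one direction and with \<open>T = J\<^sup>*\<close> in
  the other one. In the second case \<open>J\<^sup>*\<close> may shorten vectors, which is harmless for thresholds
  \<open>K \<ge> 0\<close>.
\<close>

theorem eig_dominated_compression:
  assumes P: "P \<in> carrier_mat n n" and L: "L \<in> carrier_mat N N" and S: "S \<in> carrier_mat n n"
    and J: "J \<in> carrier_mat N n" "adjoint_mat J * J = 1\<^sub>m n"
    and F: "real_symmetric_rational n F" "F = rat_mat P + S"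
    and F': "real_symmetric_rational N F'"
      "F' = rat_mat L + rat_mat (const_mat J) * S * rat_mat (const_mat (adjoint_mat J))"
  shows "eig_dominated F F'" "eig_dominated F' F"
proof -
  have aJ: "adjoint_mat J \<in> carrier_mat n N" using J by simp
  have evF: "eval_mat F s = eval_mat (rat_mat P) s + eval_mat S s" if "\<not> has_pole S s" for s
    unfolding F(2) using eval_mat_add(2)[OF rat_mat_carrier[OF P] S eval_mat_rat_mat(1) that] .
  have evF': "eval_mat F' s = eval_mat (rat_mat L) s + J * eval_mat S s * adjoint_mat J" if s: "\<not> has_pole S s" for s
  proof -
    have cJ: "rat_mat (const_mat J) \<in> carrier_mat N n" and caJ: "rat_mat (const_mat (adjoint_mat J)) \<in> carrier_mat n N"
      using J aJ by auto
    have cJS: "rat_mat (const_mat J) * S \<in> carrier_mat N n" using cJ S by simp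
    have JSJ: "rat_mat (const_mat J) * S * rat_mat (const_mat (adjoint_mat J)) \<in> carrier_mat N N"
      by (rule mult_carrier_mat[OF cJS caJ])
    note m1 = eval_mat_mult[OF cJ S eval_mat_rat_mat(1) s]
    note m2 = eval_mat_mult[OF cJS caJ m1(1) eval_mat_rat_mat(1)]
    show ?thesis
      unfolding F'(2) eval_mat_add(2)[OF rat_mat_carrier[OF L] JSJ eval_mat_rat_mat(1) m2(1)] m2(2) m1(2)
        eval_const_mat ..
  qed
  have evF: "hform (eval_mat F s) x = hform (eval_mat (rat_mat P) s) x + hform (eval_mat S s) x"
    if s: "\<not> has_pole S s" and x: "x \<in> carrier_vec n" for s x
    unfolding evF[OF s] using P S x by (intro hform_add) auto
  have evF': "hform (eval_mat F' s) y = hform (eval_mat (rat_mat L) s) y + hform (eval_mat S s) (adjoint_mat J *\<^sub>v y)"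
    if s: "\<not> has_pole S s" and y: "y \<in> carrier_vec N" for s y
    unfolding evF'[OF s]
    using hform_add[of "eval_mat (rat_mat L) s" N "J * eval_mat S s * adjoint_mat J" y]
      hform_compression[of "eval_mat S s" n J N y] L J aJ S y
    by (simp add: mult_carrier_mat[of _ N n])
  have bounds: "\<exists>bP bL. bP \<ge> 0 \<and> eventually (\<lambda>s. \<not> has_pole S s \<and> \<not> has_pole F s \<and> \<not> has_pole F' s \<and>
      (\<forall>x \<in> carrier_vec n. \<bar>hform (eval_mat (rat_mat P) s) x\<bar> \<le> bP * sqn x) \<and>
      (\<forall>y \<in> carrier_vec N. \<bar>hform (eval_mat (rat_mat L) s) y\<bar> \<le> bL * sqn y)) (at t)" for t
  proof -
    obtain bP where bP: "bP \<ge> 0" "eventually (\<lambda>s. \<forall>x \<in> carrier_vec n. \<bar>hform (eval_mat (rat_mat P) s) x\<bar> \<le> bP * sqn x) (at t)"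
      using polynomial_matrix_bounded[OF P] .
    obtain bL where bL: "bL \<ge> 0" "eventually (\<lambda>s. \<forall>y \<in> carrier_vec N. \<bar>hform (eval_mat (rat_mat L) s) y\<bar> \<le> bL * sqn y) (at t)"
      using polynomial_matrix_bounded[OF L] .
    show ?thesis
      using bP bL(2) by (intro exI[of _ bP] exI[of _ bL] conjI eventually_conj eventually_no_pole)
  qed
  show "eig_dominated F F'" unfolding eig_dominated_def
  proof
    fix t
    obtain bP bL where b0: "bP \<ge> 0" and b: "eventually (\<lambda>s. \<not> has_pole S s \<and> \<not> has_pole F s \<and> \<not> has_pole F' s \<and>
      (\<forall>x \<in> carrier_vec n. \<bar>hform (eval_mat (rat_mat P) s) x\<bar> \<le> bP * sqn x) \<and>
      (\<forall>y \<in> carrier_vec N. \<bar>hform (eval_mat (rat_mat L) s) y\<bar> \<le> bL * sqn y)) (at t)"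
      using bounds[of t] by (elim exE conjE) (rule that; assumption)
    have "eventually (\<lambda>s. large_eigenvalues_le F (K + (bP + bL)) F' K s) (at t)" for K
      using b
    proof eventually_elim
      case (elim s)
      show ?case
      proof (rule large_eigenvalues_leI[OF F(1) _ F'(1) _ J(1)])
        fix x :: "complex vec" assume x: "x \<in> carrier_vec n" and gt: "(K + (bP + bL)) * sqn x < hform (eval_mat F s) x"
        have Jx: "J *\<^sub>v x \<in> carrier_vec N" using J x by simp
        note iso = sqn_isometry[OF J x]
        have "\<bar>hform (eval_mat (rat_mat P) s) x\<bar> \<le> bP * sqn x" using elim x by blast
        moreover have "\<bar>hform (eval_mat (rat_mat L) s) (J *\<^sub>v x)\<bar> \<le> bL * sqn x"
          using elim Jx iso(1) by metis
        moreover have "(K + (bP + bL)) * sqn x = K * sqn x + bP * sqn x + bL * sqn x" by (simp add: algebra_simps)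
        ultimately show "K * sqn (J *\<^sub>v x) < hform (eval_mat F' s) (J *\<^sub>v x)"
          using gt evF[of s x] evF'[of s "J *\<^sub>v x"] elim x Jx unfolding iso by linarith
      qed (use elim in auto)
    qed
    thus "\<exists>C K0. \<forall>K\<ge>K0. eventually (\<lambda>s. large_eigenvalues_le F (K + C) F' K s) (at t)" by blast
  qed
  show "eig_dominated F' F" unfolding eig_dominated_def
  proof
    fix t
    obtain bP bL where bP: "bP \<ge> 0" and b: "eventually (\<lambda>s. \<not> has_pole S s \<and> \<not> has_pole F s \<and> \<not> has_pole F' s \<and>
      (\<forall>x \<in> carrier_vec n. \<bar>hform (eval_mat (rat_mat P) s) x\<bar> \<le> bP * sqn x) \<and>
      (\<forall>y \<in> carrier_vec N. \<bar>hform (eval_mat (rat_mat L) s) y\<bar> \<le> bL * sqn y)) (at t)"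
      using bounds[of t] by (elim exE conjE) (rule that; assumption)
    have "eventually (\<lambda>s. large_eigenvalues_le F' (K + (bP + bL)) F K s) (at t)" if K: "K \<ge> 0" for K
      using b
    proof eventually_elim
      case (elim s)
      show ?case
      proof (rule large_eigenvalues_leI[OF F'(1) _ F(1) _ aJ])
        fix y :: "complex vec" assume y: "y \<in> carrier_vec N" and gt: "(K + (bP + bL)) * sqn y < hform (eval_mat F' s) y"
        define w where "w = adjoint_mat J *\<^sub>v y"
        have w: "w \<in> carrier_vec n" using aJ y by (simp add: w_def)
        have "sqn w \<le> sqn y" unfolding w_def by (rule sqn_adjoint_isometry_le[OF J y])
        hence "(K + bP) * sqn w \<le> (K + bP) * sqn y" using K bP by (intro mult_left_mono) auto
        moreover have "\<bar>hform (eval_mat (rat_mat P) s) w\<bar> \<le> bP * sqn w" using elim w by blast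
        moreover have "\<bar>hform (eval_mat (rat_mat L) s) y\<bar> \<le> bL * sqn y" using elim y by blast
        moreover have "(K + (bP + bL)) * sqn y = (K + bP) * sqn y + bL * sqn y"
          "(K + bP) * sqn w = K * sqn w + bP * sqn w" by (simp_all add: algebra_simps)
        ultimately have "K * sqn w < hform (eval_mat F s) w"
          using gt evF[of s w] evF'[of s y] elim w y unfolding w_def[symmetric] by linarith
        thus "K * sqn (adjoint_mat J *\<^sub>v y) < hform (eval_mat F s) (adjoint_mat J *\<^sub>v y)" by (simp add: w_def)
      qed (use elim in auto)
    qed
    thus "\<exists>C K0. \<forall>K\<ge>K0. eventually (\<lambda>s. large_eigenvalues_le F' (K + C) F K s) (at t)" by blast
  qed
qed

section \<open>Products of matrices\<close>

lemma mat_prod_Nil [simp]: "mat_prod N [] = 1\<^sub>m N"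
  and mat_prod_Cons [simp]: "mat_prod N (M # Ms) = M * mat_prod N Ms"
  by (simp_all add: mat_prod_def)

lemma mat_prod_carrier [simp]: "set Ms \<subseteq> carrier_mat N N \<Longrightarrow> mat_prod N Ms \<in> carrier_mat N N"
  by (induction Ms) auto

lemma mat_prod_append:
  "set As \<subseteq> carrier_mat N N \<Longrightarrow> set Bs \<subseteq> carrier_mat N N \<Longrightarrow>
    mat_prod N (As @ Bs) = mat_prod N As * mat_prod N Bs"
proof (induction As)
  case (Cons A As)
  have "mat_prod N ((A # As) @ Bs) = A * (mat_prod N As * mat_prod N Bs)" using Cons by simp
  also have "\<dots> = A * mat_prod N As * mat_prod N Bs"
    using Cons.prems by (subst assoc_mult_mat[of _ N N _ N _ N]) auto
  finally show ?case by simp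
qed (simp add: left_mult_one_mat[of _ N N])

lemma transpose_mat_prod:
  fixes Ms :: "'a :: comm_semiring_1 mat list"
  shows "set Ms \<subseteq> carrier_mat N N \<Longrightarrow> transpose_mat (mat_prod N Ms) = mat_prod N (rev (map transpose_mat Ms))"
proof (induction Ms)
  case (Cons M Ms)
  have "transpose_mat (M * mat_prod N Ms) = transpose_mat (mat_prod N Ms) * transpose_mat M"
    by (rule transpose_mult[of _ N N _ N]) (use Cons.prems in auto)
  also have "\<dots> = mat_prod N (rev (map transpose_mat Ms)) * mat_prod N [transpose_mat M]"
    using Cons by (simp add: right_mult_one_mat[of _ N N])
  also have "\<dots> = mat_prod N (rev (map transpose_mat (M # Ms)))"
    using Cons.prems by (subst mat_prod_append[symmetric]) auto
  finally show ?case by simp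
qed simp

lemma mat_prod_commute:
  assumes M: "M \<in> carrier_mat N N" and Ms: "set Ms \<subseteq> carrier_mat N N"
    and comm: "\<And>M'. M' \<in> set Ms \<Longrightarrow> M * M' = M' * M"
  shows "M * mat_prod N Ms = mat_prod N Ms * M"
  using Ms comm
proof (induction Ms)
  case (Cons M' Ms)
  have c: "M' \<in> carrier_mat N N" "mat_prod N Ms \<in> carrier_mat N N" using Cons.prems by auto
  note assoc = assoc_mult_mat[of _ N N _ N _ N]
  have "M * (M' * mat_prod N Ms) = (M * M') * mat_prod N Ms" using M c by (simp add: assoc)
  also have "M * M' = M' * M" using Cons.prems by simp
  also have "M' * M * mat_prod N Ms = M' * (M * mat_prod N Ms)" using M c by (simp add: assoc)
  also have "M * mat_prod N Ms = mat_prod N Ms * M" using Cons by simp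
  also have "M' * (mat_prod N Ms * M) = M' * mat_prod N Ms * M" using M c by (simp add: assoc)
  finally show ?case by simp
qed (use M in simp)

lemma mat_prod_commute2:
  assumes "set Ms \<subseteq> carrier_mat N N" "set Ns \<subseteq> carrier_mat N N"
    and comm: "\<And>A B. A \<in> set Ms \<Longrightarrow> B \<in> set Ns \<Longrightarrow> A * B = B * A"
  shows "mat_prod N Ms * mat_prod N Ns = mat_prod N Ns * mat_prod N Ms"
  using assms(2) comm
  by (intro mat_prod_commute mat_prod_commute[symmetric] mat_prod_carrier assms(1,2))
     (metis (no_types, lifting) assms(1) mat_prod_commute subset_iff)

lemma symmetric_mult:
  fixes A B :: "'a :: comm_semiring_1 mat"
  assumes "A \<in> carrier_mat N N" "B \<in> carrier_mat N N" "transpose_mat A = A" "transpose_mat B = B" "A * B = B * A"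
  shows "transpose_mat (A * B) = A * B"
  using transpose_mult[OF assms(1,2)] assms(3-5) by simp

section \<open>Supports\<close>

text \<open>
  Most arguments about elementary matrices use only their supports: matrices with disjoint
  supports commute, and a matrix fixes whatever vanishes on its support.
\<close>

definition supported_on :: "nat \<Rightarrow> nat set \<Rightarrow> 'a :: semiring_1 mat \<Rightarrow> bool" where
  "supported_on N I M \<longleftrightarrow> M \<in> carrier_mat N N \<and>
     (\<forall>a<N. \<forall>b<N. a \<notin> I \<or> b \<notin> I \<longrightarrow> M $$ (a,b) = (if a = b then 1 else 0))"

lemma supported_on_mult_row:
  fixes M :: "'a :: semiring_1 mat"
  assumes M: "supported_on N I M" and A: "A \<in> carrier_mat N k" and a: "a < N" "a \<notin> I" and b: "b < k"
  shows "(M * A) $$ (a,b) = A $$ (a,b)"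
proof -
  have "(M * A) $$ (a,b) = (\<Sum>l<N. M $$ (a,l) * A $$ (l,b))"
    using M A a b by (auto simp: supported_on_def scalar_prod_def atLeast0LessThan)
  also have "\<dots> = (\<Sum>l<N. (if l = a then A $$ (l,b) else 0))"
    using M a by (intro sum.cong) (auto simp: supported_on_def)
  finally show ?thesis using a by simp
qed

lemma supported_on_mult_disjoint:
  fixes M :: "'a :: semiring_1 mat"
  assumes M: "supported_on N I M" and A: "A \<in> carrier_mat N k"
    and z: "\<And>l c. l < N \<Longrightarrow> l \<in> I \<Longrightarrow> c < k \<Longrightarrow> A $$ (l,c) = 0"
  shows "M * A = A"
proof (rule eq_matI)
  fix a c assume "a < dim_row A" "c < dim_col A"
  hence ac: "a < N" "c < k" using A by auto
  have "(M * A) $$ (a,c) = (\<Sum>l<N. M $$ (a,l) * A $$ (l,c))"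
    using M A ac by (auto simp: supported_on_def scalar_prod_def atLeast0LessThan)
  also have "\<dots> = (\<Sum>l<N. (if l = a then A $$ (l,c) else 0))"
  proof (intro sum.cong refl)
    fix l assume l: "l \<in> {..<N}"
    show "M $$ (a,l) * A $$ (l,c) = (if l = a then A $$ (l,c) else 0)"
      using M ac l z[of l c] by (cases "l \<in> I") (auto simp: supported_on_def)
  qed
  finally show "(M * A) $$ (a,c) = A $$ (a,c)" using ac by simp
qed (use M A in \<open>auto simp: supported_on_def\<close>)

lemma supported_on_commute:
  fixes M M' :: "'a :: comm_ring_1 mat"
  assumes M: "supported_on N I M" and M': "supported_on N I' M'" and dis: "I \<inter> I' = {}"
  shows "M * M' = M' * M"
proof -
  have c: "M \<in> carrier_mat N N" "M' \<in> carrier_mat N N" using M M' by (auto simp: supported_on_def)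
  have *: "(A * A') $$ (a,b) = (A' * A) $$ (a,b)"
    if A: "supported_on N J A" and A': "supported_on N J' A'" and ab: "a < N" "b < N" "a \<notin> J" and dis: "J \<inter> J' = {}"
    for A A' :: "'a mat" and J J' a b
  proof -
    have cc: "A \<in> carrier_mat N N" "A' \<in> carrier_mat N N" using A A' by (auto simp: supported_on_def)
    have "(A' * A) $$ (a,b) = (\<Sum>l<N. A' $$ (a,l) * A $$ (l,b))"
      using cc ab by (auto simp: scalar_prod_def atLeast0LessThan)
    also have "\<dots> = (\<Sum>l<N. (if l = b then A' $$ (a,l) else 0))"
    proof (intro sum.cong refl)
      fix l assume l: "l \<in> {..<N}"
      show "A' $$ (a,l) * A $$ (l,b) = (if l = b then A' $$ (a,l) else 0)"
      proof (cases "l \<in> J")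
        case True
        hence "l \<notin> J'" "l \<noteq> a" using dis ab by auto
        hence "A' $$ (a,l) = 0" using A' ab l by (auto simp: supported_on_def)
        thus ?thesis by (cases "l = b") auto
      next
        case False
        thus ?thesis using A ab l by (auto simp: supported_on_def)
      qed
    qed
    also have "\<dots> = A' $$ (a,b)" using ab by simp
    finally show ?thesis using supported_on_mult_row[OF A cc(2) ab(1,3,2)] by simp
  qed
  show ?thesis
  proof (rule eq_matI)
    fix a b assume "a < dim_row (M' * M)" "b < dim_col (M' * M)"
    hence ab: "a < N" "b < N" using c by auto
    show "(M * M') $$ (a,b) = (M' * M) $$ (a,b)"
    proof (cases "a \<in> I")
      case False
      show ?thesis by (rule *[OF M M' ab False dis])
    next
      case True
      hence "a \<notin> I'" using dis by auto
      thus ?thesis using *[OF M' M ab] dis by (metis inf_commute)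
    qed
  qed (use c in auto)
qed

section \<open>Elementary matrices\<close>

lemma diag2_index:
  assumes "X \<in> carrier_mat p p" "Y \<in> carrier_mat q q" "a < p + q" "b < p + q"
  shows "diag_block_mat [X, Y] $$ (a,b) = (if a < p \<and> b < p then X $$ (a,b)
     else if p \<le> a \<and> p \<le> b then Y $$ (a - p, b - p) else 0)"
  using assms by (auto simp: Let_def)

lemma diag3_index:
  assumes "X \<in> carrier_mat k k" "a < p + k + q" "b < p + k + q"
  shows "diag_block_mat [1\<^sub>m p, X, 1\<^sub>m q] $$ (a,b) =
    (if p \<le> a \<and> a < p + k \<and> p \<le> b \<and> b < p + k then X $$ (a - p, b - p) else if a = b then 1 else 0)"
  using assms by (auto simp: Let_def)

text \<open>
  The rows on which an elementary matrix with index \<open>k\<close> or \<open>-k\<close> acts. For \<open>0 < k < m\<close> these are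
  the block rows \<open>m - k\<close> and \<open>m - k + 1\<close>, counted from 1; the intersection and the truncated
  subtraction give the single block row \<open>m\<close> for \<open>k = 0\<close> and \<open>1\<close> for \<open>k = m\<close>.
\<close>

definition index_support :: "nat \<Rightarrow> nat \<Rightarrow> nat \<Rightarrow> nat set" where
  "index_support n m k = {(m - k - 1) * n..<(m - k + 1) * n} \<inter> {..<m * n}"

definition elem_core :: "nat \<Rightarrow> int \<Rightarrow> complex mat \<Rightarrow> complex mat" where
  "elem_core n i X = (if i > 0 then four_block_mat X (1\<^sub>m n) (1\<^sub>m n) (0\<^sub>m n n)
     else four_block_mat (0\<^sub>m n n) (1\<^sub>m n) (1\<^sub>m n) X)"

lemma elem_core_carrier: "X \<in> carrier_mat n n \<Longrightarrow> elem_core n i X \<in> carrier_mat (2 * n) (2 * n)"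
  unfolding elem_core_def mult_2 by auto

lemma elem_mat_middle:
  assumes "i \<noteq> 0" "nat \<bar>i\<bar> < m" "k = nat \<bar>i\<bar>"
  shows "elem_mat n m i X = diag_block_mat [1\<^sub>m ((m - k - 1) * n), elem_core n i X, 1\<^sub>m ((k - 1) * n)]"
  using assms by (auto simp: elem_mat_def elem_core_def)

lemma block_count:
  assumes "1 \<le> k" "k < m"
  shows "(m - k - 1) * n + 2 * n + (k - 1) * n = m * (n :: nat)" "(m - k + 1) * n = (m - k - 1) * n + 2 * n"
    "(m - k) * n = (m - k - 1) * n + n"
proof -
  have e: "m = (m - k - 1) + 2 + (k - 1)" "m - k + 1 = (m - k - 1) + 2" "m - k = (m - k - 1) + 1" using assms by auto
  show "(m - k - 1) * n + 2 * n + (k - 1) * n = m * n"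
    using arg_cong[OF e(1), of "\<lambda>x. x * n"] by (simp only: add_mult_distrib)
  show "(m - k + 1) * n = (m - k - 1) * n + 2 * n" "(m - k) * n = (m - k - 1) * n + n"
    using arg_cong[OF e(2), of "\<lambda>x. x * n"] arg_cong[OF e(3), of "\<lambda>x. x * n"]
    by (simp_all only: add_mult_distrib mult_1)
qed

lemma elem_mat_cases:
  assumes "- int m \<le> i" "i < int m"
  obtains "i = 0" | "i = - int m" "m \<noteq> 0" | "i \<noteq> 0" "nat \<bar>i\<bar> < m"
  using assms by linarith

lemma elem_mat_carrier:
  assumes i: "- int m \<le> i" "i < int m" and X: "X \<in> carrier_mat n n"
  shows "elem_mat n m i X \<in> carrier_mat (m * n) (m * n)"
proof -
  have m: "(m - 1) * n + n = m * n" using i by (cases m) auto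
  from i show ?thesis
  proof (cases rule: elem_mat_cases)
    case 1
    thus ?thesis using X m unfolding carrier_mat_def
      by (simp add: elem_mat_def dim_diag_block_mat del: diag_block_mat.simps)
  next
    case 2
    hence "i \<noteq> 0" by simp
    thus ?thesis using X m 2 unfolding carrier_mat_def
      by (simp add: elem_mat_def dim_diag_block_mat add.commute del: diag_block_mat.simps)
  next
    case 3
    define k where "k = nat \<bar>i\<bar>"
    have k: "1 \<le> k" "k < m" using 3 by (auto simp: k_def)
    have "dim_row (elem_core n i X) = 2 * n" "dim_col (elem_core n i X) = 2 * n"
      using elem_core_carrier[OF X, of i] by auto
    hence "dim_row (elem_mat n m i X) = (m - k - 1) * n + 2 * n + (k - 1) * n"
      "dim_col (elem_mat n m i X) = (m - k - 1) * n + 2 * n + (k - 1) * n"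
      unfolding elem_mat_middle[OF 3 k_def] dim_diag_block_mat by simp_all
    thus ?thesis unfolding block_count(1)[OF k] by blast
  qed
qed

lemma elem_mat_supported:
  assumes i: "- int m \<le> i" "i < int m" and X: "X \<in> carrier_mat n n"
  shows "supported_on (m * n) (index_support n m (nat \<bar>i\<bar>)) (elem_mat n m i X)"
  unfolding supported_on_def
proof (intro conjI allI impI)
  show "elem_mat n m i X \<in> carrier_mat (m * n) (m * n)" by (rule elem_mat_carrier[OF assms])
  fix a b assume ab: "a < m * n" "b < m * n" and out: "a \<notin> index_support n m (nat \<bar>i\<bar>) \<or> b \<notin> index_support n m (nat \<bar>i\<bar>)"
  have m: "(m - 1) * n + n = m * n" using i by (cases m) auto
  from i show "elem_mat n m i X $$ (a,b) = (if a = b then 1 else 0)"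
  proof (cases rule: elem_mat_cases)
    case 1
    have "\<not> ((m - 1) * n \<le> a \<and> (m - 1) * n \<le> b)"
      using out ab 1 by (auto simp: index_support_def)
    moreover have "elem_mat n m i X = diag_block_mat [1\<^sub>m ((m - 1) * n), X]" using 1 by (simp add: elem_mat_def)
    ultimately show ?thesis using diag2_index[of "1\<^sub>m ((m - 1) * n)" "(m - 1) * n" X n a b] X ab m by auto
  next
    case 2
    have "\<not> (a < n \<and> b < n)" using out ab 2 by (auto simp: index_support_def)
    moreover have "elem_mat n m i X = diag_block_mat [X, 1\<^sub>m ((m - 1) * n)]" using 2 by (simp add: elem_mat_def)
    moreover have "a < n + (m - 1) * n" "b < n + (m - 1) * n" using ab m by auto
    ultimately show ?thesis using diag2_index[of X n "1\<^sub>m ((m - 1) * n)" "(m - 1) * n" a b] X ab m by auto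
  next
    case 3
    define k where "k = nat \<bar>i\<bar>"
    have k: "1 \<le> k" "k < m" using 3 by (auto simp: k_def)
    note bc = block_count[OF k, of n]
    show ?thesis
      unfolding elem_mat_middle[OF 3 k_def]
      using diag3_index[OF elem_core_carrier[OF X, of i], of a "(m - k - 1) * n" "(k - 1) * n" b] ab out bc
      by (auto simp: index_support_def k_def[symmetric])
  qed
qed

lemma elem_mat_transpose:
  assumes i: "- int m \<le> i" "i < int m" and X: "X \<in> carrier_mat n n" "transpose_mat X = X"
  shows "transpose_mat (elem_mat n m i X) = elem_mat n m i X"
proof -
  have tr2: "transpose_mat (diag_block_mat [A, B]) = diag_block_mat [transpose_mat A, transpose_mat B]"
    for A B :: "complex mat"
    by (rule eq_matI) (auto simp: Let_def)
  have tr3: "transpose_mat (diag_block_mat [A, B, C]) = diag_block_mat [transpose_mat A, transpose_mat B, transpose_mat C]"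
    for A B C :: "complex mat"
    by (rule eq_matI) (auto simp: Let_def)
  from i show ?thesis
  proof (cases rule: elem_mat_cases)
    case 1
    thus ?thesis using X tr2 by (simp add: elem_mat_def del: diag_block_mat.simps)
  next
    case 2
    hence "i \<noteq> 0" by simp
    thus ?thesis using X 2 tr2 by (simp add: elem_mat_def del: diag_block_mat.simps)
  next
    case 3
    have "transpose_mat (elem_core n i X) = elem_core n i X"
      unfolding elem_core_def using X by (auto simp: transpose_four_block_mat[of _ n n _ n _ n])
    thus ?thesis unfolding elem_mat_middle[OF 3 refl] tr3 by simp
  qed
qed

lemma elem_mat_real:
  assumes i: "- int m \<le> i" "i < int m" and X: "X \<in> carrier_mat n n" "real_mat X"
  shows "real_mat (elem_mat n m i X)"
proof -
  have rfb: "real_mat (four_block_mat A B C D)" if "real_mat A" "real_mat B" "real_mat C" "real_mat D"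
     "A \<in> carrier_mat p q" "B \<in> carrier_mat p q'" "C \<in> carrier_mat p' q" "D \<in> carrier_mat p' q'" for A B C D p q p' q'
    using that by (auto simp: real_mat_def)
  have 01: "real_mat (1\<^sub>m k)" "real_mat (0\<^sub>m k l)" for k l by (auto simp: real_mat_def)
  have rd: "real_mat (diag_block_mat Ms)" if "\<And>M. M \<in> set Ms \<Longrightarrow> real_mat M" for Ms
    using that
    by (induction Ms) (auto simp: Let_def 01 intro!: rfb)
  from i show ?thesis
  proof (cases rule: elem_mat_cases)
    case 1
    thus ?thesis using X 01 by (simp add: elem_mat_def del: diag_block_mat.simps) (intro rd, auto)
  next
    case 2
    hence "i \<noteq> 0" by simp
    thus ?thesis using X 2 01 by (simp add: elem_mat_def del: diag_block_mat.simps) (intro rd, auto)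
  next
    case 3
    have "real_mat (elem_core n i X)"
      unfolding elem_core_def using X 01 by (auto intro!: rfb)
    thus ?thesis unfolding elem_mat_middle[OF 3 refl] by (intro rd) (auto simp: 01)
  qed
qed

lemma index_support_disjoint:
  assumes "k + 1 < l" "l \<le> m"
  shows "index_support n m k \<inter> index_support n m l = {}"
proof -
  have "m - l + 1 \<le> m - k - 1" using assms by simp
  hence "(m - l + 1) * n \<le> (m - k - 1) * n" by (rule mult_right_mono) simp
  thus ?thesis by (auto simp: index_support_def)
qed

lemma elem_mat_commute:
  assumes i: "- int m \<le> i" "i < int m" and j: "- int m \<le> j" "j < int m"
    and X: "X \<in> carrier_mat n n" and Y: "Y \<in> carrier_mat n n" and ij: "\<bar>i\<bar> + 1 < \<bar>j\<bar> \<or> \<bar>j\<bar> + 1 < \<bar>i\<bar>"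
  shows "elem_mat n m i X * elem_mat n m j Y = elem_mat n m j Y * elem_mat n m i X"
proof -
  have "index_support n m (nat \<bar>i\<bar>) \<inter> index_support n m (nat \<bar>j\<bar>) = {}"
    using ij
  proof
    assume "\<bar>i\<bar> + 1 < \<bar>j\<bar>" thus ?thesis using j by (intro index_support_disjoint) auto
  next
    assume "\<bar>j\<bar> + 1 < \<bar>i\<bar>" thus ?thesis
      by (subst Int_commute, intro index_support_disjoint) (use i in auto)
  qed
  thus ?thesis by (intro supported_on_commute[OF elem_mat_supported elem_mat_supported]) (use assms in auto)
qed

lemma elem_mat_inverse:
  assumes i: "0 < i" "i < int m" and X: "X \<in> carrier_mat n n"
  shows "elem_mat n m i (- X) * elem_mat n m (- i) X = 1\<^sub>m (m * n)"
proof -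
  define k where "k = nat \<bar>i\<bar>"
  have k: "1 \<le> k" "k < m" "k = nat \<bar>- i\<bar>" using i by (auto simp: k_def)
  define p q where "p = (m - k - 1) * n" and "q = (k - 1) * n"
  have core: "elem_core n i (- X) * elem_core n (- i) X = 1\<^sub>m (n + n)"
  proof -
    have "elem_core n i (- X) * elem_core n (- i) X =
        four_block_mat (- X) (1\<^sub>m n) (1\<^sub>m n) (0\<^sub>m n n) * four_block_mat (0\<^sub>m n n) (1\<^sub>m n) (1\<^sub>m n) X"
      using i by (simp add: elem_core_def)
    also have "\<dots> = four_block_mat (- X * 0\<^sub>m n n + 1\<^sub>m n * 1\<^sub>m n) (- X * 1\<^sub>m n + 1\<^sub>m n * X)
        (1\<^sub>m n * 0\<^sub>m n n + 0\<^sub>m n n * 1\<^sub>m n) (1\<^sub>m n * 1\<^sub>m n + 0\<^sub>m n n * X)"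
      by (rule mult_four_block_mat) (use X in auto)
    also have "\<dots> = four_block_mat (1\<^sub>m n) (0\<^sub>m n n) (0\<^sub>m n n) (1\<^sub>m n)"
      using X by (intro cong_four_block_mat) (auto simp: uminus_l_inv_mat)
    finally show ?thesis by simp
  qed
  have cc: "elem_core n i (- X) \<in> carrier_mat (n + n) (n + n)" "elem_core n (- i) X \<in> carrier_mat (n + n) (n + n)"
    using X elem_core_carrier[of "- X" n i] elem_core_carrier[of X n "- i"] by (auto simp: mult_2)
  have f: "diag_block_mat [1\<^sub>m p, Y, 1\<^sub>m q] = four_block_mat (1\<^sub>m p) (0\<^sub>m p (n + n + q)) (0\<^sub>m (n + n + q) p)
       (four_block_mat Y (0\<^sub>m (n + n) q) (0\<^sub>m q (n + n)) (1\<^sub>m q))"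
    if "Y \<in> carrier_mat (n + n) (n + n)" for Y :: "complex mat"
  proof -
    have "diag_block_mat [Y, 1\<^sub>m q] = four_block_mat Y (0\<^sub>m (n + n) q) (0\<^sub>m q (n + n)) (1\<^sub>m q)"
      using that by (rule_tac eq_matI) (auto simp: Let_def)
    thus ?thesis using that by (subst diag_block_mat.simps) (auto simp: Let_def)
  qed
  have mult: "diag_block_mat [1\<^sub>m p, Y, 1\<^sub>m q] * diag_block_mat [1\<^sub>m p, Y', 1\<^sub>m q] = 1\<^sub>m (p + (n + n + q))"
    if Y: "Y \<in> carrier_mat (n + n) (n + n)" "Y' \<in> carrier_mat (n + n) (n + n)" and YY: "Y * Y' = 1\<^sub>m (n + n)" for Y Y' :: "complex mat"
  proof -
    have inner: "four_block_mat Y (0\<^sub>m (n + n) q) (0\<^sub>m q (n + n)) (1\<^sub>m q) * four_block_mat Y' (0\<^sub>m (n + n) q) (0\<^sub>m q (n + n)) (1\<^sub>m q)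
       = 1\<^sub>m (n + n + q)"
      using Y YY by (subst mult_four_block_mat[of _ "n + n" "n + n" _ q _ q _ _ "n + n" _ q]) auto
    have cin: "four_block_mat Z (0\<^sub>m (n + n) q) (0\<^sub>m q (n + n)) (1\<^sub>m q) \<in> carrier_mat (n + n + q) (n + n + q)"
      if "Z \<in> carrier_mat (n + n) (n + n)" for Z :: "complex mat" using that by auto
    show ?thesis unfolding f[OF Y(1)] f[OF Y(2)]
      using cin[OF Y(1)] cin[OF Y(2)] inner left_mult_zero_mat[OF cin[OF Y(2)], of p]
        right_mult_zero_mat[OF cin[OF Y(1)], of p]
      by (subst mult_four_block_mat[of _ p p _ "n + n + q" _ "n + n + q" _ _ p _ "n + n + q"]) auto
  qed
  have "p + (n + n + q) = m * n" using block_count(1)[OF k(1,2), of n] by (simp add: p_def q_def)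
  moreover have "elem_mat n m i (- X) = diag_block_mat [1\<^sub>m p, elem_core n i (- X), 1\<^sub>m q]"
    unfolding p_def q_def by (rule elem_mat_middle) (use i k in \<open>auto simp: k_def\<close>)
  moreover have "elem_mat n m (- i) X = diag_block_mat [1\<^sub>m p, elem_core n (- i) X, 1\<^sub>m q]"
    unfolding p_def q_def by (rule elem_mat_middle) (use i k in \<open>auto simp: k_def\<close>)
  ultimately show ?thesis using mult[OF cc core] by simp
qed

section \<open>Action on block columns\<close>

text \<open>
  The block column \<open>e\<^bsub>m-j\<^esub> \<otimes> Z\<close>. Numbering the blocks from the bottom makes an elementary
  matrix with index \<open>i > 0\<close> carry the position \<open>i - 1\<close> to \<open>i\<close>.
\<close>

definition block_col :: "nat \<Rightarrow> nat \<Rightarrow> complex mat \<Rightarrow> complex mat" where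
  "block_col m j Z = e_col m (m - j) \<otimes>\<^sub>K Z"

lemma block_col_carrier [simp]:
  "Z \<in> carrier_mat n r \<Longrightarrow> block_col m j Z \<in> carrier_mat (m * n) r"
  by (auto simp: block_col_def kronecker_def e_col_def)

lemma block_col_index:
  assumes Z: "Z \<in> carrier_mat n r" and "a < m * n" "c < r"
  shows "block_col m j Z $$ (a,c) = (if Suc (a div n) = m - j then Z $$ (a mod n, c) else 0)"
proof -
  have "a div n < m" using assms(2) by (simp add: less_mult_imp_div_less)
  thus ?thesis using assms by (auto simp: block_col_def kronecker_def e_col_def)
qed

lemma elem_mat_block_col_fix:
  assumes i: "- int m \<le> i" "i < int m" and X: "X \<in> carrier_mat n n" and Z: "Z \<in> carrier_mat n r"
    and j: "j < m" and ij: "\<bar>i\<bar> \<noteq> int j" "\<bar>i\<bar> \<noteq> int j + 1"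
  shows "elem_mat n m i X * block_col m j Z = block_col m j Z"
proof (rule supported_on_mult_disjoint[OF elem_mat_supported[OF i X] block_col_carrier[OF Z]])
  fix l c assume l: "l < m * n" "l \<in> index_support n m (nat \<bar>i\<bar>)" and c: "c < r"
  define k where "k = nat \<bar>i\<bar>"
  have n: "n > 0" using l(1) by (cases n) auto
  have k: "k \<le> m" "k \<noteq> j" "k \<noteq> Suc j" using i ij by (auto simp: k_def)
  have "(m - k - 1) * n \<le> l" "l < (m - k + 1) * n" using l by (auto simp: index_support_def k_def)
  hence "m - k - 1 \<le> l div n" "l div n < m - k + 1"
    using n by (auto simp: less_eq_div_iff_mult_less_eq less_mult_imp_div_less)
  moreover have "l div n < m" using l(1) by (simp add: less_mult_imp_div_less)
  ultimately have "Suc (l div n) \<noteq> m - j" using k j by auto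
  thus "block_col m j Z $$ (l, c) = 0" using block_col_index[OF Z l(1) c] by simp
qed

lemma elem_mat_block_col_step:
  assumes i: "Suc j < m" and X: "X \<in> carrier_mat n n" and Z: "Z \<in> carrier_mat n r"
  shows "elem_mat n m (int (Suc j)) X * block_col m j Z = block_col m (Suc j) Z"
proof (rule eq_matI)
  define k where "k = Suc j"
  define p where "p = (m - k - 1) * n"
  have k: "1 \<le> k" "k < m" using i by (auto simp: k_def)
  note bc = block_count[OF k, of n, folded p_def]
  have kk: "k = nat \<bar>int (Suc j)\<bar>" by (simp add: k_def)
  define M where "M = elem_mat n m (int (Suc j)) X"
  have Me: "M = diag_block_mat [1\<^sub>m p, elem_core n (int (Suc j)) X, 1\<^sub>m ((k - 1) * n)]"
    unfolding M_def p_def by (rule elem_mat_middle) (use i in \<open>auto simp: k_def\<close>)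
  have Mc: "M \<in> carrier_mat (m * n) (m * n)" unfolding M_def by (rule elem_mat_carrier) (use i X in auto)
  fix a c assume "a < dim_row (block_col m (Suc j) Z)" "c < dim_col (block_col m (Suc j) Z)"
  hence ac: "a < m * n" "c < r" using block_col_carrier[OF Z, of m "Suc j"] by auto
  have n: "n > 0" using ac(1) by (cases n) auto
  have blk: "Suc (l div n) = m - j \<longleftrightarrow> p + n \<le> l \<and> l < p + 2 * n" if "l < m * n" for l
  proof -
    have "m - j = Suc (m - k)" using k by (simp add: k_def)
    hence "Suc (l div n) = m - j \<longleftrightarrow> l div n = m - k" by auto
    also have "\<dots> \<longleftrightarrow> (m - k) * n \<le> l \<and> l < (m - k + 1) * n"
      using n by (metis Suc_eq_plus1 div_less_iff_less_mult le_less_Suc_eq less_Suc_eq_le less_eq_div_iff_mult_less_eq order_refl not_less_eq linorder_neqE_nat)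
    finally show ?thesis using bc by (simp add: mult_2 add_ac)
  qed
  have blk': "Suc (a div n) = m - Suc j \<longleftrightarrow> p \<le> a \<and> a < p + n"
  proof -
    have "Suc (a div n) = m - Suc j \<longleftrightarrow> a div n = m - k - 1" using k by (auto simp: k_def)
    also have "\<dots> \<longleftrightarrow> (m - k - 1) * n \<le> a \<and> a < (m - k - 1 + 1) * n"
      using n by (metis Suc_eq_plus1 div_less_iff_less_mult le_less_Suc_eq less_Suc_eq_le less_eq_div_iff_mult_less_eq order_refl not_less_eq linorder_neqE_nat)
    finally show ?thesis by (simp add: p_def add.commute)
  qed
  have Mal: "M $$ (a,l) = (if l = a + n \<and> p \<le> a then 1 else 0)" if l: "p + n \<le> l" "l < p + 2 * n" for l
  proof -
    have lmn: "l < m * n" using l bc by simp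
    have "M $$ (a,l) = (if p \<le> a \<and> a < p + 2 * n \<and> p \<le> l \<and> l < p + 2 * n
        then elem_core n (int (Suc j)) X $$ (a - p, l - p) else if a = l then 1 else 0)"
      unfolding Me
      by (rule diag3_index[OF elem_core_carrier[OF X]]) (use ac lmn bc in auto)
    moreover have core_col: "elem_core n (int (Suc j)) X $$ (a', l') = (if l' = a' + n then 1 else 0)"
      if "a' < 2 * n" "n \<le> l'" "l' < 2 * n" for a' l'
    proof (cases "a' < n")
      case True
      have "l' - n < n" using that by linarith
      thus ?thesis using True that X by (auto simp: elem_core_def)
    next
      case False
      thus ?thesis using that X by (simp add: elem_core_def)
    qed
    hence "elem_core n (int (Suc j)) X $$ (a - p, l - p) = (if l = a + n then 1 else 0)"
      if pa: "p \<le> a" "a < p + 2 * n"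
    proof -
      have "a - p < 2 * n" "n \<le> l - p" "l - p < 2 * n" using l pa by linarith+
      moreover have "l - p = a - p + n \<longleftrightarrow> l = a + n" using l pa by linarith
      ultimately show ?thesis using core_col[of "a - p" "l - p"] by presburger
    qed
    ultimately show ?thesis using l by (cases "p \<le> a \<and> a < p + 2 * n") auto
  qed
  have "(M * block_col m j Z) $$ (a,c) = (\<Sum>l<m*n. M $$ (a,l) * block_col m j Z $$ (l,c))"
    using Mc block_col_carrier[OF Z, of m j] ac by (auto simp: scalar_prod_def atLeast0LessThan)
  also have "\<dots> = (\<Sum>l<m*n. if l = a + n then (if p \<le> a \<and> a < p + n then Z $$ (a mod n, c) else 0) else 0)"
  proof (intro sum.cong refl)
    fix l assume l: "l \<in> {..<m*n}"
    show "M $$ (a,l) * block_col m j Z $$ (l,c) =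
      (if l = a + n then (if p \<le> a \<and> a < p + n then Z $$ (a mod n, c) else 0) else 0)"
    proof (cases "p + n \<le> l \<and> l < p + 2 * n")
      case True
      thus ?thesis using blk[of l] l Mal[of l] block_col_index[OF Z _ ac(2), of l m j] by auto
    next
      case False
      thus ?thesis using blk[of l] l block_col_index[OF Z _ ac(2), of l m j] by auto
    qed
  qed
  also have "\<dots> = (if p \<le> a \<and> a < p + n then Z $$ (a mod n, c) else 0)"
    using ac bc by auto
  also have "\<dots> = block_col m (Suc j) Z $$ (a,c)"
    using block_col_index[OF Z ac] blk' by simp
  finally show "(elem_mat n m (int (Suc j)) X * block_col m j Z) $$ (a, c) = block_col m (Suc j) Z $$ (a, c)"
    by (simp add: M_def)
qed (use elem_mat_carrier[of m "int (Suc j)" X n] i X carrier_matD[OF block_col_carrier[OF Z, of m j]]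
    carrier_matD[OF block_col_carrier[OF Z, of m "Suc j"]] in auto)

section \<open>Index tuples\<close>

lemma simple_admissible_0: "simple_admissible 0 = [0]"
  and simple_admissible_1: "simple_admissible (Suc 0) = [0, 1]"
  and simple_complement_0: "simple_complement 0 = []"
  and simple_complement_1: "simple_complement (Suc 0) = [0]"
  by (simp_all add: simple_admissible_def admissible_tuple_def simple_complement_def symmetric_complement_def upto_rec1)

lemma half_SucSuc: "(Suc (Suc k) - k mod 2) div 2 = Suc ((k - k mod 2) div 2)"
proof -
  have "Suc (Suc k) - k mod 2 = (k - k mod 2) + 2" using mod_le_divisor[of 2 k] by (cases "even k") (auto simp: odd_iff_mod_2_eq_one)
  thus ?thesis by simp
qed

lemma simple_admissible_SucSuc:
  "simple_admissible (Suc (Suc k)) = [int k + 1, int k + 2] @ simple_admissible k"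
proof -
  have "[0..<Suc c] = 0 # map Suc [0..<c]" for c by (simp add: map_Suc_upt upt_conv_Cons del: upt_Suc)
  moreover have "[int k + 1..int k + 2] = [int k + 1, int k + 2]" by (simp add: upto_rec1)
  ultimately show ?thesis
    unfolding simple_admissible_def admissible_tuple_def
    by (simp add: half_SucSuc o_def algebra_simps del: upt_Suc)
qed

lemma simple_complement_SucSuc:
  "simple_complement (Suc (Suc k)) = (int k + 1) # simple_complement k"
proof -
  have "[0..<Suc c] = 0 # map Suc [0..<c]" for c by (simp add: map_Suc_upt upt_conv_Cons del: upt_Suc)
  thus ?thesis
    unfolding simple_complement_def symmetric_complement_def
    by (simp add: half_SucSuc o_def algebra_simps del: upt_Suc)
qed

lemma set_simple_admissible: "set (simple_admissible k) \<subseteq> {0..int k}"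
proof (induction k rule: induct_nat_012)
  case (ge2 k)
  thus ?case by (auto simp: simple_admissible_SucSuc)
qed (auto simp: simple_admissible_0 simple_admissible_1)

lemma set_simple_complement: "set (simple_complement k) \<subseteq> {0..<int k}"
proof (induction k rule: induct_nat_012)
  case (ge2 k)
  thus ?case by (auto simp: simple_complement_SucSuc)
qed (auto simp: simple_complement_0 simple_complement_1)

lemma set_canonical_form:
  assumes "canonical_form k ts" shows "set ts \<subseteq> {0..int k - 2}"
proof
  fix i assume "i \<in> set ts"
  then obtain a :: "nat \<Rightarrow> int" and l where "\<forall>l \<in> {1..k div 2}. 0 \<le> a l" "l \<in> {1..k div 2}" "i \<in> {a l..int k - 2 * int l}"
    using assms unfolding canonical_form_def by fastforce
  hence "0 \<le> a l" "a l \<le> i" "i \<le> int k - 2 * int l" "1 \<le> l" by auto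
  thus "i \<in> {0..int k - 2}" by auto
qed

text \<open>
  Abbreviate by \<open>S k\<close> the product over the admissible tuple and its complement. The outermost
  index \<open>k + 1\<close> of the complement for \<open>k + 2\<close> commutes with the rest of the complement and can be
  moved to the right end, which gives \<open>S (k + 2) = M (k + 1) (M (k + 2) S k) M (k + 1)\<close>. Here
  \<open>M (k + 2)\<close> and \<open>S k\<close> commute, so the middle factor is symmetric.
\<close>

lemma palindromic_symmetric:
  fixes M :: "int \<Rightarrow> 'a :: comm_semiring_1 mat"
  assumes car: "\<And>j. 0 \<le> j \<Longrightarrow> j \<le> int K \<Longrightarrow> M j \<in> carrier_mat N N"
    and sym: "\<And>j. 0 \<le> j \<Longrightarrow> j \<le> int K \<Longrightarrow> transpose_mat (M j) = M j"
    and comm: "\<And>i j. 0 \<le> i \<Longrightarrow> i + 1 < j \<Longrightarrow> j \<le> int K \<Longrightarrow> M i * M j = M j * M i"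
    and k: "k \<le> K"
  defines "W \<equiv> \<lambda>k. mat_prod N (map M (simple_admissible k))"
    and "C \<equiv> \<lambda>k. mat_prod N (map M (simple_complement k))"
  shows "transpose_mat (C k) = C k \<and> transpose_mat (W k * C k) = W k * C k"
  using k
proof (induction k rule: induct_nat_012)
  case 0
  have "W 0 = M 0" "C 0 = 1\<^sub>m N"
    using car[of 0] by (simp_all add: W_def C_def simple_admissible_0 simple_complement_0 right_mult_one_mat[of _ N N])
  thus ?case using car[of 0] sym[of 0] by (simp add: right_mult_one_mat[of _ N N])
next
  case 1
  have c: "M 0 \<in> carrier_mat N N" "M 1 \<in> carrier_mat N N" using car 1 by auto
  have "W 1 = M 0 * M 1" "C 1 = M 0"
    using c by (simp_all add: W_def C_def simple_admissible_1 simple_complement_1 right_mult_one_mat[of _ N N])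
  moreover have "transpose_mat (M 0 * M 1 * M 0) = M 0 * (M 1 * M 0)"
    using c sym[of 0] sym[of 1] 1
    by (subst transpose_mult[of _ N N _ N]) (auto simp: transpose_mult[of _ N N _ N])
  ultimately show ?case using c sym[of 0] by (simp add: assoc_mult_mat[of _ N N _ N _ N])
next
  case (ge2 k)
  have IH: "transpose_mat (C k) = C k" "transpose_mat (W k * C k) = W k * C k" using ge2 by auto
  define a b where "a = M (int k + 1)" and "b = M (int k + 2)"
  have cark: "M j \<in> carrier_mat N N" if "0 \<le> j" "j \<le> int k" for j using car[of j] that ge2.prems by auto
  have wc: "set (map M (simple_admissible k)) \<subseteq> carrier_mat N N" "set (map M (simple_complement k)) \<subseteq> carrier_mat N N"
    by (auto intro!: cark dest!: subsetD[OF set_simple_admissible] subsetD[OF set_simple_complement])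
  have c: "a \<in> carrier_mat N N" "b \<in> carrier_mat N N" "W k \<in> carrier_mat N N" "C k \<in> carrier_mat N N"
    unfolding a_def b_def W_def C_def using car ge2.prems wc by auto
  have s: "transpose_mat a = a" "transpose_mat b = b" unfolding a_def b_def using sym ge2.prems by auto
  have aC: "a * C k = C k * a" unfolding a_def C_def
  proof (rule mat_prod_commute[OF _ wc(2)])
    fix M' assume "M' \<in> set (map M (simple_complement k))"
    then obtain j where "M' = M j" "0 \<le> j" "j < int k" using set_simple_complement[of k] by auto
    thus "M (int k + 1) * M' = M' * M (int k + 1)" using comm[of j "int k + 1"] ge2.prems by simp
  qed (use car ge2.prems in auto)
  have bx: "b * M j = M j * b" if "0 \<le> j" "j \<le> int k" for j
    unfolding b_def using comm[of j "int k + 2"] that ge2.prems by simp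
  have bW: "b * W k = W k * b" unfolding W_def
  proof (rule mat_prod_commute[OF c(2) wc(1)])
    fix M' assume "M' \<in> set (map M (simple_admissible k))"
    then obtain j where "M' = M j" "0 \<le> j" "j \<le> int k" using set_simple_admissible[of k] by auto
    thus "b * M' = M' * b" using bx by simp
  qed
  have bC: "b * C k = C k * b" unfolding C_def
  proof (rule mat_prod_commute[OF c(2) wc(2)])
    fix M' assume "M' \<in> set (map M (simple_complement k))"
    then obtain j where "M' = M j" "0 \<le> j" "j \<le> int k" using set_simple_complement[of k] by force
    thus "b * M' = M' * b" using bx by simp
  qed
  note assoc = assoc_mult_mat[of _ N N _ N _ N] mult_carrier_mat[of _ N N _ N]
  have W2: "W (Suc (Suc k)) = a * (b * W k)" and C2: "C (Suc (Suc k)) = a * C k"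
    unfolding W_def C_def a_def b_def by (simp_all add: simple_admissible_SucSuc simple_complement_SucSuc)
  have "transpose_mat (a * C k) = a * C k" by (rule symmetric_mult[OF c(1,4) s(1) IH(1) aC])
  moreover have "transpose_mat (W (Suc (Suc k)) * C (Suc (Suc k))) = W (Suc (Suc k)) * C (Suc (Suc k))"
  proof -
    define S where "S = b * (W k * C k)"
    have Sc: "S \<in> carrier_mat N N" using c by (simp add: S_def assoc)
    have bS: "b * (W k * C k) = W k * C k * b"
    proof -
      have "b * (W k * C k) = (b * W k) * C k" using c by (simp add: assoc)
      also have "\<dots> = W k * (b * C k)" unfolding bW using c by (simp add: assoc)
      also have "\<dots> = W k * C k * b" unfolding bC using c by (simp add: assoc)
      finally show ?thesis .
    qed
    have St: "transpose_mat S = S" unfolding S_def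
      by (rule symmetric_mult[OF c(2) mult_carrier_mat[OF c(3,4)] s(2) IH(2) bS])
    have "W (Suc (Suc k)) * C (Suc (Suc k)) = a * (b * W k) * (C k * a)" unfolding W2 C2 aC ..
    also have "\<dots> = a * S * a" using c by (simp add: assoc S_def)
    finally have e: "W (Suc (Suc k)) * C (Suc (Suc k)) = a * S * a" .
    have "transpose_mat (a * S * a) = a * (S * a)"
      using c Sc s St by (subst transpose_mult[of _ N N _ N]) (auto simp: transpose_mult[of _ N N _ N] assoc)
    thus ?thesis unfolding e using c Sc by (simp add: assoc)
  qed
  ultimately show ?case unfolding C2 by blast
qed

text \<open>
  The position of a block column after multiplication by an elementary matrix with index \<open>i\<close>.
  The product over a tuple acts from its right end, hence the use of \<open>foldr\<close> below.
\<close>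

definition climb :: "int \<Rightarrow> int \<Rightarrow> int" where
  "climb i s = (if i = s + 1 then s + 1 else s)"

lemma climb_simps: "i = s + 1 \<Longrightarrow> climb i s = s + 1" "i \<noteq> s + 1 \<Longrightarrow> climb i s = s"
  by (simp_all add: climb_def)

lemma climb_ge: "s \<le> climb i s"
  by (simp add: climb_def)

text \<open>
  An index equal to the current position would multiply the block by the assigned matrix, and
  the shape of the block column would be lost.
\<close>

fun no_stall :: "int list \<Rightarrow> int \<Rightarrow> bool" where
  "no_stall [] s = True"
| "no_stall (i # ts) s = (no_stall ts s \<and> i \<noteq> foldr climb ts s)"

lemma no_stall_append: "no_stall (xs @ ys) s \<longleftrightarrow> no_stall ys s \<and> no_stall xs (foldr climb ys s)"
  by (induction xs) auto

lemma foldr_climb_ge: "s \<le> foldr climb ts s"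
  by (induction ts) (auto intro: order_trans[OF _ climb_ge])

text \<open>
  The largest \<open>p\<close> for which \<open>(p, \<dots>, 1, 0)\<close> is a subtuple is found greedily from the right end, and
  the greedy search performs the same steps as a block column. The start \<open>-1\<close> says that no
  entry has been matched yet.
\<close>

lemma subseq_climb:
  assumes "- 1 \<le> p"
  shows "subseq (rev [0..p]) \<beta> \<longleftrightarrow> p \<le> foldr climb \<beta> (- 1)"
  using assms
proof (induction \<beta> arbitrary: p)
  case Nil
  thus ?case by (cases "p = - 1") (auto simp: upto_rec2)
next
  case (Cons i \<beta>)
  show ?case
  proof (cases "p = - 1")
    case True
    thus ?thesis using foldr_climb_ge[of "- 1" "i # \<beta>"] by simp
  next
    case False
    hence p: "0 \<le> p" using Cons.prems by simp
    have r: "rev [0..p] = p # rev [0..p - 1]" using p by (simp add: upto_rec2)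
    show ?thesis
    proof (cases "p = i")
      case True
      hence "subseq (rev [0..p]) (i # \<beta>) \<longleftrightarrow> subseq (rev [0..p - 1]) \<beta>" unfolding r by simp
      also have "\<dots> \<longleftrightarrow> p - 1 \<le> foldr climb \<beta> (- 1)" using Cons.IH p by simp
      finally show ?thesis using True
        by (cases "i = foldr climb \<beta> (- 1) + 1") (auto simp: climb_simps)
    next
      case pi: False
      hence "subseq (rev [0..p]) (i # \<beta>) \<longleftrightarrow> subseq (rev [0..p]) \<beta>" unfolding r by simp
      also have "\<dots> \<longleftrightarrow> p \<le> foldr climb \<beta> (- 1)" using Cons by simp
      finally show ?thesis using pi
        by (cases "i = foldr climb \<beta> (- 1) + 1") (auto simp: climb_simps)
    qed
  qed
qed

lemma i_zero_climb: "i_zero (ts @ [0]) = nat (foldr climb ts 0)"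
proof -
  have "foldr climb (ts @ [0]) (- 1) = foldr climb ts 0" by (simp add: climb_simps(1))
  hence "subseq (rev [0..int p]) (ts @ [0]) \<longleftrightarrow> p \<le> nat (foldr climb ts 0)" for p
    using subseq_climb[of "int p" "ts @ [0]"] foldr_climb_ge[of 0 ts] by auto
  thus ?thesis unfolding i_zero_def by (auto intro!: Greatest_equality)
qed

lemma climb_run:
  "foldr climb [a..b] s = (if a \<le> s + 1 \<and> s + 1 \<le> b then s + 1 else s) \<and> (s \<noteq> b \<longrightarrow> no_stall [a..b] s)"
proof (induction a b rule: upto.induct)
  case (1 a b)
  show ?case
  proof (cases "a \<le> b")
    case True
    hence "[a..b] = a # [a + 1..b]" by (simp add: upto_rec1)
    define y where "y = foldr climb [a + 1..b] s"
    have y: "y = (if a + 1 \<le> s + 1 \<and> s + 1 \<le> b then s + 1 else s)" "s \<noteq> b \<Longrightarrow> no_stall [a + 1..b] s"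
      using 1[OF True] by (auto simp: y_def)
    have "climb a y = (if a \<le> s + 1 \<and> s + 1 \<le> b then s + 1 else s)"
      using y(1) True by (cases "a = y + 1") (auto simp: climb_simps split: if_splits)
    moreover have "s \<noteq> b \<Longrightarrow> a \<noteq> y" using y(1) True by (auto split: if_splits)
    ultimately show ?thesis using y(2) \<open>[a..b] = _\<close> by (simp add: y_def[symmetric])
  qed simp
qed

text \<open>
  A run \<open>a:b\<close> moves a position below \<open>b\<close> by at most one step, to at most \<open>b\<close>, and a later run
  (further left) ends at \<open>b + 2\<close>. So the position stays below the end of every run that
  acts on it, with the exception of the first one, which for even \<open>h\<close> is \<open>(0)\<close> or empty and meets
  the position \<open>1\<close>.
\<close>

lemma climb_canonical:
  assumes ts: "canonical_form h ts" and h: "even h"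
  defines "s \<equiv> if h = 0 then 0 else 1 :: int"
  shows "no_stall ts s \<and> foldr climb ts s \<le> int h"
proof (cases "h = 0")
  case True
  thus ?thesis using ts by (auto simp: canonical_form_def s_def)
next
  case False
  define q where "q = h div 2"
  have hq: "h = 2 * q" "q \<ge> 1" using h False by (auto simp: q_def)
  obtain a :: "nat \<Rightarrow> int" where a: "\<And>l. l \<in> {1..q} \<Longrightarrow> 0 \<le> a l"
    "ts = concat (map (\<lambda>l. [a l..int h - 2 * int l]) [1..<Suc q])"
    using ts unfolding canonical_form_def q_def by blast
  define S where "S l0 = concat (map (\<lambda>l. [a l..int h - 2 * int l]) [l0..<Suc q])" for l0
  have "no_stall (S l0) 1 \<and> foldr climb (S l0) 1 \<le> max 1 (int h - 2 * int l0)" if "l0 \<le> Suc q" "1 \<le> l0" for l0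
    using that
  proof (induction l0 rule: inc_induct)
    case base
    show ?case by (simp add: S_def)
  next
    case (step l)
    define x where "x = foldr climb (S (Suc l)) 1"
    have x: "no_stall (S (Suc l)) 1" "1 \<le> x" "x \<le> max 1 (int h - 2 * int (Suc l))"
      using step foldr_climb_ge[of 1 "S (Suc l)"] by (auto simp: x_def)
    have S: "S l = [a l..int h - 2 * int l] @ S (Suc l)"
      using step.hyps by (simp add: S_def upt_conv_Cons del: upt_Suc)
    have "l < q \<or> l = q" using step.hyps by linarith
    hence "x \<noteq> int h - 2 * int l" using x hq by auto
    moreover have "foldr climb [a l..int h - 2 * int l] x \<le> max 1 (int h - 2 * int l)"
      using x climb_run[of "a l" "int h - 2 * int l" x] by auto
    ultimately show ?case
      unfolding S using x(1) climb_run[of "a l" "int h - 2 * int l" x]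
      by (simp add: no_stall_append x_def[symmetric])
  qed
  from this[of 1] have "no_stall ts 1 \<and> foldr climb ts 1 \<le> max 1 (int h - 2)"
    using hq(2) by (simp add: S_def a(2) del: upt_Suc)
  thus ?thesis using hq False by (auto simp: s_def)
qed

lemma climb_simple_complement:
  "even k \<Longrightarrow> no_stall (simple_complement k) 0 \<and> foldr climb (simple_complement k) 0 = (if k = 0 then 0 else 1)"
proof (induction k rule: induct_nat_012)
  case (ge2 k)
  thus ?case by (cases "k = 0") (auto simp: simple_complement_SucSuc climb_simps simple_complement_0)
qed (auto simp: simple_complement_0)

lemma simple_admissible_even:
  "even k \<Longrightarrow> \<exists>ps. simple_admissible k = ps @ [0] \<and> set ps \<subseteq> {1..int k} \<and> no_stall ps 0
    \<and> foldr climb ps 0 = (if k = 0 then 0 else 1)"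
proof (induction k rule: induct_nat_012)
  case 0
  show ?case by (simp add: simple_admissible_0)
next
  case (ge2 k)
  then obtain ps where ps: "simple_admissible k = ps @ [0]" "set ps \<subseteq> {1..int k}" "no_stall ps 0"
    "foldr climb ps 0 = (if k = 0 then 0 else 1)" by auto
  show ?case
    by (rule exI[of _ "[int k + 1, int k + 2] @ ps"])
      (use ps ge2.prems in \<open>cases "k = 0"; auto simp: simple_admissible_SucSuc climb_simps\<close>)
qed simp

lemma elem_product_block_col:
  assumes ps: "\<And>i X. (i, X) \<in> set ps \<Longrightarrow> 0 \<le> i \<and> i < int m \<and> X \<in> carrier_mat n n"
    and s: "0 \<le> s" "s < int m" and ns: "no_stall (map fst ps) s" and Z: "Z \<in> carrier_mat n r"
  shows "mat_prod (m * n) (map (\<lambda>(i, X). elem_mat n m i X) ps) * block_col m (nat s) Z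
      = block_col m (nat (foldr climb (map fst ps) s)) Z \<and> foldr climb (map fst ps) s < int m"
  using ps ns
proof (induction ps)
  case Nil
  show ?case using s block_col_carrier[OF Z, of m "nat s"] by (simp add: left_mult_one_mat[of _ "m * n" r])
next
  case (Cons p ps)
  obtain i X where p: "p = (i, X)" by (cases p)
  define x where "x = foldr climb (map fst ps) s"
  have iX: "0 \<le> i" "i < int m" "X \<in> carrier_mat n n" using Cons.prems(1)[of i X] p by auto
  have x0: "0 \<le> x" using foldr_climb_ge[of s "map fst ps"] s by (simp add: x_def)
  have IH: "mat_prod (m * n) (map (\<lambda>(i, X). elem_mat n m i X) ps) * block_col m (nat s) Z = block_col m (nat x) Z" "x < int m"
    using Cons p by (auto simp: x_def)
  have ix: "i \<noteq> x" using Cons.prems(2) p by (simp add: x_def)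
  have Mc: "elem_mat n m i X \<in> carrier_mat (m * n) (m * n)" by (rule elem_mat_carrier) (use iX in auto)
  have "mat_prod (m * n) (map (\<lambda>(i, X). elem_mat n m i X) ps) \<in> carrier_mat (m * n) (m * n)"
    using Cons.prems(1) by (intro mat_prod_carrier) (force intro!: elem_mat_carrier)
  hence "mat_prod (m * n) (map (\<lambda>(i, X). elem_mat n m i X) (p # ps)) * block_col m (nat s) Z
      = elem_mat n m i X * block_col m (nat x) Z"
    using Mc Z p IH(1) by (simp add: assoc_mult_mat[of _ "m * n" "m * n" _ "m * n" _ r])
  moreover have "elem_mat n m i X * block_col m (nat x) Z = block_col m (nat (climb i x)) Z \<and> climb i x < int m"
  proof (cases "i = x + 1")
    case True
    have i: "i = int (Suc (nat x))" "nat (x + 1) = Suc (nat x)" using True x0 by auto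
    have "elem_mat n m i X * block_col m (nat x) Z = block_col m (nat (x + 1)) Z"
      unfolding i by (rule elem_mat_block_col_step) (use iX Z True x0 in auto)
    thus ?thesis using True iX by (simp add: climb_simps)
  next
    case False
    thus ?thesis using elem_mat_block_col_fix[of m i X n Z r "nat x"] iX Z ix x0 IH(2) by (simp add: climb_simps)
  qed
  ultimately show ?case using p by (simp add: x_def)
qed

lemma far_product_block_col:
  assumes ps: "\<And>i X. (i, X) \<in> set ps \<Longrightarrow> - int m \<le> i \<and> i < int m \<and> int j + 1 < \<bar>i\<bar> \<and> X \<in> carrier_mat n n"
    and j: "j < m" and Z: "Z \<in> carrier_mat n r"
  shows "mat_prod (m * n) (map (\<lambda>(i, X). elem_mat n m i X) ps) * block_col m j Z = block_col m j Z"
  using ps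
proof (induction ps)
  case Nil
  show ?case using block_col_carrier[OF Z, of m j] by (simp add: left_mult_one_mat[of _ "m * n" r])
next
  case (Cons p ps)
  obtain i X where p: "p = (i, X)" by (cases p)
  have iX: "- int m \<le> i" "i < int m" "int j + 1 < \<bar>i\<bar>" "X \<in> carrier_mat n n" using Cons.prems[of i X] p by auto
  have Mc: "elem_mat n m i X \<in> carrier_mat (m * n) (m * n)" by (rule elem_mat_carrier) (use iX in auto)
  have "mat_prod (m * n) (map (\<lambda>(i, X). elem_mat n m i X) ps) \<in> carrier_mat (m * n) (m * n)"
    using Cons.prems by (intro mat_prod_carrier) (force intro!: elem_mat_carrier)
  hence "mat_prod (m * n) (map (\<lambda>(i, X). elem_mat n m i X) (p # ps)) * block_col m j Z
      = elem_mat n m i X * block_col m j Z"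
    using Mc Z p Cons.IH[OF Cons.prems[OF list.set_intros(2)]]
    by (simp add: assoc_mult_mat[of _ "m * n" "m * n" _ "m * n" _ r])
  also have "\<dots> = block_col m j Z"
    by (rule elem_mat_block_col_fix[OF iX(1,2,4) Z j]) (use iX(3) in auto)
  finally show ?case .
qed

section \<open>Block diagonal extension\<close>

lemma dsum_eq: "diag_block_mat [A, D] = four_block_mat A (0\<^sub>m (dim_row A) (dim_col D)) (0\<^sub>m (dim_row D) (dim_col A)) D"
  by (rule eq_matI) (auto simp: Let_def)

lemma dsum_carrier: "A \<in> carrier_mat N N \<Longrightarrow> D \<in> carrier_mat r r \<Longrightarrow> diag_block_mat [A, D] \<in> carrier_mat (N + r) (N + r)"
  by (auto simp: dsum_eq simp del: diag_block_mat.simps)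

lemma dsum_mult:
  assumes "A \<in> carrier_mat N N" "D \<in> carrier_mat r r" "A' \<in> carrier_mat N N" "D' \<in> carrier_mat r r"
  shows "diag_block_mat [A, D] * diag_block_mat [A', D'] = diag_block_mat [A * A', D * D']"
proof -
  have z: "A * 0\<^sub>m N r = 0\<^sub>m N r" "0\<^sub>m r N * A' = 0\<^sub>m r N" "D * 0\<^sub>m r N = 0\<^sub>m r N" "0\<^sub>m N r * D' = 0\<^sub>m N r"
    using assms by auto
  show ?thesis
    unfolding dsum_eq using assms z
    by (subst mult_four_block_mat[of _ N N _ r _ r _ _ N _ r]) auto
qed

lemma dsum_one: "diag_block_mat [1\<^sub>m N, 1\<^sub>m r] = 1\<^sub>m (N + r)"
  by (rule eq_matI) (auto simp: Let_def)

lemma mat_prod_dsum: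
  assumes "\<And>x. x \<in> set xs \<Longrightarrow> f x \<in> carrier_mat N N \<and> g x \<in> carrier_mat r r"
  shows "mat_prod (N + r) (map (\<lambda>x. diag_block_mat [f x, g x]) xs) =
    diag_block_mat [mat_prod N (map f xs), mat_prod r (map g xs)]"
  using assms
proof (induction xs)
  case Nil
  show ?case by (simp only: list.map mat_prod_Nil dsum_one)
next
  case (Cons x xs)
  have "mat_prod N (map f xs) \<in> carrier_mat N N" "mat_prod r (map g xs) \<in> carrier_mat r r"
    using Cons.prems by (auto intro!: mat_prod_carrier)
  thus ?case using Cons dsum_mult[of "f x" N "g x" r "mat_prod N (map f xs)" "mat_prod r (map g xs)"]
    by (simp del: diag_block_mat.simps)
qed

lemma mat_prod_ones: "(\<And>x. x \<in> set xs \<Longrightarrow> g x = 1\<^sub>m r) \<Longrightarrow> mat_prod r (map g xs) = 1\<^sub>m r"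
  by (induction xs) auto

lemma mat_prod_extend:
  assumes "\<And>M. M \<in> set Ms \<Longrightarrow> M \<in> carrier_mat N N"
  shows "mat_prod (N + r) (map (extend_mat r) Ms) = extend_mat r (mat_prod N Ms)"
proof -
  have ones: "mat_prod r (map (\<lambda>_. 1\<^sub>m r) Ms) = 1\<^sub>m r" by (rule mat_prod_ones) simp
  show ?thesis
    using mat_prod_dsum[of Ms "\<lambda>M. M" N "\<lambda>_. 1\<^sub>m r" r] assms
    unfolding ones extend_mat_def by (simp del: diag_block_mat.simps)
qed

lemma extend_mat_eq: "A \<in> carrier_mat N N \<Longrightarrow> extend_mat r A = four_block_mat A (0\<^sub>m N r) (0\<^sub>m r N) (1\<^sub>m r)"
  unfolding extend_mat_def dsum_eq by simp

lemma extend_mat_mult_left: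
  assumes M: "M \<in> carrier_mat N N"
    and X: "X \<in> carrier_mat N N" "Y \<in> carrier_mat N r" "Z \<in> carrier_mat r N" "D \<in> carrier_mat r r"
  shows "extend_mat r M * four_block_mat X Y Z D = four_block_mat (M * X) (M * Y) Z D"
proof -
  have z: "0\<^sub>m N r * Z = 0\<^sub>m N N" "0\<^sub>m N r * D = 0\<^sub>m N r" "0\<^sub>m r N * X = 0\<^sub>m r N" "0\<^sub>m r N * Y = 0\<^sub>m r r"
    using X by (auto intro: left_mult_zero_mat)
  have c: "M * X \<in> carrier_mat N N" "M * Y \<in> carrier_mat N r" using M X by auto
  show ?thesis unfolding extend_mat_eq[OF M]
      mult_four_block_mat[OF M zero_carrier_mat zero_carrier_mat one_carrier_mat X] z
    using c X by (simp add: right_add_zero_mat[of _ N N] right_add_zero_mat[of _ N r]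
        left_add_zero_mat[of _ r N] left_add_zero_mat[of _ r r])
qed

lemma extend_mat_mult_right:
  assumes M: "M \<in> carrier_mat N N"
    and X: "X \<in> carrier_mat N N" "Y \<in> carrier_mat N r" "Z \<in> carrier_mat r N" "D \<in> carrier_mat r r"
  shows "four_block_mat X Y Z D * extend_mat r M = four_block_mat (X * M) Y (Z * M) D"
proof -
  have z: "X * 0\<^sub>m N r = 0\<^sub>m N r" "Y * 0\<^sub>m r N = 0\<^sub>m N N" "Z * 0\<^sub>m N r = 0\<^sub>m r r" "D * 0\<^sub>m r N = 0\<^sub>m r N"
    using X by (auto intro: right_mult_zero_mat)
  have c: "X * M \<in> carrier_mat N N" "Z * M \<in> carrier_mat r N" using M X by auto
  show ?thesis unfolding extend_mat_eq[OF M]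
      mult_four_block_mat[OF X M zero_carrier_mat zero_carrier_mat one_carrier_mat] z
    using c X by (simp add: right_add_zero_mat[of _ N N] right_add_zero_mat[of _ r N]
        left_add_zero_mat[of _ N r] left_add_zero_mat[of _ r r])
qed

text \<open>
  The index \<open>0\<close> occurs exactly once in a simple admissible tuple.
\<close>

lemma mat_prod_marked:
  assumes "D \<in> carrier_mat r r"
  shows "mat_prod r (map (\<lambda>j :: int. if j = 0 then D else 1\<^sub>m r) (simple_admissible k)) = D"
proof (induction k rule: induct_nat_012)
  case (ge2 k)
  thus ?case using assms by (simp add: simple_admissible_SucSuc left_mult_one_mat[of _ r r])
qed (use assms in \<open>simp_all add: simple_admissible_0 simple_admissible_1 right_mult_one_mat[of _ r r]\<close>)

lemma pencil_const_mult:
  assumes "A \<in> carrier_mat k N" "X \<in> carrier_mat N l" "Y \<in> carrier_mat N l"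
  shows "const_mat A * pencil X Y = pencil (A * X) (A * Y)"
  unfolding pencil_def using assms
  by (subst mult_minus_distrib_mat[of _ k N _ l]) (auto simp: const_mat_mult mult_smult_distrib[of _ k N _ l])

lemma pencil_mult_const:
  assumes "X \<in> carrier_mat k N" "Y \<in> carrier_mat k N" "A \<in> carrier_mat N l"
  shows "pencil X Y * const_mat A = pencil (X * A) (Y * A)"
  unfolding pencil_def using assms
  by (subst minus_mult_distrib_mat[of _ k N _ _ l]) (auto simp: const_mat_mult mult_smult_assoc_mat[of _ k N _ l])

section \<open>The block symmetric pencil\<close>

definition fiedler_coeff :: "(nat \<Rightarrow> complex mat) \<Rightarrow> int \<Rightarrow> complex mat" where
  "fiedler_coeff As i = (if i \<ge> 0 then - As (nat i) else As (nat (- i)))"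

lemma fiedler_P_elem: "fiedler_P n m As i = elem_mat n m i (fiedler_coeff As i)"
  by (simp add: fiedler_P_def fiedler_coeff_def)

lemma real_mat_prod:
  "(\<And>M. M \<in> set Ms \<Longrightarrow> M \<in> carrier_mat N N \<and> real_mat M) \<Longrightarrow> real_mat (mat_prod N Ms)"
proof (induction Ms)
  case Nil
  show ?case by (auto simp: real_mat_def)
next
  case (Cons M Ms)
  have "set Ms \<subseteq> carrier_mat N N" using Cons.prems by auto
  thus ?case using Cons by (auto intro!: real_mat_mult[of _ N N _ N])
qed

locale symmetric_pencil_data =
  fixes n m r h :: nat and As :: "nat \<Rightarrow> complex mat" and A E B :: "complex mat"
    and tw tv :: "int list" and Xs Ys :: "complex mat list"
  assumes As: "\<And>i. i \<le> m \<Longrightarrow> As i \<in> carrier_mat n n" "\<And>i. i \<le> m \<Longrightarrow> transpose_mat (As i) = As i"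
      "\<And>i. i \<le> m \<Longrightarrow> real_mat (As i)"
    and AEB: "A \<in> carrier_mat r r" "E \<in> carrier_mat r r" "B \<in> carrier_mat r n"
    and h: "h < m" "even h"
    and tw: "canonical_form h tw"
    and tv: "canonical_form (m - h - 1) (shift_tuple (int m) tv)"
    and Xs: "matrix_assignment n tw Xs" "\<And>X. X \<in> set Xs \<Longrightarrow> real_mat X \<and> symmetric_matrix X"
    and Ys: "matrix_assignment n tv Ys" "\<And>Y. Y \<in> set Ys \<Longrightarrow> real_mat Y \<and> symmetric_matrix Y"
begin

abbreviation "N \<equiv> m * n"

lemma fiedler_coeff:
  assumes "- int m \<le> i" "i < int m"
  shows "fiedler_coeff As i \<in> carrier_mat n n" "transpose_mat (fiedler_coeff As i) = fiedler_coeff As i"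
    "real_mat (fiedler_coeff As i)"
proof -
  have "nat i \<le> m" "nat (- i) \<le> m" using assms by auto
  note a = As(1)[OF this(1)] As(1)[OF this(2)] As(2)[OF this(1)] As(2)[OF this(2)] As(3)[OF this(1)] As(3)[OF this(2)]
  show "fiedler_coeff As i \<in> carrier_mat n n" using a by (simp add: fiedler_coeff_def)
  show "transpose_mat (fiedler_coeff As i) = fiedler_coeff As i"
    using a by (simp add: fiedler_coeff_def transpose_uminus)
  show "real_mat (fiedler_coeff As i)"
    using a by (auto simp: fiedler_coeff_def real_mat_def)
qed

lemma fiedler_P:
  assumes "- int m \<le> i" "i < int m"
  shows "fiedler_P n m As i \<in> carrier_mat N N" "transpose_mat (fiedler_P n m As i) = fiedler_P n m As i"
    "real_mat (fiedler_P n m As i)"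
  unfolding fiedler_P_elem
  using elem_mat_carrier[OF assms fiedler_coeff(1)[OF assms]]
    elem_mat_transpose[OF assms fiedler_coeff(1,2)[OF assms]] elem_mat_real[OF assms fiedler_coeff(1,3)[OF assms]]
  by auto

lemma fiedler_P_commute:
  assumes "- int m \<le> i" "i < int m" "- int m \<le> j" "j < int m" "\<bar>i\<bar> + 1 < \<bar>j\<bar> \<or> \<bar>j\<bar> + 1 < \<bar>i\<bar>"
  shows "fiedler_P n m As i * fiedler_P n m As j = fiedler_P n m As j * fiedler_P n m As i"
  unfolding fiedler_P_elem by (intro elem_mat_commute fiedler_coeff assms)

lemma ranges:
  "i \<in> set tw \<Longrightarrow> 0 \<le> i \<and> i \<le> int h - 2"
  "i \<in> set tv \<Longrightarrow> - int m \<le> i \<and> i \<le> - int h - 3"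
  "i \<in> set (w_tuple h) \<Longrightarrow> 0 \<le> i \<and> i \<le> int h"
  "i \<in> set (cw_tuple h) \<Longrightarrow> 0 \<le> i \<and> i < int h"
  "i \<in> set (v_tuple m h) \<Longrightarrow> - int m \<le> i \<and> i \<le> - int h - 1"
  "i \<in> set (cv_tuple m h) \<Longrightarrow> - int m \<le> i \<and> i \<le> - int h - 2"
proof -
  have k: "int (m - h - 1) = int m - int h - 1" using h by simp
  show "i \<in> set tw \<Longrightarrow> 0 \<le> i \<and> i \<le> int h - 2" using set_canonical_form[OF tw] by auto
  show "- int m \<le> i \<and> i \<le> - int h - 3" if "i \<in> set tv"
  proof -
    have "i + int m \<in> set (shift_tuple (int m) tv)" using that by (simp add: shift_tuple_def)
    thus ?thesis using set_canonical_form[OF tv] k by auto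
  qed
  show "i \<in> set (w_tuple h) \<Longrightarrow> 0 \<le> i \<and> i \<le> int h"
    using set_simple_admissible[of h] by (auto simp: w_tuple_def)
  show "i \<in> set (cw_tuple h) \<Longrightarrow> 0 \<le> i \<and> i < int h"
    using set_simple_complement[of h] by (auto simp: cw_tuple_def)
  show "i \<in> set (v_tuple m h) \<Longrightarrow> - int m \<le> i \<and> i \<le> - int h - 1"
    using set_simple_admissible[of "m - h - 1"] k by (auto simp: v_tuple_def shift_tuple_def)
  show "i \<in> set (cv_tuple m h) \<Longrightarrow> - int m \<le> i \<and> i \<le> - int h - 2"
    using set_simple_complement[of "m - h - 1"] k by (auto simp: cv_tuple_def shift_tuple_def)
qed

lemma valid_index:
  "i \<in> set tw \<union> set tv \<union> set (w_tuple h) \<union> set (cw_tuple h) \<union> set (v_tuple m h) \<union> set (cv_tuple m h)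
    \<Longrightarrow> - int m \<le> i \<and> i < int m"
  using ranges[of i] h by auto

text \<open>
  The names of the factors follow the tuples: the pencil is \<open>Q (\<lambda> V - W) C Q'\<close> with \<open>C = Cw Cv\<close>, and
  \<open>Q'\<close> will turn out to be the transpose of \<open>Q\<close>.
\<close>

definition Q where "Q = elem_prod n m (tv @ tw) (Ys @ Xs)"
definition Q' where "Q' = elem_prod n m (rev tw @ rev tv) (rev Xs @ rev Ys)"
definition V where "V = fiedler_P_prod n m As (v_tuple m h)"
definition W where "W = fiedler_P_prod n m As (w_tuple h)"
definition Cw where "Cw = fiedler_P_prod n m As (cw_tuple h)"
definition Cv where "Cv = fiedler_P_prod n m As (cv_tuple m h)"
definition C where "C = fiedler_P_prod n m As (cw_tuple h @ cv_tuple m h)"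

lemma fiedler_list:
  assumes "set ts \<subseteq> set tw \<union> set tv \<union> set (w_tuple h) \<union> set (cw_tuple h) \<union> set (v_tuple m h) \<union> set (cv_tuple m h)"
  shows "set (map (fiedler_P n m As) ts) \<subseteq> carrier_mat N N" "fiedler_P_prod n m As ts \<in> carrier_mat N N"
    "real_mat (fiedler_P_prod n m As ts)"
proof -
  show 1: "set (map (fiedler_P n m As) ts) \<subseteq> carrier_mat N N"
    using assms valid_index fiedler_P(1) by auto
  show "fiedler_P_prod n m As ts \<in> carrier_mat N N"
    unfolding fiedler_P_prod_def by (rule mat_prod_carrier[OF 1])
  show "real_mat (fiedler_P_prod n m As ts)"
    unfolding fiedler_P_prod_def using assms valid_index fiedler_P(1,3) by (intro real_mat_prod) auto
qed

lemma factor_properties: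
  "V \<in> carrier_mat N N" "W \<in> carrier_mat N N" "Cw \<in> carrier_mat N N" "Cv \<in> carrier_mat N N" "C \<in> carrier_mat N N"
  "real_mat V" "real_mat W" "real_mat C" "C = Cw * Cv"
proof -
  show "V \<in> carrier_mat N N" "W \<in> carrier_mat N N" "Cw \<in> carrier_mat N N" "Cv \<in> carrier_mat N N" "C \<in> carrier_mat N N"
    unfolding V_def W_def Cw_def Cv_def C_def by (intro fiedler_list; auto)+
  show "real_mat V" "real_mat W" "real_mat C"
    unfolding V_def W_def C_def by (intro fiedler_list; auto)+
  show "C = Cw * Cv" unfolding C_def Cw_def Cv_def fiedler_P_prod_def map_append
    by (rule mat_prod_append; rule fiedler_list; auto)
qed

lemma elem_list:
  "(i, X) \<in> set (zip (tv @ tw) (Ys @ Xs)) \<Longrightarrow> - int m \<le> i \<and> i < int m \<and> X \<in> carrier_mat n n \<and> transpose_mat X = X \<and> real_mat X"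
proof -
  assume iX: "(i, X) \<in> set (zip (tv @ tw) (Ys @ Xs))"
  hence "i \<in> set (tv @ tw)" "X \<in> set (Ys @ Xs)" using set_zip_leftD set_zip_rightD by metis+
  hence "i \<in> set tw \<union> set tv" "X \<in> set Xs \<union> set Ys" by auto
  thus ?thesis using valid_index[of i] Xs Ys by (auto simp: matrix_assignment_def symmetric_matrix_def)
qed

lemma Q_properties: "Q \<in> carrier_mat N N" "Q' = transpose_mat Q" "real_mat Q" "Q' \<in> carrier_mat N N"
proof -
  define Ms where "Ms = map2 (elem_mat n m) (tv @ tw) (Ys @ Xs)"
  have Ms: "M \<in> carrier_mat N N \<and> transpose_mat M = M \<and> real_mat M" if M: "M \<in> set Ms" for M
  proof -
    obtain p where p: "p \<in> set (zip (tv @ tw) (Ys @ Xs))" "M = (case p of (i, X) \<Rightarrow> elem_mat n m i X)"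
      using M unfolding Ms_def set_map by blast
    obtain i X where "p = (i, X)" by (cases p)
    with p have "(i, X) \<in> set (zip (tv @ tw) (Ys @ Xs))" "M = elem_mat n m i X" by simp_all
    thus ?thesis using elem_list[of i X] elem_mat_carrier[of m i X n] elem_mat_transpose[of m i X n] elem_mat_real[of m i X n]
      by auto
  qed
  hence car: "set Ms \<subseteq> carrier_mat N N" by auto
  have Q: "Q = mat_prod N Ms" by (simp add: Q_def elem_prod_def Ms_def)
  show Qc: "Q \<in> carrier_mat N N" unfolding Q by (rule mat_prod_carrier[OF car])
  show "real_mat Q" unfolding Q by (rule real_mat_prod) (use Ms in auto)
  have len: "length (tv @ tw) = length (Ys @ Xs)" using Xs Ys by (simp add: matrix_assignment_def)
  have "Q' = mat_prod N (map2 (elem_mat n m) (rev (tv @ tw)) (rev (Ys @ Xs)))"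
    by (simp add: Q'_def elem_prod_def)
  also have "map2 (elem_mat n m) (rev (tv @ tw)) (rev (Ys @ Xs)) = rev Ms"
    unfolding Ms_def by (subst zip_rev[OF len]) (simp only: rev_map)
  also have "Ms = map transpose_mat Ms" using Ms by (simp add: map_idI)
  also have "mat_prod N (rev (map transpose_mat Ms)) = transpose_mat Q"
    unfolding Q by (rule transpose_mat_prod[OF car, symmetric])
  finally show Q': "Q' = transpose_mat Q" .
  show "Q' \<in> carrier_mat N N" unfolding Q' using Qc by simp
qed

lemma fiedler_prods_commute:
  assumes s: "set ss \<subseteq> set tw \<union> set tv \<union> set (w_tuple h) \<union> set (cw_tuple h) \<union> set (v_tuple m h) \<union> set (cv_tuple m h)"
    "set ts \<subseteq> set tw \<union> set tv \<union> set (w_tuple h) \<union> set (cw_tuple h) \<union> set (v_tuple m h) \<union> set (cv_tuple m h)"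
    and far: "\<And>i j. i \<in> set ss \<Longrightarrow> j \<in> set ts \<Longrightarrow> \<bar>i\<bar> + 1 < \<bar>j\<bar>"
  shows "fiedler_P_prod n m As ss * fiedler_P_prod n m As ts = fiedler_P_prod n m As ts * fiedler_P_prod n m As ss"
  unfolding fiedler_P_prod_def
proof (rule mat_prod_commute2[OF fiedler_list(1)[OF s(1)] fiedler_list(1)[OF s(2)]])
  fix M M' assume "M \<in> set (map (fiedler_P n m As) ss)" "M' \<in> set (map (fiedler_P n m As) ts)"
  then obtain i j where ij: "i \<in> set ss" "j \<in> set ts" "M = fiedler_P n m As i" "M' = fiedler_P n m As j" by auto
  have "- int m \<le> i \<and> i < int m" "- int m \<le> j \<and> j < int m" using valid_index ij(1,2) s by blast+
  thus "M * M' = M' * M" unfolding ij(3,4) using far[OF ij(1,2)] by (intro fiedler_P_commute) auto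
qed

text \<open>
  In each case the absolute values of the indices in the two products differ by more than 1.
\<close>

lemma commutes: "Cw * Cv = Cv * Cw" "Cw * V = V * Cw" "W * Cv = Cv * W"
proof -
  show "Cw * Cv = Cv * Cw" unfolding Cw_def Cv_def
  proof (rule fiedler_prods_commute)
    fix i j assume "i \<in> set (cw_tuple h)" "j \<in> set (cv_tuple m h)"
    thus "\<bar>i\<bar> + 1 < \<bar>j\<bar>" using ranges(4)[of i] ranges(6)[of j] by linarith
  qed auto
  show "Cw * V = V * Cw" unfolding Cw_def V_def
  proof (rule fiedler_prods_commute)
    fix i j assume "i \<in> set (cw_tuple h)" "j \<in> set (v_tuple m h)"
    thus "\<bar>i\<bar> + 1 < \<bar>j\<bar>" using ranges(4)[of i] ranges(5)[of j] by linarith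
  qed auto
  show "W * Cv = Cv * W" unfolding W_def Cv_def
  proof (rule fiedler_prods_commute)
    fix i j assume "i \<in> set (w_tuple h)" "j \<in> set (cv_tuple m h)"
    thus "\<bar>i\<bar> + 1 < \<bar>j\<bar>" using ranges(3)[of i] ranges(6)[of j] by linarith
  qed auto
qed

lemma symmetric_parts:
  "transpose_mat Cw = Cw" "transpose_mat (W * Cw) = W * Cw" "transpose_mat Cv = Cv" "transpose_mat (V * Cv) = V * Cv"
proof -
  have "transpose_mat Cw = Cw \<and> transpose_mat (W * Cw) = W * Cw"
    unfolding Cw_def W_def fiedler_P_prod_def cw_tuple_def w_tuple_def
    by (rule palindromic_symmetric[where K = h]) (use h in \<open>auto intro!: fiedler_P fiedler_P_commute\<close>)
  thus "transpose_mat Cw = Cw" "transpose_mat (W * Cw) = W * Cw" by auto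
  have "transpose_mat Cv = Cv \<and> transpose_mat (V * Cv) = V * Cv"
    unfolding Cv_def V_def fiedler_P_prod_def cv_tuple_def v_tuple_def shift_tuple_def map_map
    by (rule palindromic_symmetric[where K = "m - h - 1"]) (use h in \<open>auto intro!: fiedler_P fiedler_P_commute\<close>)
  thus "transpose_mat Cv = Cv" "transpose_mat (V * Cv) = V * Cv" by auto
qed

text \<open>
  Both products arise from the symmetric products for one tuple by multiplication with a
  commuting symmetric factor: \<open>V C = Cw (V Cv)\<close> and \<open>W C = (W Cw) Cv\<close>.
\<close>

lemma core_symmetric: "transpose_mat (V * C) = V * C" "transpose_mat (W * C) = W * C" "transpose_mat C = C"
proof -
  note assoc = assoc_mult_mat[of _ N N _ N _ N] and mc = mult_carrier_mat[of _ N N _ N]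
  have "V * C = (Cw * V) * Cv" unfolding factor_properties(9) commutes(2) using factor_properties by (simp add: assoc)
  hence VC: "V * C = Cw * (V * Cv)" using factor_properties by (simp add: assoc)
  have "Cw * (V * Cv) = V * Cw * Cv"
    unfolding commutes(2)[symmetric] by (rule assoc_mult_mat[OF factor_properties(3,1,4), symmetric])
  also have "\<dots> = V * (Cv * Cw)" using factor_properties commutes(1) by (simp add: assoc)
  finally have cm: "Cw * (V * Cv) = (V * Cv) * Cw" using factor_properties by (simp add: assoc)
  show "transpose_mat (V * C) = V * C"
    unfolding VC by (rule symmetric_mult[OF factor_properties(3) mc[OF factor_properties(1,4)] symmetric_parts(1,4) cm])
  have WC: "W * C = (W * Cw) * Cv" unfolding factor_properties(9) using factor_properties by (simp add: assoc)
  have "(W * Cw) * Cv = W * (Cv * Cw)" using factor_properties commutes(1) by (simp add: assoc)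
  also have "\<dots> = Cv * W * Cw"
    unfolding commutes(3)[symmetric] by (rule assoc_mult_mat[OF factor_properties(2,4,3), symmetric])
  finally have cm: "(W * Cw) * Cv = Cv * (W * Cw)" using factor_properties by (simp add: assoc)
  show "transpose_mat (W * C) = W * C"
    unfolding WC by (rule symmetric_mult[OF mc[OF factor_properties(2,3)] factor_properties(4) symmetric_parts(2,3) cm])
  show "transpose_mat C = C"
    unfolding factor_properties(9) by (rule symmetric_mult[OF factor_properties(3,4) symmetric_parts(1,3) commutes(1)])
qed

definition LV where "LV = Q * (V * C) * Q'"
definition LW where "LW = Q * (W * C) * Q'"

lemma congruence_symmetric:
  assumes S: "S \<in> carrier_mat N N" "transpose_mat S = S"
  shows "transpose_mat (Q * S * Q') = Q * S * Q'"
proof -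
  have "transpose_mat (Q * S * Q') = transpose_mat Q' * transpose_mat (Q * S)"
    by (rule transpose_mult[of _ N N _ N]) (use S Q_properties in \<open>auto intro: mult_carrier_mat[of _ N N _ N]\<close>)
  also have "\<dots> = Q * (S * Q')"
    using S Q_properties by (simp add: transpose_mult[of _ N N _ N])
  also have "\<dots> = Q * S * Q'" using S Q_properties by (simp add: assoc_mult_mat[of _ N N _ N _ N])
  finally show ?thesis .
qed

lemma pencil_coefficients: "LV \<in> carrier_mat N N" "LW \<in> carrier_mat N N" "transpose_mat LV = LV" "transpose_mat LW = LW"
  "real_mat LV" "real_mat LW"
proof -
  note mc = mult_carrier_mat[of _ N N _ N]
  have VC: "V * C \<in> carrier_mat N N" "W * C \<in> carrier_mat N N" using factor_properties by (auto intro: mc)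
  show "LV \<in> carrier_mat N N" "LW \<in> carrier_mat N N" unfolding LV_def LW_def using VC Q_properties by (auto intro!: mc)
  show "transpose_mat LV = LV" "transpose_mat LW = LW"
    unfolding LV_def LW_def by (intro congruence_symmetric VC core_symmetric)+
  have rQ': "real_mat Q'" using Q_properties by (auto simp: real_mat_def)
  have "real_mat (V * C)" "real_mat (W * C)" using factor_properties by (auto intro!: real_mat_mult[of _ N N _ N])
  thus "real_mat LV" "real_mat LW"
    unfolding LV_def LW_def using VC Q_properties rQ' by (auto intro!: real_mat_mult[of _ N N _ N] mc)
qed

lemma L_P_eq: "L_P n m As h tw tv Xs Ys = pencil LV LW"
proof -
  note mc = mult_carrier_mat[of _ N N _ N]
  have "L_P n m As h tw tv Xs Ys = const_mat Q * pencil V W * const_mat C * const_mat Q'"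
    by (simp add: L_P_def Q_def V_def W_def C_def Q'_def)
  also have "\<dots> = pencil (Q * V * C * Q') (Q * W * C * Q')"
    using Q_properties factor_properties
    by (simp add: pencil_const_mult[of _ N N _ N] pencil_mult_const[of _ N N _ _ N] mc del: assoc_mult_mat)
  also have "\<dots> = pencil LV LW"
    unfolding LV_def LW_def using Q_properties factor_properties by (simp add: assoc_mult_mat[of _ N N _ N _ N] mc)
  finally show ?thesis .
qed

section \<open>Block form of the system pencil\<close>

definition col_B where "col_B j = block_col m j (transpose_mat B)"

lemma col_B_carrier: "col_B j \<in> carrier_mat N r"
  unfolding col_B_def using AEB by simp

lemma transpose_col_B: "transpose_mat (col_B j) = transpose_mat (e_col m (m - j)) \<otimes>\<^sub>K B"
proof -
  have "ja mod n < n" if "ja < m * n" for ja using that by (cases n) auto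
  thus ?thesis
    using AEB by (intro eq_matI) (auto simp: col_B_def block_col_def kronecker_def e_col_def
      less_mult_imp_div_less mult.commute)
qed

text \<open>
  The position that the block column \<open>e\<^sub>m \<otimes> B\<^sup>T\<close> reaches under \<open>W\<close> without its factor with index
  \<open>0\<close>, and also under \<open>C\<close>. The agreement of the two is the reason why the off-diagonal blocks of
  the pencil are transposes of each other.
\<close>

definition s0 where "s0 = (if h = 0 then 0 else 1 :: nat)"

lemma fiedler_far:
  assumes "set ts \<subseteq> set (cv_tuple m h)" shows "fiedler_P_prod n m As ts * col_B 0 = col_B 0"
proof -
  have "fiedler_P_prod n m As ts = mat_prod N (map (\<lambda>(i, X). elem_mat n m i X) (map (\<lambda>i. (i, fiedler_coeff As i)) ts))"
    unfolding fiedler_P_prod_def by (intro arg_cong[of _ _ "mat_prod N"]) (simp add: fiedler_P_elem)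
  also have "\<dots> * col_B 0 = col_B 0"
    unfolding col_B_def
  proof (rule far_product_block_col)
    fix i X assume "(i, X) \<in> set (map (\<lambda>i. (i, fiedler_coeff As i)) ts)"
    hence i: "i \<in> set (cv_tuple m h)" "X = fiedler_coeff As i" using assms by auto
    have "- int m \<le> i \<and> i < int m" using valid_index i by blast
    thus "- int m \<le> i \<and> i < int m \<and> int 0 + 1 < \<bar>i\<bar> \<and> X \<in> carrier_mat n n"
      using ranges(6)[OF i(1)] i fiedler_coeff(1) by auto
  qed (use h AEB in auto)
  finally show ?thesis .
qed

lemma fiedler_climb:
  assumes ts: "set ts \<subseteq> {0..int h}" "no_stall ts 0" "foldr climb ts 0 = (if h = 0 then 0 else 1)"
  shows "fiedler_P_prod n m As ts * col_B 0 = col_B s0"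
proof -
  have e: "fiedler_P_prod n m As ts = mat_prod N (map (\<lambda>(i, X). elem_mat n m i X) (map (\<lambda>i. (i, fiedler_coeff As i)) ts))"
    unfolding fiedler_P_prod_def by (intro arg_cong[of _ _ "mat_prod N"]) (simp add: fiedler_P_elem)
  have f: "map fst (map (\<lambda>i. (i, fiedler_coeff As i)) ts) = ts" by (simp add: o_def)
  have BT: "transpose_mat B \<in> carrier_mat n r" using AEB by simp
  have ns: "no_stall (map fst (map (\<lambda>i. (i, fiedler_coeff As i)) ts)) 0" unfolding f by (rule ts(2))
  have m0: "(0 :: int) < int m" using h by simp
  have "mat_prod N (map (\<lambda>(i, X). elem_mat n m i X) (map (\<lambda>i. (i, fiedler_coeff As i)) ts)) * block_col m (nat 0) (transpose_mat B)
     = block_col m (nat (foldr climb (map fst (map (\<lambda>i. (i, fiedler_coeff As i)) ts)) 0)) (transpose_mat B)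
       \<and> foldr climb (map fst (map (\<lambda>i. (i, fiedler_coeff As i)) ts)) 0 < int m"
  proof (rule elem_product_block_col[OF _ order.refl m0 ns BT])
    fix i X assume "(i, X) \<in> set (map (\<lambda>i. (i, fiedler_coeff As i)) ts)"
    hence i: "0 \<le> i" "i < int m" "X = fiedler_coeff As i" using ts(1) h by auto
    thus "0 \<le> i \<and> i < int m \<and> X \<in> carrier_mat n n" using fiedler_coeff(1)[of i] by auto
  qed
  thus ?thesis unfolding e f col_B_def using ts(3) by (auto simp: s0_def)
qed

lemma C_col: "C * col_B 0 = col_B s0"
proof -
  have "C * col_B 0 = Cw * (Cv * col_B 0)" unfolding factor_properties(9)
    using factor_properties col_B_carrier by (simp add: assoc_mult_mat[of _ N N _ N _ r])
  also have "Cv * col_B 0 = col_B 0" unfolding Cv_def by (rule fiedler_far) simp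
  also have "Cw * col_B 0 = col_B s0" unfolding Cw_def cw_tuple_def
    using climb_simple_complement[OF h(2)] set_simple_complement[of h] by (intro fiedler_climb) auto
  finally show ?thesis .
qed

definition \<alpha> where "\<alpha> = i_zero (tw @ w_tuple h)"

text \<open>
  The indices in \<open>tv\<close> are too far away to act. Those in \<open>tw\<close> continue the greedy search that \<open>w\<close>
  has begun, and it ends at \<open>\<alpha>\<close> by the definition of \<open>\<alpha>\<close>.
\<close>

lemma Q_col: "Q * col_B s0 = col_B \<alpha>"
proof -
  define s where "s = (if h = 0 then 0 else 1 :: int)"
  have s: "s = int s0" "nat s = s0" by (auto simp: s_def s0_def)
  obtain ps where ps: "w_tuple h = ps @ [0]" "foldr climb ps 0 = s"
    using simple_admissible_even[OF h(2)] by (auto simp: w_tuple_def s_def)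
  have "\<alpha> = nat (foldr climb (tw @ ps) 0)"
    unfolding \<alpha>_def ps(1) append_assoc[symmetric] by (rule i_zero_climb)
  hence al: "\<alpha> = nat (foldr climb tw s)" using ps by simp
  have cl: "no_stall tw s" "foldr climb tw s \<le> int h"
    using climb_canonical[OF tw h(2)] by (auto simp: s_def)
  have len: "length tv = length Ys" "length tw = length Xs" using Xs Ys by (auto simp: matrix_assignment_def)
  have zip: "zip (tv @ tw) (Ys @ Xs) = zip tv Ys @ zip tw Xs" using len by simp
  have car: "elem_mat n m i X \<in> carrier_mat N N" if "(i, X) \<in> set (zip tv Ys @ zip tw Xs)" for i X
    using elem_list[of i X] that unfolding zip by (intro elem_mat_carrier) auto
  have Q: "Q = mat_prod N (map (\<lambda>(i, X). elem_mat n m i X) (zip tv Ys)) * mat_prod N (map (\<lambda>(i, X). elem_mat n m i X) (zip tw Xs))"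
    unfolding Q_def elem_prod_def zip map_append using car by (intro mat_prod_append) auto
  have c1: "mat_prod N (map (\<lambda>(i, X). elem_mat n m i X) (zip tv Ys)) \<in> carrier_mat N N"
    and c2: "mat_prod N (map (\<lambda>(i, X). elem_mat n m i X) (zip tw Xs)) \<in> carrier_mat N N"
    using car by (auto intro!: mat_prod_carrier)
  have fst: "map fst (zip tw Xs) = tw" using len by simp
  have BT: "transpose_mat B \<in> carrier_mat n r" using AEB by simp
  have "mat_prod N (map (\<lambda>(i, X). elem_mat n m i X) (zip tw Xs)) * block_col m (nat s) (transpose_mat B)
     = block_col m (nat (foldr climb (map fst (zip tw Xs)) s)) (transpose_mat B) \<and> foldr climb (map fst (zip tw Xs)) s < int m"
  proof (rule elem_product_block_col[OF _ _ _ _ BT])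
    fix i X assume iX: "(i, X) \<in> set (zip tw Xs)"
    hence "i \<in> set tw" "X \<in> set Xs" using set_zip_leftD set_zip_rightD by metis+
    thus "0 \<le> i \<and> i < int m \<and> X \<in> carrier_mat n n"
      using ranges(1)[of i] h Xs(1) by (auto simp: matrix_assignment_def)
  qed (use s h cl fst in \<open>auto simp: s_def s0_def\<close>)
  hence tw_col: "mat_prod N (map (\<lambda>(i, X). elem_mat n m i X) (zip tw Xs)) * col_B s0 = col_B \<alpha>" and am: "\<alpha> < m"
    unfolding fst al col_B_def s(2) using foldr_climb_ge[of s tw] s by auto
  have "mat_prod N (map (\<lambda>(i, X). elem_mat n m i X) (zip tv Ys)) * col_B \<alpha> = col_B \<alpha>"
    unfolding col_B_def
  proof (rule far_product_block_col[OF _ am BT])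
    fix i X assume iX: "(i, X) \<in> set (zip tv Ys)"
    hence "i \<in> set tv" "X \<in> set Ys" using set_zip_leftD set_zip_rightD by metis+
    thus "- int m \<le> i \<and> i < int m \<and> int \<alpha> + 1 < \<bar>i\<bar> \<and> X \<in> carrier_mat n n"
      using ranges(2)[of i] h Ys(1) cl(2) al by (auto simp: matrix_assignment_def)
  qed
  thus ?thesis unfolding Q using c1 c2 col_B_carrier tw_col by (simp add: assoc_mult_mat[of _ N N _ N _ r])
qed

lemma alpha_less: "\<alpha> < m"
proof -
  define s where "s = (if h = 0 then 0 else 1 :: int)"
  obtain ps where ps: "w_tuple h = ps @ [0]" "foldr climb ps 0 = s"
    using simple_admissible_even[OF h(2)] by (auto simp: w_tuple_def s_def)
  have "\<alpha> = nat (foldr climb (tw @ ps) 0)"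
    unfolding \<alpha>_def ps(1) append_assoc[symmetric] by (rule i_zero_climb)
  hence "\<alpha> = nat (foldr climb tw s)" using ps(2) by simp
  moreover have "foldr climb tw s \<le> int h" using climb_canonical[OF tw h(2)] by (simp add: s_def)
  ultimately show ?thesis using h by linarith
qed

lemma V_ext: "fiedler_S_prod n m r As A E B (v_tuple m h) = diag_block_mat [V, - E]"
proof -
  define g where "g i = (if i = - int m then - E else 1\<^sub>m r)" for i
  have gc: "g i \<in> carrier_mat r r" for i using AEB by (simp add: g_def)
  have f: "fiedler_S n m r As A E B i = diag_block_mat [fiedler_P n m As i, g i]" if i: "i \<in> set (v_tuple m h)" for i
  proof (cases "i = - int m")
    case True
    thus ?thesis using h by (simp add: fiedler_S_def g_def del: diag_block_mat.simps)
  next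
    case False
    define k where "k = - i"
    have k: "0 < k" "k < int m" "i = - k" using ranges(5)[OF i] False by (auto simp: k_def)
    have v1: "- int m \<le> k" "k < int m" "- int m \<le> - k" "- k < int m" using k by auto
    have Ak: "As (nat k) \<in> carrier_mat n n" using As(1) k by simp
    have P: "fiedler_P n m As k = elem_mat n m k (- As (nat k))" "fiedler_P n m As (- k) = elem_mat n m (- k) (As (nat k))"
      using k by (simp_all add: fiedler_P_def)
    have inv: "fiedler_P n m As k * fiedler_P n m As (- k) = 1\<^sub>m N"
      unfolding P by (rule elem_mat_inverse[OF k(1,2) Ak])
    have c: "fiedler_P n m As k \<in> carrier_mat N N" "fiedler_P n m As (- k) \<in> carrier_mat N N" using fiedler_P(1) v1 by auto
    have "mat_inv (extend_mat r (fiedler_P n m As k)) = extend_mat r (fiedler_P n m As (- k))"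
      unfolding extend_mat_def
    proof (rule mat_inv_eqI[OF dsum_carrier dsum_carrier])
      show "diag_block_mat [fiedler_P n m As k, 1\<^sub>m r] * diag_block_mat [fiedler_P n m As (- k), 1\<^sub>m r] = 1\<^sub>m (N + r)"
        unfolding dsum_mult[OF c(1) one_carrier_mat c(2) one_carrier_mat] inv
        using dsum_one[of N r] by (simp only: left_mult_one_mat[OF one_carrier_mat])
    qed (use c in auto)
    thus ?thesis using k False by (simp add: fiedler_S_def g_def extend_mat_def del: diag_block_mat.simps)
  qed
  have "fiedler_S_prod n m r As A E B (v_tuple m h) = mat_prod (N + r) (map (\<lambda>i. diag_block_mat [fiedler_P n m As i, g i]) (v_tuple m h))"
    unfolding fiedler_S_prod_def using f by (intro arg_cong[of _ _ "mat_prod (N + r)"] map_cong) auto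
  also have "\<dots> = diag_block_mat [mat_prod N (map (fiedler_P n m As) (v_tuple m h)), mat_prod r (map g (v_tuple m h))]"
    using gc fiedler_P(1) valid_index by (intro mat_prod_dsum) auto
  also have "map g (v_tuple m h) = map (\<lambda>j. if j = 0 then - E else 1\<^sub>m r) (simple_admissible (m - h - 1))"
    by (auto simp: v_tuple_def shift_tuple_def g_def)
  also have "mat_prod r \<dots> = - E" using AEB by (intro mat_prod_marked) simp
  finally show ?thesis by (simp only: V_def fiedler_P_prod_def)
qed

text \<open>
  For even \<open>h\<close> the index \<open>0\<close> stands at the right end of the tuple, so all other factors act from the
  left and leave the lower blocks alone.
\<close>

lemma W_ext: "fiedler_S_prod n m r As A E B (w_tuple h) =
   four_block_mat W (- col_B s0) (- transpose_mat (col_B 0)) (- A)"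
proof -
  obtain ps where ps: "w_tuple h = ps @ [0]" "set ps \<subseteq> {1..int h}" "no_stall ps 0"
     "foldr climb ps 0 = (if h = 0 then 0 else 1)"
    using simple_admissible_even[OF h(2)] by (auto simp: w_tuple_def)
  define W' where "W' = fiedler_P_prod n m As ps"
  have psv: "set ps \<subseteq> set (w_tuple h)" using ps(1) by auto
  have W'c: "W' \<in> carrier_mat N N" unfolding W'_def by (rule fiedler_list) (use psv in auto)
  have W'col: "W' * col_B 0 = col_B s0" unfolding W'_def by (rule fiedler_climb) (use ps in auto)
  have P0: "fiedler_P n m As 0 \<in> carrier_mat N N" using fiedler_P(1)[of 0] h by auto
  have pc: "M \<in> carrier_mat N N" if "M \<in> set (map (fiedler_P n m As) ps)" for M
    using that fiedler_list(1)[of ps] psv by auto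
  have W: "W = W' * fiedler_P n m As 0"
    unfolding W_def W'_def fiedler_P_prod_def ps(1) map_append
    using P0 pc by (subst mat_prod_append) (auto simp: right_mult_one_mat[of _ N N])
  have S0: "fiedler_S n m r As A E B 0 = four_block_mat (fiedler_P n m As 0) (- col_B 0) (- transpose_mat (col_B 0)) (- A)"
    unfolding transpose_col_B by (simp add: fiedler_S_def col_B_def block_col_def)
  have S0c: "fiedler_S n m r As A E B 0 \<in> carrier_mat (N + r) (N + r)"
    unfolding S0 using P0 AEB by auto
  have pos: "fiedler_S n m r As A E B i = extend_mat r (fiedler_P n m As i)" if "i \<in> set ps" for i
    using that ps(2) by (auto simp: fiedler_S_def)
  have mp: "map (fiedler_S n m r As A E B) ps = map (extend_mat r) (map (fiedler_P n m As) ps)"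
    using pos by simp
  have ec: "set (map (fiedler_S n m r As A E B) ps) \<subseteq> carrier_mat (N + r) (N + r)"
    unfolding mp extend_mat_def using pc by (auto intro!: dsum_carrier simp del: diag_block_mat.simps)
  have "fiedler_S_prod n m r As A E B (w_tuple h) =
      mat_prod (N + r) (map (fiedler_S n m r As A E B) ps) * fiedler_S n m r As A E B 0"
    unfolding fiedler_S_prod_def ps(1) map_append
    using ec S0c by (subst mat_prod_append) (auto simp: right_mult_one_mat[of _ "N + r" "N + r"])
  also have "mat_prod (N + r) (map (fiedler_S n m r As A E B) ps) = extend_mat r W'"
    unfolding mp W'_def fiedler_P_prod_def by (rule mat_prod_extend[OF pc])
  also have "extend_mat r W' * fiedler_S n m r As A E B 0 =
     four_block_mat (W' * fiedler_P n m As 0) (W' * (- col_B 0)) (- transpose_mat (col_B 0)) (- A)"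
    unfolding S0 by (rule extend_mat_mult_left) (use W'c P0 col_B_carrier AEB in auto)
  also have "W' * (- col_B 0) = - col_B s0"
    using W'c col_B_carrier[of 0] W'col by (simp add: uminus_mult_right_mat)
  finally show ?thesis unfolding W .
qed

lemma L_S_eq: "L_S n m r As A E B h tw tv Xs Ys =
   four_block_mat (pencil LV LW) (const_mat (col_B \<alpha>)) (const_mat (transpose_mat (col_B \<alpha>))) (- pencil E A)"
proof -
  define eQ eC eQ' where "eQ = extend_mat r Q" and "eC = extend_mat r C" and "eQ' = extend_mat r Q'"
  have ext: "ext_elem_prod n m r ts Zs = extend_mat r (elem_prod n m ts Zs)"
    if "\<And>i X. (i, X) \<in> set (zip ts Zs) \<Longrightarrow> elem_mat n m i X \<in> carrier_mat N N" for ts Zs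
  proof -
    have e: "map2 (\<lambda>i X. extend_mat r (elem_mat n m i X)) ts Zs = map (extend_mat r) (map2 (elem_mat n m) ts Zs)"
      by (simp add: case_prod_unfold)
    show ?thesis unfolding ext_elem_prod_def elem_prod_def e by (rule mat_prod_extend) (use that in auto)
  qed
  have len: "length (tv @ tw) = length (Ys @ Xs)" using Xs Ys by (simp add: matrix_assignment_def)
  have e1: "ext_elem_prod n m r (tv @ tw) (Ys @ Xs) = eQ"
    unfolding eQ_def Q_def using elem_list by (intro ext elem_mat_carrier) auto
  have e2: "ext_elem_prod n m r (rev tw @ rev tv) (rev Xs @ rev Ys) = eQ'"
    unfolding eQ'_def Q'_def
  proof (rule ext)
    fix i X assume "(i, X) \<in> set (zip (rev tw @ rev tv) (rev Xs @ rev Ys))"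
    also have "zip (rev tw @ rev tv) (rev Xs @ rev Ys) = rev (zip (tv @ tw) (Ys @ Xs))"
      using zip_rev[OF len] by simp
    finally show "elem_mat n m i X \<in> carrier_mat N N" using elem_list[of i X] by (intro elem_mat_carrier) auto
  qed
  have e3: "ext_fiedler_P_prod n m r As (cw_tuple h @ cv_tuple m h) = eC"
  proof -
    have "map (\<lambda>i. extend_mat r (fiedler_P n m As i)) (cw_tuple h @ cv_tuple m h) =
       map (extend_mat r) (map (fiedler_P n m As) (cw_tuple h @ cv_tuple m h))" by simp
    thus ?thesis unfolding ext_fiedler_P_prod_def eC_def C_def fiedler_P_prod_def
      using fiedler_list(1)[of "cw_tuple h @ cv_tuple m h"] by (simp only:, intro mat_prod_extend) auto
  qed
  define b1 b2 where "b1 = diag_block_mat [V, - E]"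
    and "b2 = four_block_mat W (- col_B s0) (- transpose_mat (col_B 0)) (- A)"
  have Ec: "- E \<in> carrier_mat r r" "- A \<in> carrier_mat r r" using AEB by auto
  have cB: "- col_B s0 \<in> carrier_mat N r" "- transpose_mat (col_B 0) \<in> carrier_mat r N"
    using col_B_carrier by auto
  have car: "eQ \<in> carrier_mat (N + r) (N + r)" "eC \<in> carrier_mat (N + r) (N + r)" "eQ' \<in> carrier_mat (N + r) (N + r)"
    "b1 \<in> carrier_mat (N + r) (N + r)" "b2 \<in> carrier_mat (N + r) (N + r)"
    unfolding eQ_def eC_def eQ'_def b1_def b2_def extend_mat_def
    by (rule dsum_carrier Q_properties factor_properties Ec one_carrier_mat four_block_carrier_mat)+
  note mc = mult_carrier_mat[of _ "N + r" "N + r" _ "N + r"] and assoc = assoc_mult_mat[of _ "N + r" "N + r" _ "N + r" _ "N + r"]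
  have "L_S n m r As A E B h tw tv Xs Ys = const_mat eQ * pencil b1 b2 * const_mat eC * const_mat eQ'"
    unfolding L_S_def e1 e2 e3 V_ext W_ext b1_def b2_def ..
  also have "\<dots> = pencil (eQ * b1 * eC * eQ') (eQ * b2 * eC * eQ')"
    using car
    by (simp add: pencil_const_mult[of _ "N + r" "N + r" _ "N + r"] pencil_mult_const[of _ "N + r" "N + r" _ _ "N + r"] mc del: assoc_mult_mat)
  also have "eQ * b1 * eC * eQ' = diag_block_mat [LV, - E]"
  proof -
    have "eQ * b1 * eC * eQ' = diag_block_mat [Q * V * C * Q', 1\<^sub>m r * (- E) * 1\<^sub>m r * 1\<^sub>m r]"
      unfolding eQ_def b1_def eC_def eQ'_def extend_mat_def
      using Q_properties factor_properties Ec by (simp add: dsum_mult[of _ N _ r] mult_carrier_mat[of _ N N _ N] del: diag_block_mat.simps assoc_mult_mat)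
    moreover have "1\<^sub>m r * (- E) * 1\<^sub>m r * 1\<^sub>m r = - E" using Ec by simp
    moreover have "Q * V * C * Q' = LV"
      unfolding LV_def using Q_properties factor_properties by (simp add: assoc_mult_mat[of _ N N _ N _ N] mult_carrier_mat[of _ N N _ N])
    ultimately show ?thesis by (simp only:)
  qed
  also have "eQ * b2 * eC * eQ' = four_block_mat LW (- col_B \<alpha>) (- transpose_mat (col_B \<alpha>)) (- A)"
  proof -
    define R where "R = C * Q'"
    have R: "R \<in> carrier_mat N N" unfolding R_def using factor_properties Q_properties by (auto intro: mult_carrier_mat)
    have RT: "transpose_mat R * col_B 0 = col_B \<alpha>"
    proof -
      have "transpose_mat R = transpose_mat Q' * transpose_mat C"
        unfolding R_def by (rule transpose_mult[OF factor_properties(5) Q_properties(4)])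
      also have "\<dots> = Q * C" using Q_properties(2) core_symmetric(3) by simp
      finally show ?thesis using Q_properties factor_properties col_B_carrier C_col Q_col
        by (simp add: assoc_mult_mat[of _ N N _ N _ r])
    qed
    have row: "transpose_mat (col_B 0) * R = transpose_mat (col_B \<alpha>)"
      unfolding RT[symmetric] using R col_B_carrier[of 0] by (simp add: transpose_mult[of _ N N _ r])
    have eCQ: "eC * eQ' = extend_mat r R"
      unfolding eC_def eQ'_def extend_mat_def dsum_mult[OF factor_properties(5) one_carrier_mat Q_properties(4) one_carrier_mat] R_def[symmetric]
      by simp
    have "eQ * b2 = four_block_mat (Q * W) (Q * (- col_B s0)) (- transpose_mat (col_B 0)) (- A)"
      unfolding eQ_def b2_def by (rule extend_mat_mult_left[OF Q_properties(1) factor_properties(2) cB Ec(2)])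
    also have "Q * (- col_B s0) = - col_B \<alpha>"
      using Q_properties(1) col_B_carrier[of s0] Q_col by (simp add: uminus_mult_right_mat)
    finally have eb: "eQ * b2 = four_block_mat (Q * W) (- col_B \<alpha>) (- transpose_mat (col_B 0)) (- A)" .
    have "eQ * b2 * eC * eQ' = (eQ * b2) * (eC * eQ')" using car by (simp add: assoc mc)
    also have "\<dots> = four_block_mat ((Q * W) * R) (- col_B \<alpha>) ((- transpose_mat (col_B 0)) * R) (- A)"
      unfolding eb eCQ
      by (rule extend_mat_mult_right) (use R Q_properties factor_properties cB col_B_carrier Ec in \<open>auto intro: mult_carrier_mat\<close>)
    also have "(Q * W) * R = LW"
      unfolding LW_def R_def using Q_properties factor_properties by (simp add: assoc_mult_mat[of _ N N _ N _ N] mult_carrier_mat[of _ N N _ N])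
    also have "(- transpose_mat (col_B 0)) * R = - transpose_mat (col_B \<alpha>)"
      using R col_B_carrier[of 0] row by (simp add: uminus_mult_left_mat)
    finally show ?thesis .
  qed
  also have "pencil (diag_block_mat [LV, - E]) (four_block_mat LW (- col_B \<alpha>) (- transpose_mat (col_B \<alpha>)) (- A)) =
     four_block_mat (pencil LV LW) (const_mat (col_B \<alpha>)) (const_mat (transpose_mat (col_B \<alpha>))) (- pencil E A)"
    using pencil_coefficients(1,2) AEB col_B_carrier[of \<alpha>] unfolding dsum_eq
    by (intro eq_matI) (auto simp: pencil_def const_mat_def)
  finally show ?thesis .
qed

lemma transfer_function_L_S:
  "transfer_function N (L_S n m r As A E B h tw tv Xs Ys) = rat_mat (pencil LV LW)
     + rat_mat (const_mat (col_B \<alpha>)) * mat_inv (rat_mat (pencil E A)) * rat_mat (const_mat (transpose_mat (col_B \<alpha>)))"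
proof -
  define X where "X = four_block_mat (pencil LV LW) (const_mat (col_B \<alpha>)) (const_mat (transpose_mat (col_B \<alpha>))) (- pencil E A)"
  have c: "pencil LV LW \<in> carrier_mat N N" "const_mat (col_B \<alpha>) \<in> carrier_mat N r"
    "const_mat (transpose_mat (col_B \<alpha>)) \<in> carrier_mat r N" "- pencil E A \<in> carrier_mat r r" "pencil E A \<in> carrier_mat r r"
    using pencil_coefficients(1,2) col_B_carrier[of \<alpha>] AEB by auto
  have "split_block X N N = (pencil LV LW, const_mat (col_B \<alpha>), const_mat (transpose_mat (col_B \<alpha>)), - pencil E A)"
    unfolding split_block_def X_def using c by (auto simp: Let_def intro!: eq_matI)
  moreover have "- (- pencil E A) = pencil E A" using c by (intro eq_matI) auto
  ultimately show ?thesis unfolding L_S_eq X_def[symmetric] transfer_function_def by simp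
qed

end

section \<open>The transfer function and its index\<close>

lemma block_col_factor:
  assumes Z: "Z \<in> carrier_mat n r"
  shows "block_col m j (1\<^sub>m n) * Z = block_col m j Z"
proof (rule eq_matI)
  fix a c assume "a < dim_row (block_col m j Z)" "c < dim_col (block_col m j Z)"
  hence ac: "a < m * n" "c < r" using carrier_matD[OF block_col_carrier[OF Z, of m j]] by auto
  have J: "block_col m j (1\<^sub>m n) \<in> carrier_mat (m * n) n" by (rule block_col_carrier) simp
  have an: "a mod n < n" using ac(1) by (cases n) auto
  have "(block_col m j (1\<^sub>m n) * Z) $$ (a,c) = (\<Sum>k<n. block_col m j (1\<^sub>m n) $$ (a,k) * Z $$ (k,c))"
    using carrier_matD[OF J] carrier_matD[OF Z] ac by (simp add: scalar_prod_def atLeast0LessThan)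
  also have "\<dots> = (\<Sum>k<n. if k = a mod n then (if Suc (a div n) = m - j then Z $$ (k,c) else 0) else 0)"
    using block_col_index[OF one_carrier_mat ac(1), of _ j] an by (intro sum.cong) auto
  also have "\<dots> = block_col m j Z $$ (a,c)"
    using block_col_index[OF Z ac, of j] an by simp
  finally show "(block_col m j (1\<^sub>m n) * Z) $$ (a,c) = block_col m j Z $$ (a,c)" .
qed (use carrier_matD[OF block_col_carrier[OF Z, of m j]] carrier_matD[OF block_col_carrier[OF one_carrier_mat, where m = m and n = n and j = j]] Z in auto)

lemma block_col_one_isometry:
  fixes m n j :: nat
  assumes j: "j < m"
  defines "J \<equiv> block_col m j (1\<^sub>m n)"
  shows "J \<in> carrier_mat (m * n) n" "adjoint_mat J = transpose_mat J" "adjoint_mat J * J = 1\<^sub>m n" "real_mat J"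
proof -
  show J: "J \<in> carrier_mat (m * n) n" unfolding J_def by (rule block_col_carrier) simp
  have ent: "J $$ (a,k) = (if a = (m - j - 1) * n + k then 1 else 0)" if ak: "a < m * n" "k < n" for a k
  proof -
    have an: "a mod n < n" using ak(2) by simp
    have "(Suc (a div n) = m - j \<and> a mod n = k) \<longleftrightarrow> a = (m - j - 1) * n + k"
    proof
      assume *: "Suc (a div n) = m - j \<and> a mod n = k"
      hence "a div n = m - j - 1" by auto
      thus "a = (m - j - 1) * n + k" using * div_mult_mod_eq[of a n] by simp
    next
      assume "a = (m - j - 1) * n + k"
      thus "Suc (a div n) = m - j \<and> a mod n = k" using ak(2) j by simp
    qed
    thus ?thesis unfolding J_def using block_col_index[OF one_carrier_mat ak, of j] an ak(2) by auto
  qed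
  show "real_mat J" using ent J by (auto simp: real_mat_def)
  show adj: "adjoint_mat J = transpose_mat J"
    using ent J by (intro eq_matI) (auto simp: adjoint_mat_def)
  show "adjoint_mat J * J = 1\<^sub>m n" unfolding adj
  proof (rule eq_matI)
    fix i k assume "i < dim_row (1\<^sub>m n :: complex mat)" "k < dim_col (1\<^sub>m n :: complex mat)"
    hence ik: "i < n" "k < n" by auto
    have "m = Suc (m - j - 1) + j" using j by simp
    hence "m * n = Suc (m - j - 1) * n + j * n" by (metis add_mult_distrib)
    hence lt: "(m - j - 1) * n + i < m * n" using ik by simp
    have "(transpose_mat J * J) $$ (i,k) = (\<Sum>a<m*n. J $$ (a,i) * J $$ (a,k))"
      using J ik by (auto simp: scalar_prod_def atLeast0LessThan)
    also have "\<dots> = (\<Sum>a<m*n. if a = (m - j - 1) * n + i then (if i = k then 1 else 0) else 0)"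
      using ent ik by (intro sum.cong) auto
    also have "\<dots> = (if i = k then 1 else 0)" using lt by simp
    finally show "(transpose_mat J * J) $$ (i,k) = 1\<^sub>m n $$ (i,k)" using ik by simp
  qed (use J in auto)
qed

lemma transpose_pencil:
  assumes "X \<in> carrier_mat k k" "Y \<in> carrier_mat k k" "transpose_mat X = X" "transpose_mat Y = Y"
  shows "transpose_mat (pencil X Y) = pencil X Y"
proof (rule eq_matI)
  have c: "pencil X Y \<in> carrier_mat k k" using assms by simp
  fix i j assume "i < dim_row (pencil X Y)" "j < dim_col (pencil X Y)"
  hence ij: "i < k" "j < k" using c by auto
  have "X $$ (j,i) = X $$ (i,j)" "Y $$ (j,i) = Y $$ (i,j)"
    using ij assms by (metis carrier_matD index_transpose_mat(1))+
  thus "transpose_mat (pencil X Y) $$ (i,j) = pencil X Y $$ (i,j)"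
    using ij c by (simp add: pencil_index[OF assms(1,2)])
qed (use pencil_carrier[OF assms(1,2)] in auto)

lemma coeff_matrix_poly:
  assumes "i < n" "j < n" "k \<le> m"
  shows "coeff (matrix_poly n m As $$ (i,j)) k = As k $$ (i,j)"
  using assms by (simp add: matrix_poly_def coeff_sum)

theorem theorem4p12:
  fixes n m r h \<alpha> :: nat
    and G GG :: "complex poly fract mat"
    and P L LL :: "complex poly mat"
    and As :: "nat \<Rightarrow> complex mat"
    and A E B :: "complex mat"
    and tw tv :: "int list"
    and Xs Ys :: "complex mat list"
  assumes G: "G \<in> carrier_mat n n" "real_rational_mat G" "symmetric_matrix G"
    and As: "\<And>i. i \<le> m \<Longrightarrow> As i \<in> carrier_mat n n" "As m \<noteq> 0\<^sub>m n n"
    and P: "P = matrix_poly n m As"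
    and realization: "is_minimal_realization n r G P A E B (transpose_mat B)"
    and symmetric: "symmetric_matrix A" "symmetric_matrix E"
    and h: "h < m" "even h"
    and Am: "even m \<Longrightarrow> invertible_mat (As m)"
    and tw: "canonical_form h tw"
    and tv: "canonical_form (m - h - 1) (shift_tuple (int m) tv)"
    and Xs: "nonsingular_assignment n m tw Xs"
      "\<And>X. X \<in> set Xs \<Longrightarrow> real_mat X \<and> symmetric_matrix X"
    and Ys: "nonsingular_assignment n m tv Ys"
      "\<And>Y. Y \<in> set Ys \<Longrightarrow> real_mat Y \<and> symmetric_matrix Y"
    and L: "L = L_P n m As h tw tv Xs Ys"
    and LL: "LL = L_S n m r As A E B h tw tv Xs Ys"
    and \<alpha>: "\<alpha> = i_zero (tw @ w_tuple h)"
    and GG: "GG = transfer_function (m * n) LL"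
  shows "GG = rat_mat L
            + rat_mat (const_mat (e_col m (m - \<alpha>) \<otimes>\<^sub>K transpose_mat B))
              * mat_inv (rat_mat (pencil E A))
              * rat_mat (const_mat (transpose_mat (e_col m (m - \<alpha>)) \<otimes>\<^sub>K B))
       \<and> real_rational_mat GG \<and> symmetric_matrix GG
       \<and> Ind_CM G = Ind_CM GG"
proof -
  have Pc: "P \<in> carrier_mat n n" and Ac: "A \<in> carrier_mat r r" and Ec: "E \<in> carrier_mat r r" and Einv: "invertible_mat E"
    and Bc: "B \<in> carrier_mat r n"
    and Geq: "G = rat_mat P + rat_mat (const_mat (transpose_mat B)) * mat_inv (rat_mat (pencil E A)) * rat_mat (const_mat B)"
    using realization unfolding is_minimal_realization_def is_realization_def by auto
  define R where "R = mat_inv (rat_mat (pencil E A))"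
  define S where "S = proper_part E A B"
  note ctx = Ec Einv Ac Bc symmetric(2,1)
  have Rc: "R \<in> carrier_mat r r" unfolding R_def by (rule pencil_inverse(2)[OF ctx])
  have Sc: "S \<in> carrier_mat n n" unfolding S_def by (rule proper_part_carrier[OF ctx])
  have ST: "transpose_mat S = S" unfolding S_def by (rule proper_part_symmetric[OF ctx])
  have S_eq: "S = rat_mat (const_mat (transpose_mat B)) * R * rat_mat (const_mat B)"
    unfolding S_def R_def proper_part_def[OF ctx] ..
  have GS: "G = rat_mat P + proper_part E A B" unfolding Geq proper_part_def[OF ctx] ..
  note parts = realization_parts[OF ctx G(2,3) Pc GS]
  have Asym: "transpose_mat (As k) = As k" and Areal: "real_mat (As k)" if k: "k \<le> m" for k
  proof -
    note Ak = As(1)[OF k]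
    show "transpose_mat (As k) = As k"
    proof (rule eq_matI)
      fix i j assume "i < dim_row (As k)" "j < dim_col (As k)"
      hence ij: "i < n" "j < n" using Ak by auto
      have "P $$ (j,i) = P $$ (i,j)"
        using arg_cong[OF parts(3), of "\<lambda>M. M $$ (i,j)"] ij Pc by simp
      thus "transpose_mat (As k) $$ (i,j) = As k $$ (i,j)"
        using coeff_matrix_poly[of i n j k m As] coeff_matrix_poly[of j n i k m As] ij k Ak unfolding P by simp
    qed (use Ak in auto)
    show "real_mat (As k)"
      using parts(2) coeff_matrix_poly[of _ n _ k m As] k Ak unfolding P real_mat_def real_coeffs_def by (metis carrier_matD)
  qed
  interpret D: symmetric_pencil_data n m r h As A E B tw tv Xs Ys
    by unfold_locales (use As Asym Areal Ac Ec Bc h tw tv Xs Ys in \<open>auto simp: nonsingular_assignment_def\<close>)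
  have al: "\<alpha> = D.\<alpha>" unfolding \<alpha> D.\<alpha>_def ..
  have am: "\<alpha> < m" using D.alpha_less al by simp
  have Leq: "L = pencil D.LV D.LW" unfolding L by (rule D.L_P_eq)
  have Lc: "L \<in> carrier_mat (m * n) (m * n)" unfolding Leq using D.pencil_coefficients by simp
  have LT: "transpose_mat L = L" unfolding Leq by (rule transpose_pencil[OF D.pencil_coefficients(1-4)])
  have Lreal: "real_rational_mat (rat_mat L)" unfolding Leq by (rule real_rational_pencil[OF D.pencil_coefficients(1,2,5,6)])
  have GG1: "GG = rat_mat L + rat_mat (const_mat (D.col_B \<alpha>)) * R * rat_mat (const_mat (transpose_mat (D.col_B \<alpha>)))"
    unfolding GG LL Leq al R_def by (rule D.transfer_function_L_S)
  define J where "J = block_col m \<alpha> (1\<^sub>m n)"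
  have J: "J \<in> carrier_mat (m * n) n" "adjoint_mat J = transpose_mat J" "adjoint_mat J * J = 1\<^sub>m n" "real_mat J"
    unfolding J_def by (rule block_col_one_isometry[OF am])+
  have BT: "transpose_mat B \<in> carrier_mat n r" using Bc by simp
  have col: "D.col_B \<alpha> = J * transpose_mat B"
    unfolding D.col_B_def J_def by (rule block_col_factor[OF BT, symmetric])
  have colT: "transpose_mat (D.col_B \<alpha>) = B * adjoint_mat J"
    unfolding col J(2) using transpose_mult[OF J(1) BT] by simp
  define jm where "jm = rat_mat (const_mat J)"
  define jt where "jt = rat_mat (const_mat (adjoint_mat J))"
  define b where "b = rat_mat (const_mat B)"
  define bt where "bt = rat_mat (const_mat (transpose_mat B))"
  have aJ: "adjoint_mat J \<in> carrier_mat n (m * n)" using J(1) by simp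
  have c: "jm \<in> carrier_mat (m * n) n" "jt \<in> carrier_mat n (m * n)" "b \<in> carrier_mat r n" "bt \<in> carrier_mat n r"
    using J(1) aJ Bc unfolding jm_def jt_def b_def bt_def by auto
  have e1: "rat_mat (const_mat (D.col_B \<alpha>)) = jm * bt"
    unfolding col jm_def bt_def const_mat_mult[OF J(1) BT]
    by (rule rat_mat_mult[OF const_mat_carrier[OF J(1)] const_mat_carrier[OF BT]])
  have e2: "rat_mat (const_mat (transpose_mat (D.col_B \<alpha>))) = b * jt"
    unfolding colT jt_def b_def const_mat_mult[OF Bc aJ]
    by (rule rat_mat_mult[OF const_mat_carrier[OF Bc] const_mat_carrier[OF aJ]])
  have JSJ: "jm * bt * R * (b * jt) = jm * S * jt"
  proof -
    have btR: "bt * R \<in> carrier_mat n r" and bj: "b * jt \<in> carrier_mat r (m * n)"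
      using c Rc by (auto intro: mult_carrier_mat)
    have "jm * bt * R * (b * jt) = jm * (bt * R) * (b * jt)"
      using assoc_mult_mat[OF c(1,4) Rc] by simp
    also have "\<dots> = jm * (bt * R * (b * jt))" by (rule assoc_mult_mat[OF c(1) btR bj])
    also have "bt * R * (b * jt) = S * jt"
      unfolding S_eq b_def[symmetric] bt_def[symmetric] by (rule assoc_mult_mat[OF btR c(3,2), symmetric])
    also have "jm * (S * jt) = jm * S * jt" by (rule assoc_mult_mat[OF c(1) Sc c(2), symmetric])
    finally show ?thesis .
  qed
  have GG2: "GG = rat_mat L + jm * S * jt" unfolding GG1 e1 e2 JSJ ..
  have jS: "jm * S \<in> carrier_mat (m * n) n" using c Sc by (auto intro: mult_carrier_mat)
  have jSj: "jm * S * jt \<in> carrier_mat (m * n) (m * n)" by (rule mult_carrier_mat[OF jS c(2)])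
  have GGc: "GG \<in> carrier_mat (m * n) (m * n)" unfolding GG2 using Lc jSj by simp
  have rj: "real_rational_mat jm" "real_rational_mat jt"
    unfolding jm_def jt_def J(2) using J(4) by (auto intro!: real_rational_const_mat simp: real_mat_def)
  have GGreal: "real_rational_mat GG"
    unfolding GG2
    by (intro real_rational_mat_add[OF rat_mat_carrier[OF Lc] jSj Lreal]
        real_rational_mat_mult[OF jS c(2)] real_rational_mat_mult[OF c(1) Sc] rj parts(1)[folded S_def])
  have tj: "transpose_mat jm = jt" "transpose_mat jt = jm"
    unfolding jm_def jt_def J(2) rat_mat_transpose const_mat_transpose by simp_all
  have "transpose_mat (jm * S * jt) = transpose_mat jt * transpose_mat (jm * S)" by (rule transpose_mult[OF jS c(2)])
  also have "transpose_mat (jm * S) = S * jt" using transpose_mult[OF c(1) Sc] ST tj by simp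
  also have "transpose_mat jt * (S * jt) = jm * S * jt"
    unfolding tj by (rule assoc_mult_mat[OF c(1) Sc c(2), symmetric])
  finally have "transpose_mat (jm * S * jt) = jm * S * jt" .
  hence GGsym: "symmetric_matrix GG"
    unfolding GG2 symmetric_matrix_def
    using transpose_add[OF rat_mat_carrier[OF Lc] jSj] LT by (simp add: rat_mat_transpose)
  have F: "real_symmetric_rational n G" "real_symmetric_rational (m * n) GG"
    using G GGc GGreal GGsym by (auto intro: real_symmetric_rational.intro)
  have "Ind_CM G = Ind_CM GG"
    by (rule Ind_CM_eqI[OF F];
        rule eig_dominated_compression[OF Pc Lc Sc J(1,3) F(1) GS[folded S_def] F(2) GG2[unfolded jm_def jt_def]])
  moreover have "GG = rat_mat L
            + rat_mat (const_mat (e_col m (m - \<alpha>) \<otimes>\<^sub>K transpose_mat B))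
              * mat_inv (rat_mat (pencil E A))
              * rat_mat (const_mat (transpose_mat (e_col m (m - \<alpha>)) \<otimes>\<^sub>K B))"
    using GG1[unfolded D.transpose_col_B] unfolding R_def D.col_B_def block_col_def .
  ultimately show ?thesis using GGreal GGsym by blast
qed

end
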